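(* Let $G$ be a finite simple connected graph, and let $H$ be the subgraph of $G$ whose edges are the edges of all the $4$-cycles of $G$. Then $G$ is a Freiman graph if and only if one of the following holds: (i) there exist no primitive even walks in $G$; or (ii) $H$ is bipartite of type $(2,s)$ for some integer $s$, and there exist no primitive even walks in $G$ of length $>4$.
   Context: $K$ is a field and $G$ is a finite simple graph on the vertex set $[n]$. Its edge ideal is $I(G)=(x_ix_j : \{i,j\}\in E(G))\subset S=K[x_1,\ldots,x_n]$. $G$ is called a Freiman graph if $I(G)$ is a Freiman ideal, i.e. if $\mu(I(G)^2)=\ell\,\mu(I(G))-\binom{\ell}{2}$, where $\mu$ denotes the minimal number of generators and $\ell=\ell(I(G))$ is the analytic spread, i.e. the Krull dimension of the fiber cone $F(I(G))=\bigoplus_{k\ge 0}I(G)^k/\mathfrak m I(G)^k$, $\mathfrak m=(x_1,\ldots,x_n)$. A walk of length $r$ in $G$ is a sequence of vertices $i_0,i_1,\ldots,i_r$ such that $\{i_j,i_{j+1}\}\in E(G)$ for $j=0,\ldots,r-1$; it is closed if $i_0=i_r$, and a closed walk is even (odd) if $r$ is even (odd). A closed walk is a cycle if the vertices $i_0,\ldots,i_{r-1}$ are pairwise distinct (with $r\geq 3$). A primitive even walk is an even closed walk $W$ of one of the following types: (1) $W$ is an even cycle of $G$; (2) $W=(C_1,C_2)$, where $C_1$ and $C_2$ are odd cycles of $G$ having exactly one common vertex; (3) $W=(C_1,W_1,C_2,W_2)$, where $C_1$ and $C_2$ are odd cycles of $G$ having no common vertex and $W_1,W_2$ are walks of $G$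 both of which connect a vertex $v_1$ of $C_1$ with a vertex $v_2$ of $C_2$. The vertex set of $H$ consists of the vertices lying on $4$-cycles of $G$. A graph is bipartite of type $(2,s)$ if it is bipartite with vertex classes of cardinality $2$ and $s$. *)

theory Defs
  imports
    "HOL-Algebra.QuotRing"
    "HOL-Algebra.Ideal_Product"
    "HOL-Algebra.Algebraic_Closure_Type"
    "HOL-Library.Poly_Mapping"
    "HOL-Library.Extended_Nat"
begin

section \<open>Krull dimension, fiber cone and Freiman ideals\<close>

definition ideal_power :: "('a, 'b) ring_scheme \<Rightarrow> 'a set \<Rightarrow> nat \<Rightarrow> 'a set" where
  "ideal_power R I k = I [^]\<^bsub>ideals_set R\<^esub> k"

definition min_num_gens :: "('a, 'b) ring_scheme \<Rightarrow> 'a set \<Rightarrow> nat" where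
  "min_num_gens R I =
     (LEAST n. \<exists>B. B \<subseteq> carrier R \<and> finite B \<and> card B = n \<and> Idl\<^bsub>R\<^esub> B = I)"

text \<open>The zero ring gets Krull dimension 0 (the supremum of the empty set).\<close>

definition krull_dim :: "('a, 'b) ring_scheme \<Rightarrow> enat" where
  "krull_dim R = Sup {enat r | r. \<exists>P :: nat \<Rightarrow> 'a set.
     (\<forall>i\<le>r. primeideal (P i) R) \<and> (\<forall>i<r. P i \<subset> P (Suc i))}"

text \<open>
  The fiber cone is the direct sum over \<open>k\<close> of \<open>I\<^sup>k / m I\<^sup>k\<close>. Its elements are the families
  of cosets \<open>f k\<close> with \<open>f k\<close> in \<open>I\<^sup>k / m I\<^sup>k\<close> (viewed inside \<open>R / m I\<^sup>k\<close>) and with \<open>f k\<close>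
  the zero coset \<open>m I\<^sup>k\<close> for all but finitely many \<open>k\<close>. The product of a coset of degree \<open>i\<close>
  and one of degree \<open>j\<close> is formed from representatives, modulo \<open>m I\<^sup>i\<^sup>+\<^sup>j\<close>.
\<close>

definition fiber_cone :: "('a, 'b) ring_scheme \<Rightarrow> 'a set \<Rightarrow> 'a set \<Rightarrow> (nat \<Rightarrow> 'a set) ring" where
  "fiber_cone R m I =
     (let J = (\<lambda>k. m \<cdot>\<^bsub>R\<^esub> ideal_power R I k) in
      \<lparr> carrier = {f. (\<forall>k. f k \<in> (\<lambda>a. J k +>\<^bsub>R\<^esub> a) ` ideal_power R I k) \<and>
                      finite {k. f k \<noteq> J k}},
        monoid.mult = (\<lambda>f g k. \<Oplus>\<^bsub>R Quot J k\<^esub>i\<in>{..k}. rcoset_mult R (J k) (f i) (g (k - i))),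
        one = (\<lambda>k. if k = 0 then J 0 +>\<^bsub>R\<^esub> \<one>\<^bsub>R\<^esub> else J k),
        zero = J,
        add = (\<lambda>f g k. f k \<oplus>\<^bsub>R Quot J k\<^esub> g k) \<rparr>)"

definition analytic_spread :: "('a, 'b) ring_scheme \<Rightarrow> 'a set \<Rightarrow> 'a set \<Rightarrow> enat" where
  "analytic_spread R m I = krull_dim (fiber_cone R m I)"

definition freiman_ideal :: "('a, 'b) ring_scheme \<Rightarrow> 'a set \<Rightarrow> 'a set \<Rightarrow> bool" where
  "freiman_ideal R m I \<longleftrightarrow>
     (\<exists>l :: nat. analytic_spread R m I = enat l \<and>
        int (min_num_gens R (ideal_power R I 2)) =
          int l * int (min_num_gens R I) - int (l choose 2))"


section \<open>Edge ideals\<close>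

text \<open>
  The polynomial ring over \<open>'k\<close> in the variables indexed by \<open>'n\<close>: finitely supported functions
  from exponent vectors \<open>'n \<Rightarrow>\<^sub>0 nat\<close> to \<open>'k\<close>.
\<close>

abbreviation mpoly_ring :: "(('n \<Rightarrow>\<^sub>0 nat) \<Rightarrow>\<^sub>0 'k::field) ring" where
  "mpoly_ring \<equiv> ring_of_type_algebra"

definition mvar :: "'n \<Rightarrow> (('n \<Rightarrow>\<^sub>0 nat) \<Rightarrow>\<^sub>0 'k::field)" where
  "mvar i = Poly_Mapping.single (Poly_Mapping.single i 1) 1"

definition irrelevant_ideal :: "(('n \<Rightarrow>\<^sub>0 nat) \<Rightarrow>\<^sub>0 'k::field) set" where
  "irrelevant_ideal = Idl\<^bsub>mpoly_ring\<^esub> (range mvar)"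

definition edge_ideal :: "'n set set \<Rightarrow> (('n \<Rightarrow>\<^sub>0 nat) \<Rightarrow>\<^sub>0 'k::field) set" where
  "edge_ideal E = Idl\<^bsub>mpoly_ring\<^esub> {mvar i * mvar j | i j. {i, j} \<in> E}"

definition freiman_graph :: "'k::field itself \<Rightarrow> 'n::finite set set \<Rightarrow> bool" where
  "freiman_graph K E \<longleftrightarrow>
     freiman_ideal mpoly_ring irrelevant_ideal (edge_ideal E :: (('n \<Rightarrow>\<^sub>0 nat) \<Rightarrow>\<^sub>0 'k) set)"


section \<open>Graphs and walks\<close>

text \<open>
  A graph on the vertex set \<open>UNIV :: 'n set\<close> is given by its set \<open>E\<close> of edges. A walk
  \<open>i\<^sub>0, \<dots>, i\<^sub>r\<close> is the list of its \<open>r + 1\<close> vertices, so a closed walk repeats its first vertex at the end.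
\<close>

definition simple_graph :: "'n set set \<Rightarrow> bool" where
  "simple_graph E \<longleftrightarrow> (\<forall>e\<in>E. card e = 2)"

definition walk :: "'n set set \<Rightarrow> 'n list \<Rightarrow> bool" where
  "walk E p \<longleftrightarrow> p \<noteq> [] \<and> (\<forall>j. Suc j < length p \<longrightarrow> {p ! j, p ! Suc j} \<in> E)"

definition walk_length :: "'n list \<Rightarrow> nat" where
  "walk_length p = length p - 1"

definition walk_between :: "'n set set \<Rightarrow> 'n \<Rightarrow> 'n list \<Rightarrow> 'n \<Rightarrow> bool" where
  "walk_between E u p v \<longleftrightarrow> walk E p \<and> hd p = u \<and> last p = v"

definition connected_graph :: "'n set set \<Rightarrow> bool" where
  "connected_graph E \<longleftrightarrow> (\<forall>u v. \<exists>p. walk_between E u p v)"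

definition closed_walk :: "'n set set \<Rightarrow> 'n list \<Rightarrow> bool" where
  "closed_walk E p \<longleftrightarrow> walk E p \<and> hd p = last p"

definition graph_cycle :: "'n set set \<Rightarrow> 'n list \<Rightarrow> bool" where
  "graph_cycle E p \<longleftrightarrow> closed_walk E p \<and> walk_length p \<ge> 3 \<and> distinct (butlast p)"

definition odd_cycle :: "'n set set \<Rightarrow> 'n list \<Rightarrow> bool" where
  "odd_cycle E p \<longleftrightarrow> graph_cycle E p \<and> odd (walk_length p)"

text \<open>
  Walks are concatenated as \<open>p @ tl q\<close>, the end of \<open>p\<close> being the start of \<open>q\<close>. The cycles
  \<open>c1\<close>, \<open>c2\<close> of the composed types are run through starting from the vertex at which they
  are attached. In the last type \<open>w1\<close> leads from \<open>c1\<close> to \<open>c2\<close> and \<open>w2\<close> leads back; these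
  may be arbitrary walks, subject to the total length being even.
\<close>

inductive primitive_even_walk :: "'n set set \<Rightarrow> 'n list \<Rightarrow> bool" for E where
  even_cycle:
    "graph_cycle E p \<Longrightarrow> even (walk_length p) \<Longrightarrow> primitive_even_walk E p"
| two_cycles:
    "odd_cycle E c1 \<Longrightarrow> odd_cycle E c2 \<Longrightarrow> hd c1 = v \<Longrightarrow> hd c2 = v \<Longrightarrow>
     set c1 \<inter> set c2 = {v} \<Longrightarrow> primitive_even_walk E (c1 @ tl c2)"
| two_cycles_connected:
    "odd_cycle E c1 \<Longrightarrow> odd_cycle E c2 \<Longrightarrow> hd c1 = v1 \<Longrightarrow> hd c2 = v2 \<Longrightarrow>
     set c1 \<inter> set c2 = {} \<Longrightarrow>
     walk_between E v1 w1 v2 \<Longrightarrow> walk_between E v2 w2 v1 \<Longrightarrow>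
     even (walk_length (c1 @ tl w1 @ tl c2 @ tl w2)) \<Longrightarrow>
     primitive_even_walk E (c1 @ tl w1 @ tl c2 @ tl w2)"

definition four_cycle :: "'n set set \<Rightarrow> 'n list \<Rightarrow> bool" where
  "four_cycle E p \<longleftrightarrow> graph_cycle E p \<and> walk_length p = 4"

definition four_cycle_verts :: "'n set set \<Rightarrow> 'n set" where
  "four_cycle_verts E = (\<Union>p\<in>{p. four_cycle E p}. set p)"

definition four_cycle_edges :: "'n set set \<Rightarrow> 'n set set" where
  "four_cycle_edges E =
     (\<Union>p\<in>{p. four_cycle E p}. {{p ! j, p ! Suc j} | j. Suc j < length p})"

definition bipartite_of_type :: "'n set \<Rightarrow> 'n set set \<Rightarrow> nat \<Rightarrow> nat \<Rightarrow> bool" where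
  "bipartite_of_type V F a b \<longleftrightarrow>
     (\<exists>A B. finite A \<and> finite B \<and> A \<inter> B = {} \<and> A \<union> B = V \<and> card A = a \<and> card B = b \<and>
        (\<forall>e\<in>F. \<exists>u\<in>A. \<exists>v\<in>B. e = {u, v}))"

end

theory Submission
  imports Defs "HOL-Analysis.Cartesian_Space"
begin

text \<open>
  Let \<open>q\<close> be the number of edges and \<open>\<ell>\<close> the rank of the incidence vectors of the edges. The proof has an
  algebraic half, which turns the Freiman property into a statement about sums of incidence vectors, and
  a combinatorial half, which decides when that statement holds.

  \<^emph>\<open>Algebra.\<close> The edge ideal \<open>I\<close> is generated by monomials of one degree. Hence the numbers of generators of \<open>I\<close>
  and \<open>I\<^sup>2\<close> are the numbers \<open>q\<close> of edges and \<open>s\<close> of distinct sums of two edges, and the fiber cone is the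
  algebra of the monoid \<open>M\<close> generated by the edges (\<open>fiber_cone_iso\<close>). The Krull dimension of such an algebra is the
  size of a minimal set \<open>T\<close> of coordinates that separates the points of \<open>M\<close> (\<open>krull_dim_alg_ring\<close>). It is at
  least that large because putting the variables outside \<open>T\<close>, and then those of \<open>T\<close> one after the other, equal
  to \<open>1\<close> gives maps to domains with strictly growing kernels. It is at most that large because more than
  \<open>|T|\<close> elements are algebraically dependent, by counting monomials, and an algebraic relation between elements that
  witness the strict inclusions of a chain of primes is absurd (\<open>no_relation_along_chain\<close>). By clearing denominators,
  \<open>|T| = \<ell>\<close>. So \<open>G\<close> is Freiman iff the integer \<open>gap = s - \<ell> q + (\<ell> choose 2)\<close> vanishes (\<open>freiman_graph_iff_gap\<close>).

  \<^emph>\<open>Combinatorics.\<close> Remove an edge \<open>e\<close>. If \<open>e\<close> is not a linear combination of the other edges, the gap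
  does not change. Otherwise it drops by \<open>q - c - \<ell>\<close>, where \<open>c\<close> counts the edges opposite to \<open>e\<close> in a 4-cycle.
  Every opposite edge is a combination of \<open>e\<close> and of edges that meet \<open>e\<close>, so \<open>c \<le> q - \<ell>\<close>. Therefore the gap is never
  negative, and gap \<open>0\<close> is inherited by all subgraphs. Moreover, if the gap is \<open>0\<close> and \<open>e\<close> depends on the other
  edges, then the edges that are not opposite to \<open>e\<close>, with \<open>e\<close> among them, are linearly independent
  (\<open>gap_zero_independent\<close>). In particular two disjoint edges that both occur in linear relations are opposite in a
  4-cycle (\<open>gap_zero_disjoint_edges\<close>).

  Applied to suitable subgraphs, this last property excludes even cycles of length above 4 and linked odd
  cycles, so that every primitive even walk is a 4-cycle. Applied to the union of two 4-cycles with
  different vertex sets it shows that they share a diagonal, while the independence of the non-opposite edges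
  excludes two 4-cycles on the same four vertices, which would form a \<open>K\<^sub>4\<close>; then all 4-cycles share one, and \<open>H\<close> is complete bipartite on this diagonal and the
  remaining vertices. Conversely, a graph without primitive even walks has independent edges
  (\<open>no_primitive_independent\<close>: look at a longest path in the support of a relation) and thus gap \<open>0\<close>. If all
  primitive even walks are 4-cycles with a common diagonal \<open>{u, v}\<close>, take a 4-cycle \<open>u x v y\<close> and remove
  the edge \<open>v x\<close>: the edges that are not opposite to it contain no 4-cycle, hence are independent, and so
  the gap does not change.
\<close>

no_notation fps_nth (infixl "$" 75)

section \<open>Sums of edges and the gap in the Freiman inequality\<close>

text \<open>
  The incidence vectors are rational because the analytic spread will turn out to be their rank over
  \<open>\<rat>\<close>, whatever the field of coefficients of the edge ideal is.
\<close>

definition inc :: "'n::finite set \<Rightarrow> rat ^ 'n" where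
  "inc e = (\<chi> i. if i \<in> e then 1 else 0)"

lemma inc_nth: "inc e $ i = (if i \<in> e then 1 else 0)"
  by (simp add: inc_def)

lemma inj_inc: "inj inc"
  by (rule injI) (auto simp: inc_def vec_eq_iff split: if_splits)

lemma inc_image_diff: "inc ` (A - B) = inc ` A - inc ` B"
  by (rule image_set_diff[OF inj_inc])

definition edge_sums :: "'n::finite set set \<Rightarrow> (rat ^ 'n) set" where
  "edge_sums F = (\<lambda>(e, f). inc e + inc f) ` (F \<times> F)"

definition edge_rank :: "'n::finite set set \<Rightarrow> nat" where
  "edge_rank F = vec.dim (inc ` F)"

text \<open>
  In a simple graph these are the edges opposite to \<open>e\<close> in a 4-cycle (\<open>mem_oppositeE\<close>). The
  formulation by vectors says when the sum of \<open>e\<close> and \<open>f\<close> survives the removal of \<open>e\<close>.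
\<close>

definition opposite :: "'n::finite set set \<Rightarrow> 'n set \<Rightarrow> 'n set set" where
  "opposite F e = {f \<in> F. \<exists>g\<in>F - {e}. \<exists>h\<in>F - {e}. inc e + inc f = inc g + inc h}"

text \<open>
  The two sides of the Freiman equation for the edge ideal differ by this number.
\<close>

definition gap :: "'n::finite set set \<Rightarrow> int" where
  "gap F = int (card (edge_sums F)) - int (edge_rank F) * int (card F) + int (edge_rank F choose 2)"

lemma opposite_subset: "opposite F e \<subseteq> F"
  by (auto simp: opposite_def)

lemma mem_edge_sums_iff: "x \<in> edge_sums F \<longleftrightarrow> (\<exists>g\<in>F. \<exists>h\<in>F. x = inc g + inc h)"
  unfolding edge_sums_def by (simp add: image_iff)

lemma mem_opposite_iff:
  "f \<in> opposite F e \<longleftrightarrow> f \<in> F \<and> inc e + inc f \<in> edge_sums (F - {e})"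
  unfolding opposite_def mem_edge_sums_iff by blast

text \<open>
  Removing \<open>e\<close> destroys sums of the form \<open>e + f\<close> only, and such a sum remains a sum of two other edges
  exactly when \<open>f\<close> is opposite to \<open>e\<close>.
\<close>

lemma card_edge_sums_remove:
  fixes F :: "'n::finite set set"
  assumes "e \<in> F"
  shows "card (edge_sums F) = card (edge_sums (F - {e})) + (card F - card (opposite F e))"
proof -
  let ?new = "(\<lambda>f. inc e + inc f) ` (F - opposite F e)"
  have "edge_sums F = edge_sums (F - {e}) \<union> ?new"
  proof (intro equalityI subsetI)
    fix x assume "x \<in> edge_sums F"
    then obtain f g where fg: "f \<in> F" "g \<in> F" "x = inc f + inc g"
      unfolding mem_edge_sums_iff by blast
    show "x \<in> edge_sums (F - {e}) \<union> ?new"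
    proof (cases "f \<noteq> e \<and> g \<noteq> e")
      case True
      then show ?thesis using fg unfolding mem_edge_sums_iff Un_iff by blast
    next
      case False
      then obtain h where "h \<in> F" "x = inc e + inc h"
        using fg by (metis add.commute)
      then show ?thesis by (cases "h \<in> opposite F e") (simp_all add: mem_opposite_iff)
    qed
  next
    fix x assume "x \<in> edge_sums (F - {e}) \<union> ?new"
    then show "x \<in> edge_sums F" using assms unfolding mem_edge_sums_iff Un_iff by blast
  qed
  moreover have "edge_sums (F - {e}) \<inter> ?new = {}"
    using mem_opposite_iff by blast
  moreover have "card ?new = card F - card (opposite F e)"
    by (subst card_image) (auto simp: inj_on_def inj_eq[OF inj_inc] card_Diff_subset opposite_subset)
  moreover have "finite (edge_sums (F - {e}))"
    by (simp add: edge_sums_def)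
  ultimately show ?thesis
    by (simp add: card_Un_disjoint)
qed

lemma edge_rank_remove_span:
  assumes "e \<in> F" "inc e \<in> vec.span (inc ` (F - {e}))"
  shows "edge_rank F = edge_rank (F - {e})"
proof -
  have "inc ` F = insert (inc e) (inc ` (F - {e}))" using assms by auto
  then show ?thesis using assms by (simp add: edge_rank_def vec.dim_insert)
qed

lemma edge_rank_remove_not_span:
  assumes "e \<in> F" "inc e \<notin> vec.span (inc ` (F - {e}))"
  shows "edge_rank F = Suc (edge_rank (F - {e}))"
proof -
  have "inc ` F = insert (inc e) (inc ` (F - {e}))" using assms by auto
  then show ?thesis using assms by (simp add: edge_rank_def vec.dim_insert)
qed

lemma choose_two_Suc: "Suc n choose 2 = (n choose 2) + n"
  by (simp add: numeral_2_eq_2)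

text \<open>
  An exchange \<open>e + f = g + h\<close> expresses \<open>e\<close> by other edges.
\<close>

lemma opposite_empty_if_not_span:
  fixes F :: "'n::finite set set"
  assumes "inc e \<notin> vec.span (inc ` (F - {e}))"
  shows "opposite F e = {}"
proof (rule ccontr)
  assume "opposite F e \<noteq> {}"
  then obtain f g h where *: "f \<in> F" "g \<in> F - {e}" "h \<in> F - {e}" "inc e + inc f = inc g + inc h"
    by (auto simp: opposite_def)
  have span: "inc x \<in> vec.span (inc ` (F - {e}))" if "x \<in> F - {e}" for x
    using that by (auto intro: vec.span_base)
  show False
  proof (cases "f = e")
    case True
    have "inc e = (1/2) *s (inc e + inc f)"
      using True by (simp add: vec_eq_iff)
    then have "inc e = (1/2) *s (inc g + inc h)"
      using *(4) by simp
    then show False using assms * by (metis vec.span_add vec.span_scale span)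
  next
    case False
    have "inc e = inc g + inc h - inc f" using * by (simp add: algebra_simps)
    then show False using assms * False by (metis vec.span_add vec.span_diff span Diff_iff singletonD)
  qed
qed

lemma gap_remove_not_span:
  fixes F :: "'n::finite set set"
  assumes "e \<in> F" "inc e \<notin> vec.span (inc ` (F - {e}))"
  shows "gap F = gap (F - {e})"
proof -
  have q: "card F = Suc (card (F - {e}))"
    using assms by (metis card_Suc_Diff1 finite)
  show ?thesis
    unfolding gap_def card_edge_sums_remove[OF assms(1)] opposite_empty_if_not_span[OF assms(2)]
      edge_rank_remove_not_span[OF assms] q choose_two_Suc
    by (simp add: algebra_simps)
qed

lemma gap_remove_span:
  fixes F :: "'n::finite set set"
  assumes "e \<in> F" "inc e \<in> vec.span (inc ` (F - {e}))"
  shows "gap F = gap (F - {e}) + (int (card (F - opposite F e)) - int (edge_rank F))"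
proof -
  have q: "int (card F) = int (card (F - {e})) + 1"
    using assms by (metis card_Suc_Diff1 finite of_nat_Suc add.commute)
  have c: "card (F - opposite F e) = card F - card (opposite F e)"
    by (simp add: card_Diff_subset opposite_subset)
  show ?thesis
    unfolding gap_def card_edge_sums_remove[OF assms(1)] edge_rank_remove_span[OF assms, symmetric] c q
    by (simp add: algebra_simps)
qed

text \<open>
  Comparing coordinates shows that \<open>e, f\<close> and \<open>g, h\<close> have the same union and the same intersection. A common
  vertex of \<open>e\<close> and \<open>f\<close> would lie on \<open>g\<close> and \<open>h\<close> and force one of them to be \<open>e\<close>; so \<open>e\<close> and \<open>f\<close> are disjoint,
  and \<open>g\<close> has one end in each of them.
\<close>

lemma edge_sum_exchange:
  fixes e f g h :: "'n::finite set"
  assumes "card e = 2" "card f = 2" "card g = 2" "card h = 2"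
    and eq: "inc e + inc f = inc g + inc h" and "g \<noteq> e" "h \<noteq> e"
  obtains a b c d where "e = {a, b}" "f = {c, d}" "g = {b, c}" "h = {a, d}"
    "distinct [a, b, c, d]"
proof -
  obtain a b where e: "e = {a, b}" "a \<noteq> b" using assms(1) by (auto simp: card_2_iff)
  obtain c d where f: "f = {c, d}" "c \<noteq> d" using assms(2) by (auto simp: card_2_iff)
  obtain x y where g: "g = {x, y}" "x \<noteq> y" using assms(3) by (auto simp: card_2_iff)
  obtain z w where h: "h = {z, w}" "z \<noteq> w" using assms(4) by (auto simp: card_2_iff)
  have *: "(if i \<in> e then 1 else 0) + (if i \<in> f then 1 else 0 :: rat)
      = (if i \<in> g then 1 else 0) + (if i \<in> h then 1 else 0)" for i
    using eq by (auto simp: vec_eq_iff inc_nth)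
  have *: "(i \<in> e \<or> i \<in> f \<longleftrightarrow> i \<in> g \<or> i \<in> h) \<and> (i \<in> e \<and> i \<in> f \<longleftrightarrow> i \<in> g \<and> i \<in> h)" for i
    using *[of i] by (cases "i \<in> e"; cases "i \<in> f"; cases "i \<in> g"; cases "i \<in> h") simp_all
  have un: "e \<union> f = g \<union> h" and int: "e \<inter> f = g \<inter> h"
    using * by blast+
  have disj: "e \<inter> f = {}"
  proof (rule ccontr)
    assume "e \<inter> f \<noteq> {}"
    then obtain i where i: "i \<in> e" "i \<in> f" "i \<in> g" "i \<in> h" using int by auto
    obtain j where j: "e = {i, j}" "j \<noteq> i" using i e by auto
    have "j \<notin> g" using i j g \<open>g \<noteq> e\<close> by (metis insertE insert_commute singletonD)
    moreover have "j \<notin> h" using i j h \<open>h \<noteq> e\<close> by (metis insertE insert_commute singletonD)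
    ultimately show False using un j by auto
  qed
  have h': "h = (e \<union> f) - g" using un int disj by blast
  have "g \<noteq> f" using h' disj \<open>h \<noteq> e\<close> by blast
  have "\<not> g \<subseteq> e" "\<not> g \<subseteq> f"
    using \<open>g \<noteq> e\<close> \<open>g \<noteq> f\<close> assms by (metis card_subset_eq finite)+
  moreover have "g \<subseteq> e \<union> f" using un by blast
  ultimately obtain b' c' where "b' \<in> g" "b' \<in> e" "c' \<in> g" "c' \<in> f" by blast
  moreover from this have "b' \<noteq> c'" using disj by blast
  ultimately have bc: "g = {b', c'}" "b' \<in> e" "c' \<in> f"
    using g by blast+
  obtain a' where a': "e = {a', b'}" "a' \<noteq> b'" using bc(2) e by blast
  obtain d' where d': "f = {c', d'}" "d' \<noteq> c'" using bc(3) f by blast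
  have ne: "a' \<noteq> c'" "a' \<noteq> d'" "b' \<noteq> c'" "b' \<noteq> d'" using disj a' d' by blast+
  have "h = {a', d'}" unfolding h' bc a' d' using ne a' d' by blast
  show ?thesis
    by (rule that[OF a'(1) d'(1) bc(1) \<open>h = {a', d'}\<close>]) (use a'(2) d'(2) ne in simp)
qed

lemma mem_oppositeE:
  fixes F :: "'n::finite set set"
  assumes "simple_graph F" "e \<in> F" "f \<in> opposite F e"
  obtains a b c d where "e = {a, b}" "f = {c, d}" "{b, c} \<in> F" "{a, d} \<in> F"
    "distinct [a, b, c, d]"
proof -
  obtain g h where gh: "f \<in> F" "g \<in> F - {e}" "h \<in> F - {e}" "inc e + inc f = inc g + inc h"
    using assms(3) by (auto simp: opposite_def)
  have "card e = 2" "card f = 2" "card g = 2" "card h = 2"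
    using gh assms by (auto simp: simple_graph_def)
  then show ?thesis
    using edge_sum_exchange[of e f g h] gh that by (metis Diff_iff insertI1)
qed

text \<open>
  In the 4-cycle \<open>a b c d\<close> one has \<open>cd = bc + ad - ab\<close>, and the edges on the right meet \<open>ab\<close>, while opposite
  edges are disjoint from it.
\<close>

lemma opposite_in_span:
  fixes F :: "'n::finite set set"
  assumes "simple_graph F" "e \<in> F" "f \<in> opposite F e"
  shows "inc f \<in> vec.span (inc ` {g \<in> F - opposite F e. g \<inter> e \<noteq> {}})"
proof -
  obtain a b c d where *: "e = {a, b}" "f = {c, d}" "{b, c} \<in> F" "{a, d} \<in> F"
    "distinct [a, b, c, d]"
    using mem_oppositeE[OF assms] .
  define S where "S = {g \<in> F - opposite F e. g \<inter> e \<noteq> {}}"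
  have "g \<inter> e = {}" if g: "g \<in> opposite F e" for g
    by (rule mem_oppositeE[OF assms(1,2) g]) auto
  then have "g \<in> S" if "g \<in> F" "g \<inter> e \<noteq> {}" for g
    using that by (auto simp: S_def)
  then have S: "{b, c} \<in> S" "{a, d} \<in> S" "e \<in> S"
    using *(1,3,4) assms(2) by blast+
  have "inc f = inc {b, c} + inc {a, d} - inc e"
    unfolding *(1,2) vec_eq_iff using *(5) by (auto simp: inc_nth)
  then have "inc f \<in> vec.span (inc ` S)"
    using S by (simp add: vec.span_add vec.span_diff vec.span_base)
  then show ?thesis by (simp add: S_def)
qed

lemma span_minus_opposite:
  fixes F :: "'n::finite set set"
  assumes "simple_graph F" "e \<in> F"
  shows "vec.span (inc ` (F - opposite F e)) = vec.span (inc ` F)"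
proof
  show "vec.span (inc ` (F - opposite F e)) \<subseteq> vec.span (inc ` F)"
    by (rule vec.span_mono[OF image_mono[OF Diff_subset]])
  have "inc f \<in> vec.span (inc ` (F - opposite F e))" if "f \<in> F" for f
  proof (cases "f \<in> opposite F e")
    case True
    show ?thesis
      by (rule subsetD[OF vec.span_mono[OF image_mono] opposite_in_span[OF assms True]]) blast
  next
    case False
    then show ?thesis using that by (auto intro: vec.span_base)
  qed
  then show "vec.span (inc ` F) \<subseteq> vec.span (inc ` (F - opposite F e))"
    by (intro vec.span_minimal) (auto simp: vec.subspace_span)
qed

lemma edge_rank_minus_opposite:
  fixes F :: "'n::finite set set"
  assumes "simple_graph F" "e \<in> F"
  shows "edge_rank (F - opposite F e) = edge_rank F"
  using span_minus_opposite[OF assms] unfolding edge_rank_def by (metis vec.dim_span)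

lemma edge_rank_le_card: "edge_rank (F :: 'n::finite set set) \<le> card F"
  unfolding edge_rank_def by (rule order_trans[OF vec.dim_le_card'[OF finite_imageI[OF finite]] card_image_le[OF finite]])

lemma independent_iff_edge_rank: "vec.independent (inc ` F) \<longleftrightarrow> edge_rank (F :: 'n::finite set set) = card F"
proof -
  have "card (inc ` F) = card F" by (simp add: card_image inj_on_subset[OF inj_inc])
  then show ?thesis
    unfolding edge_rank_def
    using vec.card_eq_dim[OF subset_refl, of "inc ` F"] vec.dim_eq_card_independent[of "inc ` F"]
      vec.span_superset[of "inc ` F"] by auto
qed

lemma simple_graph_subset: "simple_graph F \<Longrightarrow> F' \<subseteq> F \<Longrightarrow> simple_graph F'"
  by (auto simp: simple_graph_def)

text \<open>
  This step contains the Freiman inequality: the rank of \<open>F\<close> is attained by the edges that are not opposite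
  to \<open>e\<close>, hence bounded by their number.
\<close>

lemma gap_remove_le:
  fixes F :: "'n::finite set set"
  assumes "simple_graph F" "e \<in> F"
  shows "gap (F - {e}) \<le> gap F"
proof (cases "inc e \<in> vec.span (inc ` (F - {e}))")
  case True
  then show ?thesis
    using gap_remove_span[OF assms(2) True] edge_rank_minus_opposite[OF assms] edge_rank_le_card[of "F - opposite F e"] by simp
next
  case False
  then show ?thesis using gap_remove_not_span[OF assms(2)] by simp
qed

lemma gap_mono:
  fixes F :: "'n::finite set set"
  assumes "simple_graph F" "F' \<subseteq> F"
  shows "gap F' \<le> gap F"
proof -
  have "finite (F - F')" by simp
  then have "F - F' \<subseteq> F \<Longrightarrow> gap (F - (F - F')) \<le> gap F"
  proof (induction rule: finite_induct)
    case empty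
    then show ?case by simp
  next
    case (insert e A)
    have "F - insert e A = (F - A) - {e}" by auto
    moreover have "gap ((F - A) - {e}) \<le> gap (F - A)"
      by (rule gap_remove_le) (use insert assms simple_graph_subset[OF assms(1), of "F - A"] in auto)
    ultimately show ?case using insert by simp
  qed
  moreover have "F - (F - F') = F'" using assms by auto
  ultimately show ?thesis by auto
qed

lemma gap_empty: "gap ({} :: 'n::finite set set) = 0"
  by (simp add: gap_def edge_sums_def edge_rank_def)

lemma gap_nonneg:
  fixes F :: "'n::finite set set"
  assumes "simple_graph F"
  shows "gap F \<ge> 0"
  using gap_mono[OF assms, of "{}"] by (simp add: gap_empty)

text \<open>
  Equality in the Freiman inequality is inherited by subgraphs. This is what reduces the structure of a
  Freiman graph to the discussion of small configurations.
\<close>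

lemma gap_zero_subset:
  fixes F :: "'n::finite set set"
  assumes "simple_graph F" "gap F = 0" "F' \<subseteq> F"
  shows "gap F' = 0"
  using gap_mono[OF assms(1,3)] gap_nonneg[OF simple_graph_subset[OF assms(1,3)]] assms(2) by simp

text \<open>
  When the gap vanishes before and after the removal of \<open>e\<close>, the non-opposite edges are as many as the rank
  which they attain.
\<close>

lemma gap_zero_independent:
  fixes F :: "'n::finite set set"
  assumes "simple_graph F" "gap F = 0" "e \<in> F" "inc e \<in> vec.span (inc ` (F - {e}))"
  shows "vec.independent (inc ` (F - opposite F e))"
proof -
  have "gap (F - {e}) = 0" by (rule gap_zero_subset[OF assms(1,2)]) auto
  then have "card (F - opposite F e) = edge_rank F"
    using gap_remove_span[OF assms(3,4)] assms(2) by simp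
  then show ?thesis using edge_rank_minus_opposite[OF assms(1,3)] by (simp add: independent_iff_edge_rank)
qed

text \<open>
  If \<open>f\<close> were not opposite to \<open>e\<close>, then in a relation for \<open>f\<close> one could replace all edges opposite to \<open>e\<close> by
  edges that meet \<open>e\<close>, hence differ from \<open>f\<close>. This would be a relation between non-opposite edges.
\<close>

lemma gap_zero_disjoint_edges:
  fixes F :: "'n::finite set set"
  assumes "simple_graph F" "gap F = 0"
    and e: "e \<in> F" "inc e \<in> vec.span (inc ` (F - {e}))"
    and f: "f \<in> F" "inc f \<in> vec.span (inc ` (F - {f}))"
    and "e \<inter> f = {}"
  shows "f \<in> opposite F e"
proof (rule ccontr)
  assume nf: "f \<notin> opposite F e"
  have "inc ` (F - {f}) \<subseteq> vec.span (inc ` (F - opposite F e - {f}))"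
  proof (rule image_subsetI)
    fix g assume "g \<in> F - {f}"
    then have g: "g \<in> F" "g \<noteq> f" by auto
    show "inc g \<in> vec.span (inc ` (F - opposite F e - {f}))"
    proof (cases "g \<in> opposite F e")
      case True
      show ?thesis
        by (rule subsetD[OF vec.span_mono[OF image_mono] opposite_in_span[OF assms(1) e(1) True]])
          (use assms(7) in blast)
    qed (use g in \<open>auto intro: vec.span_base\<close>)
  qed
  then have "vec.span (inc ` (F - {f})) \<subseteq> vec.span (inc ` (F - opposite F e - {f}))"
    by (intro vec.span_minimal) (auto simp: vec.subspace_span)
  then have "inc f \<in> vec.span (inc ` (F - opposite F e) - {inc f})"
    using f(2) by (auto simp: inc_image_diff)
  then have "vec.dependent (inc ` (F - opposite F e))"
    using f(1) nf by (auto simp: vec.dependent_def)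
  then show False using gap_zero_independent[OF assms(1,2) e] by simp
qed

lemma gap_independent:
  fixes F :: "'n::finite set set"
  assumes "vec.independent (inc ` F)"
  shows "gap F = 0"
proof -
  have "finite F" by simp
  then have "vec.independent (inc ` F) \<longrightarrow> gap F = 0"
  proof (induction rule: finite_induct)
    case empty
    then show ?case by (simp add: gap_empty)
  next
    case (insert e F)
    show ?case
    proof
      assume ind: "vec.independent (inc ` insert e F)"
      have eq: "insert e F - {e} = F" using insert(2) by blast
      have "inc e \<notin> vec.span (inc ` F)"
        using ind insert(2) by (simp add: vec.independent_insert inj_image_mem_iff[OF inj_inc])
      then have "gap (insert e F) = gap F"
        using gap_remove_not_span[of e "insert e F", unfolded eq, OF insertI1] by blast
      moreover have "vec.independent (inc ` F)"
        by (rule vec.independent_mono[OF ind]) blast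
      ultimately show "gap (insert e F) = 0" using insert by simp
    qed
  qed
  then show ?thesis using assms by simp
qed

text \<open>
  The converse of \<open>gap_zero_independent\<close>, used to build up graphs with gap zero edge by edge.
\<close>

lemma gap_zeroI:
  fixes F :: "'n::finite set set"
  assumes "simple_graph F" "e \<in> F" "gap (F - {e}) = 0"
    and "vec.independent (inc ` (F - opposite F e))"
  shows "gap F = 0"
proof (cases "inc e \<in> vec.span (inc ` (F - {e}))")
  case True
  then show ?thesis
    using gap_remove_span[OF assms(2) True] assms(3,4) edge_rank_minus_opposite[OF assms(1,2)]
    by (simp add: independent_iff_edge_rank)
next
  case False
  then show ?thesis using gap_remove_not_span[OF assms(2)] assms by simp
qed

section \<open>Graphs without primitive even walks\<close>

lemma simple_graph_edge_other:
  assumes "simple_graph F" "f \<in> F" "v \<in> f"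
  obtains y where "f = {v, y}" "y \<noteq> v"
proof -
  have "card f = 2" using assms by (simp add: simple_graph_def)
  then obtain a b where "f = {a, b}" "a \<noteq> b" by (meson card_2_iff)
  then show ?thesis using assms(3) that by blast
qed

lemma simple_graph_no_loop: "simple_graph F \<Longrightarrow> {u, v} \<in> F \<Longrightarrow> u \<noteq> v"
  by (fastforce simp: simple_graph_def)

lemma walk_singleton [simp]: "walk F [x]"
  by (simp add: walk_def)

lemma walk_Cons: "walk F (x # y # p) \<longleftrightarrow> {x, y} \<in> F \<and> walk F (y # p)"
  by (auto simp: walk_def nth_Cons split: nat.splits)

lemma walk_append_iff:
  assumes "xs \<noteq> []" "ys \<noteq> []"
  shows "walk F (xs @ ys) \<longleftrightarrow> walk F xs \<and> {last xs, hd ys} \<in> F \<and> walk F ys"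
  using assms
proof (induction xs rule: induct_list012)
  case (2 x)
  then show ?case by (cases ys) (auto simp: walk_Cons)
next
  case (3 x y zs)
  then show ?case by (auto simp: walk_Cons)
qed simp

lemma walk_rev: "walk F p \<Longrightarrow> walk F (rev p)"
proof (induction p rule: induct_list012)
  case (3 x y zs)
  then show ?case
    using walk_append_iff[of "rev zs @ [y]" "[x]" F] by (simp add: walk_Cons insert_commute)
qed simp_all

lemma walk_take: "walk F p \<Longrightarrow> 0 < n \<Longrightarrow> walk F (take n p)"
  by (auto simp: walk_def)

lemma walk_drop: "walk F p \<Longrightarrow> n < length p \<Longrightarrow> walk F (drop n p)"
  by (auto simp: walk_def)

lemma walk_mono: "walk F p \<Longrightarrow> F \<subseteq> F' \<Longrightarrow> walk F' p"
  by (auto simp: walk_def)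

text \<open>
  A cycle without its repeated end vertex, so that rotation and reversal are list operations.
\<close>

definition cyc :: "'n set set \<Rightarrow> 'n list \<Rightarrow> bool" where
  "cyc F xs \<longleftrightarrow> 3 \<le> length xs \<and> distinct xs \<and> walk F xs \<and> {last xs, hd xs} \<in> F"

lemma graph_cycle_iff_cyc: "graph_cycle F p \<longleftrightarrow> (\<exists>xs. cyc F xs \<and> p = xs @ [hd xs])"
proof
  assume *: "graph_cycle F p"
  then have "p \<noteq> []" by (auto simp: graph_cycle_def closed_walk_def walk_def)
  then obtain xs x where p: "p = xs @ [x]" by (metis rev_exhaust)
  have "length xs \<ge> 3" using * p by (simp add: graph_cycle_def walk_length_def)
  then have "xs \<noteq> []" by auto
  have "x = hd xs" using * p \<open>xs \<noteq> []\<close> by (simp add: graph_cycle_def closed_walk_def)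
  moreover have "cyc F xs"
    using * \<open>length xs \<ge> 3\<close> \<open>xs \<noteq> []\<close> unfolding cyc_def graph_cycle_def closed_walk_def p \<open>x = hd xs\<close>
    by (simp add: walk_append_iff)
  ultimately show "\<exists>xs. cyc F xs \<and> p = xs @ [hd xs]" using p by blast
next
  assume "\<exists>xs. cyc F xs \<and> p = xs @ [hd xs]"
  then obtain xs where *: "cyc F xs" "p = xs @ [hd xs]" by blast
  then have "xs \<noteq> []" by (auto simp: cyc_def)
  then show "graph_cycle F p"
    using * unfolding cyc_def graph_cycle_def closed_walk_def walk_length_def
    by (simp add: walk_append_iff)
qed

lemma odd_cycle_iff_cyc:
  "odd_cycle F p \<longleftrightarrow> (\<exists>xs. cyc F xs \<and> odd (length xs) \<and> p = xs @ [hd xs])"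
  unfolding odd_cycle_def graph_cycle_iff_cyc by (auto simp: walk_length_def)

lemma cyc_rotate: "cyc F (xs @ ys) \<Longrightarrow> cyc F (ys @ xs)"
proof (cases "xs = [] \<or> ys = []")
  case False
  assume "cyc F (xs @ ys)"
  with False show ?thesis by (auto simp: cyc_def walk_append_iff)
qed auto

lemma cyc_rev: "cyc F xs \<Longrightarrow> cyc F (rev xs)"
  by (auto simp: cyc_def walk_rev hd_rev last_rev insert_commute)

lemma cyc_mono: "cyc F xs \<Longrightarrow> F \<subseteq> F' \<Longrightarrow> cyc F' xs"
  by (auto simp: cyc_def intro: walk_mono)

definition no_primitive :: "'n set set \<Rightarrow> bool" where
  "no_primitive F \<longleftrightarrow> (\<nexists>W. primitive_even_walk F W)"

lemma odd_length_cyc: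
  assumes "no_primitive F" "cyc F xs"
  shows "odd (length xs)"
proof
  assume "even (length xs)"
  then have "primitive_even_walk F (xs @ [hd xs])"
    using assms(2) by (intro even_cycle) (auto simp: graph_cycle_iff_cyc walk_length_def)
  then show False using assms(1) by (auto simp: no_primitive_def)
qed

lemma last_take_Suc: "i < length p \<Longrightarrow> last (take (Suc i) p) = p ! i"
  by (simp add: take_Suc_conv_app_nth)

lemma cyc_take:
  assumes "distinct p" "walk F p" "{p ! 0, p ! i} \<in> F" "2 \<le> i" "i < length p"
  shows "cyc F (take (Suc i) p)"
proof -
  have "p \<noteq> []" using assms(5) by auto
  then show ?thesis
    using assms by (auto simp: cyc_def walk_take last_take_Suc insert_commute hd_conv_nth)
qed

text \<open>
  Neighbours \<open>v\<^sub>i\<close> and \<open>v\<^sub>j\<close> of the start \<open>v\<^sub>0\<close> of a path close up cycles of lengths \<open>i + 1\<close>, \<open>j + 1\<close> and \<open>j - i + 2\<close>.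
  Their sum is even, so one of the three would be an even cycle.
\<close>

lemma back_edge_unique:
  assumes "no_primitive F" and p: "distinct p" "walk F p"
    and i: "{p ! 0, p ! i} \<in> F" "2 \<le> i" "i < length p"
    and j: "{p ! 0, p ! j} \<in> F" "2 \<le> j" "j < length p"
  shows "i = j"
proof -
  have *: False if i: "{p ! 0, p ! i} \<in> F" "2 \<le> i" "i < length p"
    and j: "{p ! 0, p ! j} \<in> F" "2 \<le> j" "j < length p" and "i < j" for i j
  proof -
    have ev: "even i" "even j"
      using odd_length_cyc[OF assms(1) cyc_take[OF p i]] odd_length_cyc[OF assms(1) cyc_take[OF p j]]
        i j by auto
    let ?q = "drop i (take (Suc j) p)"
    have q: "?q \<noteq> []" "hd ?q = p ! i" "last ?q = p ! j"
      using i j \<open>i < j\<close> by (auto simp: hd_drop_conv_nth last_take_Suc)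
    obtain m where m: "j - i = Suc m" using \<open>i < j\<close> by (metis Suc_diff_Suc)
    have "p ! 0 \<notin> set ?q"
    proof
      assume "p ! 0 \<in> set ?q"
      then have "p ! 0 \<in> set (drop i p)" by (metis drop_take in_set_takeD)
      moreover have "p ! 0 \<in> set (take i p)" using i by (auto simp: in_set_conv_nth intro!: exI[of _ 0])
      ultimately show False using set_take_disj_set_drop_if_distinct[OF p(1), of i i] by auto
    qed
    moreover have "walk F ?q" using p(2) i j \<open>i < j\<close> by (intro walk_drop walk_take) auto
    ultimately have "cyc F (p ! 0 # ?q)"
      using i j p(1) \<open>i < j\<close> q ev m unfolding cyc_def
      using walk_append_iff[of "[p ! 0]" ?q F]
      by (auto simp: insert_commute)
    from odd_length_cyc[OF assms(1) this] show False
      using ev i j \<open>i < j\<close> by auto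
  qed
  show ?thesis using *[OF i j] *[OF j i] by (meson linorder_neqE_nat)
qed

definition maximal_path :: "'n set set \<Rightarrow> 'n list \<Rightarrow> bool" where
  "maximal_path F p \<longleftrightarrow> distinct p \<and> walk F p \<and> 2 \<le> length p \<and>
     (\<forall>q. distinct q \<longrightarrow> walk F q \<longrightarrow> length q \<le> length p)"

lemma maximal_path_nbr:
  assumes "maximal_path F p" "{p ! 0, y} \<in> F"
  shows "y \<in> set p"
proof (rule ccontr)
  assume "y \<notin> set p"
  moreover have "p \<noteq> []" using assms by (auto simp: maximal_path_def)
  ultimately have "distinct (y # p)" "walk F (y # p)"
    using assms walk_append_iff[of "[y]" p F] by (auto simp: maximal_path_def hd_conv_nth insert_commute)
  then have "length (y # p) \<le> length p" using assms unfolding maximal_path_def by blast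
  then show False by simp
qed

lemma maximal_path_rev: "maximal_path F p \<Longrightarrow> maximal_path F (rev p)"
  by (auto simp: maximal_path_def walk_rev)

lemma maximal_path_exists:
  fixes F :: "'n::finite set set"
  assumes "simple_graph F" "F \<noteq> {}"
  obtains p where "maximal_path F p"
proof -
  obtain e where "e \<in> F" using assms by blast
  moreover from this obtain a b where "e = {a, b}" "a \<noteq> b"
    using assms by (metis simple_graph_def card_2_iff)
  ultimately have 0: "distinct [a, b] \<and> walk F [a, b]" by (auto simp: walk_Cons)
  define P where "P p \<longleftrightarrow> distinct p \<and> walk F p" for p
  have "\<forall>p. P p \<longrightarrow> length p < Suc (card (UNIV :: 'n set))"
    using distinct_card[symmetric] card_mono[OF finite subset_UNIV] by (fastforce simp: P_def less_Suc_eq_le)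
  from ex_has_greatest_nat[of P "[a, b]" length "Suc (card (UNIV :: 'n set))"] 0 this
  obtain p where p: "P p" "\<forall>q. P q \<longrightarrow> length q \<le> length p"
    unfolding P_def[symmetric] by (metis less_imp_le)
  then have "maximal_path F p"
    using p(2)[unfolded P_def, rule_format, OF 0] unfolding maximal_path_def P_def by simp
  then show ?thesis by (rule that)
qed

text \<open>
  By maximality all neighbours of the start lie on the path, and by the degree condition there is one besides
  the second vertex of the path.
\<close>

lemma maximal_path_back_edge:
  assumes "simple_graph F" "no_primitive F" "maximal_path F p"
    and deg: "\<And>e v. e \<in> F \<Longrightarrow> v \<in> e \<Longrightarrow> \<exists>f\<in>F. v \<in> f \<and> f \<noteq> e"
  shows "\<exists>i. 2 \<le> i \<and> i < length p \<and> even i \<and> {p ! 0, p ! i} \<in> F \<and>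
    (\<forall>y. {p ! 0, y} \<in> F \<longrightarrow> y = p ! 1 \<or> y = p ! i)"
proof -
  have p: "distinct p" "walk F p" "2 \<le> length p" using assms by (auto simp: maximal_path_def)
  have "{p ! 0, p ! 1} \<in> F" using p by (auto simp: walk_def)
  then obtain f where f: "f \<in> F" "p ! 0 \<in> f" "f \<noteq> {p ! 0, p ! 1}" using deg[of "{p ! 0, p ! 1}" "p ! 0"] by auto
  then obtain y where y: "f = {p ! 0, y}" "y \<noteq> p ! 0"
    using simple_graph_edge_other[OF assms(1)] by metis
  have idx: "y = p ! 1 \<or> (\<exists>i. 2 \<le> i \<and> i < length p \<and> y = p ! i)" if "{p ! 0, y} \<in> F" for y
  proof -
    have "y \<in> set p" using maximal_path_nbr[OF assms(3) that] .
    then obtain i where "i < length p" "y = p ! i" by (auto simp: in_set_conv_nth)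
    moreover have "i \<noteq> 0"
      using simple_graph_no_loop[OF assms(1) that] calculation by (cases "i = 0") auto
    ultimately show ?thesis by (cases "i = 1") (auto intro!: exI[of _ i])
  qed
  then obtain i where i: "2 \<le> i" "i < length p" "y = p ! i" using f y by blast
  then have i': "{p ! 0, p ! i} \<in> F" "2 \<le> i" "i < length p" using f y by auto
  have "even i" using odd_length_cyc[OF assms(2) cyc_take[OF p(1,2) i']] i(2) by auto
  moreover have "y = p ! 1 \<or> y = p ! i" if "{p ! 0, y} \<in> F" for y
    using idx[OF that] back_edge_unique[OF assms(2) p(1,2) i'] that by blast
  ultimately show ?thesis using i' by blast
qed

text \<open>
  Let \<open>v\<^sub>0\<close> be adjacent to \<open>v\<^sub>i\<close> and the last vertex \<open>v\<^sub>k\<close> to \<open>v\<^sub>j\<close>, apart from their neighbours on the path. Both edges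
  close up odd cycles. For \<open>i < j\<close> these are disjoint and linked by a piece of the path, for \<open>i = j\<close> they
  meet in one vertex, and for \<open>i > j\<close> the walk \<open>v\<^sub>0 \<dots> v\<^sub>j v\<^sub>k \<dots> v\<^sub>i v\<^sub>0\<close> is an even cycle, unless it degenerates because
  \<open>i = k\<close> and \<open>j = 0\<close>. So only the degenerate case is possible: the path closes up to an odd cycle.
\<close>

lemma maximal_path_closes_up:
  assumes "simple_graph F" "no_primitive F" "maximal_path F p"
    and deg: "\<And>e v. e \<in> F \<Longrightarrow> v \<in> e \<Longrightarrow> \<exists>f\<in>F. v \<in> f \<and> f \<noteq> e"
  shows "cyc F p" "odd (length p)" "\<And>y. {hd p, y} \<in> F \<Longrightarrow> y = p ! 1 \<or> y = last p"
proof -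
  have p: "distinct p" "walk F p" "2 \<le> length p" using assms by (auto simp: maximal_path_def)
  let ?L = "length p"
  obtain i where i: "2 \<le> i" "i < ?L" "even i" "{p ! 0, p ! i} \<in> F"
    and nb: "\<And>y. {p ! 0, y} \<in> F \<Longrightarrow> y = p ! 1 \<or> y = p ! i"
    using maximal_path_back_edge[OF assms(1-3) deg] by blast
  obtain j' where j': "2 \<le> j'" "j' < ?L" "even j'" "{rev p ! 0, rev p ! j'} \<in> F"
    and nb': "\<And>y. {rev p ! 0, y} \<in> F \<Longrightarrow> y = rev p ! 1 \<or> y = rev p ! j'"
    using maximal_path_back_edge[OF assms(1,2) maximal_path_rev[OF assms(3)] deg, unfolded length_rev]
    by blast
  \<comment> \<open>the index, counted from the start, of the neighbour of the last vertex\<close>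
  define j where "j = ?L - 1 - j'"
  have j: "j < ?L" "?L - j = Suc j'" using j' by (auto simp: j_def)
  have C1: "cyc F (take (Suc i) p)" by (rule cyc_take[OF p(1,2) i(4,1,2)])
  have "cyc F (take (Suc j') (rev p))"
    using p j' by (intro cyc_take) (auto simp: walk_rev)
  then have "cyc F (rev (drop j p))" using j by (simp add: take_rev j_def)
  then have C2: "cyc F (drop j p)" using cyc_rev by fastforce
  define c1 where "c1 = rev (take (Suc i) p)"
  define c2 where "c2 = drop j p"
  have c1: "cyc F c1" "odd (length c1)" "hd c1 = p ! i"
    using C1 i by (auto simp: c1_def hd_rev last_take_Suc cyc_rev)
  have c2: "cyc F c2" "odd (length c2)" "hd c2 = p ! j"
    using C2 j j' by (auto simp: c2_def hd_drop_conv_nth)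
  have o1: "odd_cycle F (c1 @ [hd c1])" and o2: "odd_cycle F (c2 @ [hd c2])"
    using c1 c2 by (auto simp: odd_cycle_iff_cyc)
  have ne: "c1 \<noteq> []" "c2 \<noteq> []" using c1 c2 by auto
  have set12: "set (c1 @ [hd c1]) = set (take (Suc i) p)" "set (c2 @ [hd c2]) = set (drop j p)"
    using hd_in_set[OF ne(1)] hd_in_set[OF ne(2)] by (auto simp: c1_def c2_def simp del: hd_in_set)
  have "j < i"
  proof (rule ccontr)
    assume "\<not> j < i"
    then consider "i < j" | "i = j" by linarith
    then show False
    proof cases
      case 1
      define w where "w = drop i (take (Suc j) p)"
      have w: "walk_between F (p ! i) w (p ! j)"
        using p i j 1 by (auto simp: walk_between_def w_def hd_drop_conv_nth last_take_Suc intro!: walk_drop walk_take)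
      then have w': "walk_between F (p ! j) (rev w) (p ! i)"
        by (auto simp: walk_between_def walk_rev hd_rev last_rev)
      have disj: "set (c1 @ [hd c1]) \<inter> set (c2 @ [hd c2]) = {}"
        using set_take_disj_set_drop_if_distinct[OF p(1), of "Suc i" j] 1 unfolding set12 by simp
      have "length w \<ge> 1" using 1 i j by (auto simp: w_def)
      then have "even (walk_length ((c1 @ [hd c1]) @ tl w @ tl (c2 @ [hd c2]) @ tl (rev w)))"
        using c1 c2 ne by (auto simp: walk_length_def)
      then have "primitive_even_walk F ((c1 @ [hd c1]) @ tl w @ tl (c2 @ [hd c2]) @ tl (rev w))"
        using c1 c2 ne by (intro two_cycles_connected[OF o1 o2 _ _ disj w w']) auto
      then show False using assms(2) by (auto simp: no_primitive_def)
    next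
      case 2
      have dr: "drop i p = p ! i # drop (Suc i) p" using i by (simp add: Cons_nth_drop_Suc)
      have tk: "take (Suc i) p = take i p @ [p ! i]" using i by (simp add: take_Suc_conv_app_nth)
      have "set (c1 @ [hd c1]) \<inter> set (c2 @ [hd c2]) = set (take (Suc i) p) \<inter> set (drop i p)"
        unfolding set12 2 by simp
      also have "\<dots> = {p ! i}"
        using set_take_disj_set_drop_if_distinct[OF p(1), of i i]
          set_take_disj_set_drop_if_distinct[OF p(1), of "Suc i" "Suc i"]
        unfolding dr tk by auto
      finally have int: "set (c1 @ [hd c1]) \<inter> set (c2 @ [hd c2]) = {p ! i}" .
      have "primitive_even_walk F ((c1 @ [hd c1]) @ tl (c2 @ [hd c2]))"
        using c1 c2 ne 2 by (intro two_cycles[OF o1 o2 _ _ int]) auto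
      then show False using assms(2) by (auto simp: no_primitive_def)
    qed
  qed
  have closed: "i = ?L - 1 \<and> j = 0"
  proof (rule ccontr)
    assume nd: "\<not> (i = ?L - 1 \<and> j = 0)"
    let ?c = "take (Suc j) p @ rev (drop i p)"
    have lr: "rev p ! 0 = last p" using p by (cases p rule: rev_cases) auto
    have jj: "rev p ! j' = p ! j" using j' by (simp add: rev_nth j_def)
    have d: "drop i p \<noteq> []" "take (Suc j) p \<noteq> []" using i j by auto
    have "distinct ?c"
      using p set_take_disj_set_drop_if_distinct[OF p(1), of "Suc j" i] \<open>j < i\<close> by auto
    moreover have "walk F ?c"
      using p i j d j'(4) lr jj
      by (subst walk_append_iff) (auto simp: walk_take walk_drop walk_rev hd_rev last_take_Suc insert_commute)
    moreover have "{last ?c, hd ?c} \<in> F"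
    proof -
      have "last ?c = p ! i" using d i by (simp add: last_rev hd_drop_conv_nth)
      moreover have "hd ?c = p ! 0" using d by (cases p) auto
      ultimately show ?thesis using i by (simp add: insert_commute)
    qed
    moreover have len: "length ?c = Suc j + (?L - i)" using i j by simp
    moreover have "even (Suc j + (?L - i))"
      using j j'(3) i(2,3) by presburger
    moreover have "3 \<le> length ?c" using nd i len by linarith
    ultimately have "cyc F ?c" "even (length ?c)" unfolding cyc_def by simp_all
    then show False using odd_length_cyc[OF assms(2)] by blast
  qed
  have "p \<noteq> []" using p(3) by auto
  then have i_last: "p ! i = last p" using closed by (simp add: last_conv_nth)
  have "take (Suc i) p = p" using closed p by auto
  then show "cyc F p" using C1 by simp
  show "odd (length p)" using closed i p by presburger
  show "y = p ! 1 \<or> y = last p" if "{hd p, y} \<in> F" for y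
    using nb[of y] that i_last \<open>p \<noteq> []\<close> by (simp add: hd_conv_nth)
qed

lemma primitive_even_walk_mono:
  assumes "primitive_even_walk F' W" "F' \<subseteq> F"
  shows "primitive_even_walk F W"
proof -
  have oc: "odd_cycle F' c \<Longrightarrow> odd_cycle F c" for c
    using cyc_mono[OF _ assms(2)] by (auto simp: odd_cycle_iff_cyc)
  have wb: "walk_between F' u w v \<Longrightarrow> walk_between F u w v" for u w v
    using walk_mono[OF _ assms(2)] by (auto simp: walk_between_def)
  show ?thesis
    using assms(1)
  proof (induction rule: primitive_even_walk.induct)
    case (even_cycle p)
    then show ?case
      using cyc_mono[OF _ assms(2)] by (intro primitive_even_walk.even_cycle) (auto simp: graph_cycle_iff_cyc)
  next
    case (two_cycles c1 c2 v)
    then show ?case by (intro primitive_even_walk.two_cycles[OF oc oc])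
  next
    case (two_cycles_connected c1 c2 v1 v2 w1 w2)
    then show ?case by (intro primitive_even_walk.two_cycles_connected[OF oc oc _ _ _ wb wb])
  qed
qed

lemma no_primitive_subset: "no_primitive F \<Longrightarrow> F' \<subseteq> F \<Longrightarrow> no_primitive F'"
  unfolding no_primitive_def using primitive_even_walk_mono by blast

text \<open>
  The composed types contain two odd cycles and have length at least 6.
\<close>

lemma short_primitive_even_walk:
  assumes "primitive_even_walk F W" "walk_length W \<le> 4"
  shows "four_cycle F W"
  using assms
proof cases
  case even_cycle
  moreover from this have "walk_length W \<noteq> 3" "3 \<le> walk_length W" by (auto simp: graph_cycle_def)
  ultimately show ?thesis using assms(2) by (simp add: four_cycle_def)
next
  case (two_cycles c1 c2 v)
  then have "4 \<le> length c1" "4 \<le> length c2"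
    by (auto simp: odd_cycle_def graph_cycle_def walk_length_def)
  then show ?thesis using assms(2) two_cycles(1) by (simp add: walk_length_def)
next
  case (two_cycles_connected c1 c2 v1 v2 w1 w2)
  then have "4 \<le> length c1" "4 \<le> length c2"
    by (auto simp: odd_cycle_def graph_cycle_def walk_length_def)
  then show ?thesis using assms(2) two_cycles_connected(1) by (simp add: walk_length_def)
qed

text \<open>
  The support of a linear relation has no vertex of degree one. A longest path in it closes up to an odd
  cycle, and since rotations of this path are longest paths too, no further edge of the support
  touches the cycle. So the coefficients along the cycle alternate in sign, which is impossible for
  odd length.
\<close>

lemma no_primitive_independent:
  fixes F :: "'n::finite set set"
  assumes "simple_graph F" "no_primitive F"
  shows "vec.independent (inc ` F)"
proof
  assume "vec.dependent (inc ` F)"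
  then obtain u v where u: "(\<Sum>x\<in>inc ` F. u x *s x) = 0" and v: "v \<in> inc ` F" "u v \<noteq> 0"
    by (auto simp: vec.dependent_finite)
  define \<rho> where "\<rho> e = u (inc e)" for e
  \<comment> \<open>the support of the relation, as a subgraph\<close>
  define S where "S = {e \<in> F. \<rho> e \<noteq> 0}"
  have S: "simple_graph S" "no_primitive S"
    using simple_graph_subset[OF assms(1), of S] no_primitive_subset[OF assms(2), of S] by (auto simp: S_def)
  have "S \<noteq> {}" using v by (auto simp: S_def \<rho>_def)
  have "(\<Sum>e\<in>F. \<rho> e *s inc e) = 0"
    using u by (subst (asm) sum.reindex) (auto simp: \<rho>_def inj_on_subset[OF inj_inc])
  then have "(\<Sum>e\<in>F. \<rho> e *s inc e) $ w = 0" for w by simp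
  then have "(\<Sum>e\<in>F. \<rho> e * (if w \<in> e then 1 else 0)) = 0" for w by (simp add: inc_nth)
  moreover have "(\<Sum>e\<in>{e\<in>S. w \<in> e}. \<rho> e) = (\<Sum>e\<in>F. \<rho> e * (if w \<in> e then 1 else 0))" for w
    by (rule sum.mono_neutral_cong_left) (auto simp: S_def)
  ultimately have bal: "(\<Sum>e\<in>{e\<in>S. w \<in> e}. \<rho> e) = 0" for w by simp
  have deg: "\<exists>f\<in>S. w \<in> f \<and> f \<noteq> e" if "e \<in> S" "w \<in> e" for e w
  proof (rule ccontr)
    assume "\<not> (\<exists>f\<in>S. w \<in> f \<and> f \<noteq> e)"
    then have "{e\<in>S. w \<in> e} = {e}" using that by blast
    then show False using bal[of w] that by (simp add: S_def)
  qed
  have alt: "\<rho> {p ! 1, hd p} = - \<rho> {hd p, last p}" if p: "maximal_path S p" for p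
  proof -
    note cl = maximal_path_closes_up[OF S p deg]
    have len: "length p \<ge> 3" "distinct p" "walk S p" using cl(1) by (auto simp: cyc_def)
    have "{hd p, p ! 1} \<in> S" using len by (cases p rule: remdups_adj.cases) (auto simp: walk_Cons)
    moreover have "{hd p, last p} \<in> S" using cl(1) by (simp add: cyc_def insert_commute)
    moreover have "e = {hd p, p ! 1} \<or> e = {hd p, last p}" if "e \<in> S" "hd p \<in> e" for e
      by (rule simple_graph_edge_other[OF S(1) that]) (use cl(3) that in blast)
    ultimately have "{e\<in>S. hd p \<in> e} = {{hd p, p ! 1}, {hd p, last p}}"
      by blast
    moreover have "{hd p, p ! 1} \<noteq> {hd p, last p}"
    proof -
      have "p ! 1 \<noteq> last p" using len by (subst last_conv_nth) (auto simp: nth_eq_iff_index_eq)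
      then show ?thesis by (auto simp: doubleton_eq_iff)
    qed
    ultimately have "\<rho> {hd p, p ! 1} + \<rho> {hd p, last p} = 0" using bal[of "hd p"] by simp
    then show ?thesis by (simp add: insert_commute add_eq_0_iff2)
  qed
  obtain p where p: "maximal_path S p" using maximal_path_exists[OF S(1) \<open>S \<noteq> {}\<close>] .
  have rot1: "maximal_path S (rotate1 q)" if q: "maximal_path S q" for q
  proof -
    have "cyc S q" using maximal_path_closes_up(1)[OF S q deg] .
    then have "cyc S (rotate1 q)" using cyc_rotate[of S "[hd q]" "tl q"]
      by (cases q) auto
    then show ?thesis using q by (auto simp: maximal_path_def cyc_def)
  qed
  \<comment> \<open>the coefficients along the cycle, in cyclic order\<close>
  define a where "a m = \<rho> {hd (rotate m p), last (rotate m p)}" for m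
  have rot: "maximal_path S (rotate m p)" for m
    by (induction m) (auto simp: p rot1)
  have "a (Suc m) = - a m" for m
  proof -
    have "length (rotate m p) \<ge> 2" using rot[of m] by (simp add: maximal_path_def)
    then obtain x y r where q: "rotate m p = x # y # r"
      by (metis One_nat_def Suc_1 Suc_le_length_iff)
    show ?thesis using alt[OF rot[of m]] by (simp add: a_def q)
  qed
  then have "a m = (-1) ^ m * a 0" for m by (induction m) auto
  moreover have "a (length p) = a 0" by (simp add: a_def)
  moreover have "odd (length p)" using maximal_path_closes_up(2)[OF S p deg] .
  ultimately have "a 0 = 0" by (metis minus_one_power_iff mult_minus1 neg_equal_zero)
  moreover have "{last p, hd p} \<in> S" using maximal_path_closes_up(1)[OF S p deg] by (simp add: cyc_def)
  ultimately show False by (simp add: a_def S_def insert_commute)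
qed

section \<open>Primitive even walks of graphs with gap zero\<close>

definition walk_edges :: "'n list \<Rightarrow> 'n set set" where
  "walk_edges p = {{p ! j, p ! Suc j} | j. Suc j < length p}"

lemma walk_edges_Cons: "walk_edges (x # y # p) = insert {x, y} (walk_edges (y # p))"
proof -
  have "(\<exists>j. e = {(x # y # p) ! j, (y # p) ! j} \<and> j < Suc (length p)) \<longleftrightarrow>
      e = {x, y} \<or> (\<exists>j. e = {(y # p) ! j, p ! j} \<and> j < length p)" for e
  proof
    assume "\<exists>j. e = {(x # y # p) ! j, (y # p) ! j} \<and> j < Suc (length p)"
    then obtain j where "e = {(x # y # p) ! j, (y # p) ! j}" "j < Suc (length p)" by blast
    then show "e = {x, y} \<or> (\<exists>j. e = {(y # p) ! j, p ! j} \<and> j < length p)"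
      by (cases j) auto
  next
    assume "e = {x, y} \<or> (\<exists>j. e = {(y # p) ! j, p ! j} \<and> j < length p)"
    then show "\<exists>j. e = {(x # y # p) ! j, (y # p) ! j} \<and> j < Suc (length p)"
      by (elim disjE exE) (force intro: exI[of _ 0] exI[of _ "Suc _"])+
  qed
  then show ?thesis by (auto simp: walk_edges_def)
qed

lemma walk_edges_singleton [simp]: "walk_edges [x] = {}"
  by (simp add: walk_edges_def)

lemma walk_walk_edges_iff: "p \<noteq> [] \<Longrightarrow> walk F p \<longleftrightarrow> walk_edges p \<subseteq> F"
  by (induction p rule: induct_list012) (auto simp: walk_Cons walk_edges_Cons)

lemma walk_edges_subset_set: "e \<in> walk_edges p \<Longrightarrow> e \<subseteq> set p"
  by (auto simp: walk_edges_def)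

lemma walk_avoid:
  assumes "walk F p" "v \<in> e" "v \<notin> set p"
  shows "walk (F - {e}) p"
proof -
  have "p \<noteq> []" using assms(1) by (simp add: walk_def)
  then show ?thesis
    using assms walk_edges_subset_set[of e p] by (auto simp: walk_walk_edges_iff)
qed

definition vx :: "'n::finite \<Rightarrow> rat ^ 'n" where
  "vx v = (\<chi> i. if i = v then 1 else 0)"

lemma inc_edge: "u \<noteq> v \<Longrightarrow> inc {u, v} = vx u + vx v"
  by (auto simp: inc_def vx_def vec_eq_iff)

text \<open>
  The alternating sum of the edges along a walk telescopes to its two ends.
\<close>

lemma walk_span:
  fixes F :: "'n::finite set set"
  assumes "simple_graph F" "walk F p"
  shows "(even (length p) \<longrightarrow> vx (hd p) + vx (last p) \<in> vec.span (inc ` F)) \<and>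
         (odd (length p) \<longrightarrow> vx (hd p) - vx (last p) \<in> vec.span (inc ` F))"
  using assms(2)
proof (induction p rule: induct_list012)
  case 1
  then show ?case by (simp add: walk_def)
next
  case (2 x)
  then show ?case by (simp add: vec.span_zero)
next
  case (3 x y zs)
  have xy: "{x, y} \<in> F" and w: "walk F (y # zs)" using 3(3) by (simp_all add: walk_Cons)
  have "x \<noteq> y" using simple_graph_no_loop[OF assms(1) xy] .
  then have s: "vx x + vx y \<in> vec.span (inc ` F)"
    using xy inc_edge[of x y] by (metis imageI vec.span_base)
  have eq: "last (x # y # zs) = last (y # zs)" by simp
  show ?case
  proof (cases "even (length zs)")
    case True
    then have "vx y - vx (last (y # zs)) \<in> vec.span (inc ` F)" using 3(2)[OF w] by simp
    from vec.span_diff[OF s this] show ?thesis using True eq by simp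
  next
    case False
    then have "vx y + vx (last (y # zs)) \<in> vec.span (inc ` F)" using 3(2)[OF w] by simp
    from vec.span_diff[OF s this] show ?thesis using False eq by simp
  qed
qed

lemma walk_span_even: "simple_graph F \<Longrightarrow> walk F p \<Longrightarrow> even (length p) \<Longrightarrow>
    vx (hd p) + vx (last p) \<in> vec.span (inc ` (F :: 'n::finite set set))"
  using walk_span by blast

lemma walk_avoid_chord:
  assumes "walk F p" "distinct p" "3 \<le> length p"
  shows "walk (F - {{hd p, last p}}) p"
  unfolding walk_def
proof (intro conjI allI impI)
  show ne: "p \<noteq> []" using assms by auto
  fix j assume j: "Suc j < length p"
  have hl: "hd p = p ! 0" "last p = p ! (length p - 1)" using ne by (simp_all add: hd_conv_nth last_conv_nth)
  have "{p ! j, p ! Suc j} \<noteq> {hd p, last p}"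
  proof
    assume "{p ! j, p ! Suc j} = {hd p, last p}"
    then have "p ! j = p ! 0 \<and> p ! Suc j = p ! (length p - 1) \<or> p ! j = p ! (length p - 1) \<and> p ! Suc j = p ! 0"
      unfolding hl by (simp add: doubleton_eq_iff)
    then have "j = 0 \<and> Suc j = length p - 1 \<or> j = length p - 1"
      using nth_eq_iff_index_eq[OF assms(2), of j 0] nth_eq_iff_index_eq[OF assms(2), of "Suc j" "length p - 1"]
        nth_eq_iff_index_eq[OF assms(2), of j "length p - 1"] j by linarith
    then show False using j assms(3) by linarith
  qed
  then show "{p ! j, p ! Suc j} \<in> F - {{hd p, last p}}" using assms(1) j by (simp add: walk_def)
qed

text \<open>
  The alternating sum along the rest of the cycle.
\<close>

lemma even_cycle_span:
  fixes F :: "'n::finite set set"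
  assumes "simple_graph F" "cyc F (x # y # r)" "even (length r)"
  shows "inc {x, y} \<in> vec.span (inc ` (F - {{x, y}}))"
proof -
  have c: "distinct (x # y # r)" "walk F (y # r)" "{last (y # r), x} \<in> F" "r \<noteq> []"
    using assms(2) by (auto simp: cyc_def walk_Cons)
  then have "walk F (y # r @ [x])"
    using walk_append_iff[of "y # r" "[x]" F] by simp
  moreover have "distinct (y # r @ [x])" using c by auto
  moreover have "3 \<le> length (y # r @ [x])" using c(4) by (cases r) auto
  ultimately have "walk (F - {{y, x}}) (y # r @ [x])"
    using walk_avoid_chord[of F "y # r @ [x]"] by simp
  then have "vx y + vx x \<in> vec.span (inc ` (F - {{y, x}}))"
    using walk_span_even[of "F - {{y, x}}" "y # r @ [x]"] assms(3) simple_graph_subset[OF assms(1)] by force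
  then show ?thesis
    using c(1) inc_edge[of x y] by (simp add: insert_commute add.commute)
qed

lemma cyc_cong: "cyc F xs \<Longrightarrow> walk_edges (xs @ [hd xs]) \<subseteq> F' \<Longrightarrow> cyc F' xs"
proof -
  assume c: "cyc F xs" and s: "walk_edges (xs @ [hd xs]) \<subseteq> F'"
  then have "walk F' (xs @ [hd xs])" by (subst walk_walk_edges_iff) auto
  moreover have "xs \<noteq> []" using c by (auto simp: cyc_def)
  ultimately show "cyc F' xs" using c by (auto simp: cyc_def walk_append_iff)
qed

lemma cyc_walk_edges: "cyc F xs \<Longrightarrow> walk_edges (xs @ [hd xs]) \<subseteq> F"
proof -
  assume c: "cyc F xs"
  then have "xs \<noteq> []" by (auto simp: cyc_def)
  then have "walk F (xs @ [hd xs])" using c by (auto simp: cyc_def walk_append_iff)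
  then show ?thesis by (subst (asm) walk_walk_edges_iff) auto
qed

lemma gap_zero_join:
  fixes F :: "'n::finite set set"
  assumes "simple_graph F" "gap F = 0"
    and "e \<in> F" "inc e \<in> vec.span (inc ` (F - {e}))"
    and "f \<in> F" "inc f \<in> vec.span (inc ` (F - {f}))"
    and "e \<inter> f = {}" "v \<in> e"
  shows "\<exists>w\<in>f. {v, w} \<in> F"
proof -
  have "f \<in> opposite F e" using gap_zero_disjoint_edges[OF assms(1-7)] .
  then obtain a b c d where *: "e = {a, b}" "f = {c, d}" "{b, c} \<in> F" "{a, d} \<in> F"
    by (rule mem_oppositeE[OF assms(1,3)])
  have "v = a \<or> v = b" using assms(8) *(1) by blast
  then show ?thesis using * by blast
qed

text \<open>
  In the graph formed by a long even cycle \<open>a b c d e f \<dots>\<close> all edges occur in a relation, but the disjoint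
  edges \<open>ab\<close> and \<open>de\<close> are not opposite in a 4-cycle, because \<open>b\<close> has the neighbours \<open>a\<close> and \<open>c\<close> only.
\<close>

lemma gap_zero_no_long_even_cycle:
  fixes F :: "'n::finite set set"
  assumes "simple_graph F" "gap F = 0" "cyc F xs" "even (length xs)"
  shows "length xs = 4"
proof (rule ccontr)
  assume "length xs \<noteq> 4"
  moreover have "length xs \<ge> 3" using assms(3) by (simp add: cyc_def)
  moreover have "length xs \<noteq> 3" "length xs \<noteq> 5" using assms(4) by auto
  ultimately have "6 \<le> length xs" by linarith
  then obtain a b c d e f r where xs: "xs = a # b # c # d # e # f # r"
    by (auto simp: numeral_eq_Suc Suc_le_length_iff)
  define G where "G = walk_edges (xs @ [hd xs])"
  have G: "simple_graph G" "gap G = 0"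
    using simple_graph_subset[OF assms(1)] gap_zero_subset[OF assms(1,2)] cyc_walk_edges[OF assms(3)]
    by (auto simp: G_def)
  have cG: "cyc G xs" by (rule cyc_cong[OF assms(3)]) (simp add: G_def)
  then have d: "distinct xs" by (simp add: cyc_def)
  have cG': "cyc G (d # e # f # r @ [a, b, c])"
    using cyc_rotate[of G "[a, b, c]" "d # e # f # r"] cG by (simp add: xs)
  have "{a, b} \<in> G" "{d, e} \<in> G" by (auto simp: G_def xs walk_edges_Cons)
  moreover have "inc {a, b} \<in> vec.span (inc ` (G - {{a, b}}))"
    using even_cycle_span[OF G(1), of a b "c # d # e # f # r"] cG assms(4) by (simp add: xs)
  moreover have "inc {d, e} \<in> vec.span (inc ` (G - {{d, e}}))"
    using even_cycle_span[OF G(1) cG'] assms(4) by (simp add: xs)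
  moreover have "{a, b} \<inter> {d, e} = {}" using d by (auto simp: xs)
  ultimately have "\<exists>w\<in>{d, e}. {b, w} \<in> G"
    using gap_zero_join[OF G, of "{a, b}" "{d, e}" b] by simp
  then obtain w where w: "w \<in> {d, e}" "{b, w} \<in> G" by blast
  have "{b, w} \<in> {{a, b}, {b, c}} \<or> {b, w} \<in> walk_edges (c # d # e # f # r @ [a])"
    using w(2) by (auto simp: G_def xs walk_edges_Cons)
  then show False
    using walk_edges_subset_set[of "{b, w}" "c # d # e # f # r @ [a]"] d w(1)
    by (auto simp: xs doubleton_eq_iff)
qed

lemma odd_cycle_span:
  fixes F :: "'n::finite set set"
  assumes "simple_graph F" "cyc F xs" "odd (length xs)"
  shows "vx (hd xs) + vx (hd xs) \<in> vec.span (inc ` F)"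
proof -
  have "xs \<noteq> []" using assms(2) by (auto simp: cyc_def)
  then have "walk F (xs @ [hd xs])" using assms(2) by (auto simp: cyc_def walk_append_iff)
  from walk_span_even[OF assms(1) this] show ?thesis using assms(3) \<open>xs \<noteq> []\<close> by simp
qed

text \<open>
  Write \<open>u\<close> for a vertex and its basis vector alike. Going along \<open>p\<close>, around \<open>d\<close> and back shows that \<open>2 u\<close> is
  a combination of edges that avoid \<open>x\<close>, and \<open>xy = ux + (y + u) - 2 u\<close>, where \<open>y + u\<close> comes from the rest
  of the odd cycle \<open>c\<close>.
\<close>

lemma linked_odd_cycle_edge_span:
  fixes F :: "'n::finite set set"
  assumes "simple_graph F"
    and c: "cyc F c" "odd (length c)" "c = u # x # y # r"
    and d: "cyc F d" "odd (length d)" "x \<notin> set d"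
    and p: "walk F p" "hd p = u" "last p = hd d" "x \<notin> set p"
  shows "inc {x, y} \<in> vec.span (inc ` (F - {{x, y}}))"
proof -
  let ?G = "F - {{x, y}}"
  let ?S = "vec.span (inc ` ?G)"
  have G: "simple_graph ?G" using simple_graph_subset[OF assms(1)] by auto
  have dc: "distinct (u # x # y # r)" "walk F (u # x # y # r)" "{last (y # r), u} \<in> F"
    using c by (auto simp: cyc_def)
  have "cyc ?G d"
  proof (rule cyc_cong[OF d(1)], rule subsetI)
    fix e assume "e \<in> walk_edges (d @ [hd d])"
    moreover have "d \<noteq> []" using d by auto
    ultimately show "e \<in> ?G" using cyc_walk_edges[OF d(1)] d(3) walk_edges_subset_set[of e "d @ [hd d]"]
      by auto
  qed
  from odd_cycle_span[OF G this d(2)] have s1: "vx (hd d) + vx (hd d) \<in> ?S" .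
  have "walk ?G p" using walk_avoid[OF p(1) _ p(4), of "{x, y}"] by simp
  note s2 = walk_span[OF G this, unfolded p(2,3)]
  have uu: "vx u + vx u \<in> ?S"
  proof (cases "even (length p)")
    case True
    then have "vx u + vx (hd d) \<in> ?S" using s2 by blast
    note * = this
    have "(vx u + vx (hd d)) + (vx u + vx (hd d)) - (vx (hd d) + vx (hd d)) \<in> ?S"
      by (rule vec.span_diff[OF vec.span_add[OF * *] s1])
    then show ?thesis by simp
  next
    case False
    then have "vx u - vx (hd d) \<in> ?S" using s2 by blast
    note * = this
    have "(vx u - vx (hd d)) + (vx u - vx (hd d)) + (vx (hd d) + vx (hd d)) \<in> ?S"
      by (rule vec.span_add[OF vec.span_add[OF * *] s1])
    then show ?thesis by (simp add: algebra_simps)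
  qed
  have "walk F [u, x]" using dc(2) by (simp add: walk_Cons)
  then have "walk ?G [u, x]" using dc(1) by (auto simp: walk_Cons doubleton_eq_iff)
  from walk_span_even[OF G this] have s3: "vx u + vx x \<in> ?S" by simp
  have "walk F (y # r @ [u])"
    using dc walk_append_iff[of "y # r" "[u]" F] by (simp add: walk_Cons)
  then have "walk ?G (y # r @ [u])"
    by (rule walk_avoid[of _ _ x]) (use dc(1) in auto)
  from walk_span_even[OF G this] have s4: "vx y + vx u \<in> ?S" using c(2,3) by simp
  have "(vx u + vx x) + (vx y + vx u) - (vx u + vx u) \<in> ?S"
    by (rule vec.span_diff[OF vec.span_add[OF s3 s4] uu])
  moreover have "inc {x, y} = vx x + vx y" using dc(1) by (intro inc_edge) auto
  ultimately show ?thesis by simp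
qed

text \<open>
  In the graph formed by both cycles and the linking walk, take an edge of each cycle that avoids the
  link. Both occur in relations, so they would be joined by an edge, but no edge of this graph leads
  from one cycle to the other beside the link. The one-vertex walk covers cycles that meet in a vertex.
\<close>

lemma gap_zero_no_linked_odd_cycles:
  fixes F :: "'n::finite set set"
  assumes "simple_graph F" "gap F = 0"
    and c: "cyc F c" "odd (length c)" and d: "cyc F d" "odd (length d)"
    and p: "walk F p" "hd p = hd c" "last p = hd d"
    and disj: "set p \<inter> set c = {hd c}" "set p \<inter> set d = {hd d}" "set c \<inter> set d \<subseteq> set p"
  shows False
proof -
  define G where "G = walk_edges (c @ [hd c]) \<union> walk_edges p \<union> walk_edges (d @ [hd d])"
  have "p \<noteq> []" using p(1) by (simp add: walk_def)
  then have "G \<subseteq> F"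
    using p cyc_walk_edges[OF c(1)] cyc_walk_edges[OF d(1)] by (auto simp: G_def walk_walk_edges_iff)
  then have G: "simple_graph G" "gap G = 0"
    using simple_graph_subset[OF assms(1)] gap_zero_subset[OF assms(1,2)] by auto
  have cG: "cyc G c" "cyc G d" "walk G p"
    by (rule cyc_cong[OF c(1)], use G_def in blast, rule cyc_cong[OF d(1)], use G_def in blast,
        use \<open>p \<noteq> []\<close> G_def walk_walk_edges_iff in blast)
  obtain u x y r where c': "c = u # x # y # r"
    using c(1) by (auto simp: cyc_def numeral_eq_Suc Suc_le_length_iff)
  obtain w x' y' r' where d': "d = w # x' # y' # r'"
    using d(1) by (auto simp: cyc_def numeral_eq_Suc Suc_le_length_iff)
  have dist: "distinct c" "distinct d" using c d by (auto simp: cyc_def)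
  have out: "x \<notin> set p" "y \<notin> set p" "x' \<notin> set p" "y' \<notin> set p"
    using disj(1,2) dist by (auto simp: c' d')
  then have out': "x \<notin> set d" "y \<notin> set d" "x' \<notin> set c" "y' \<notin> set c"
    using disj(3) by (auto simp: c' d')
  have "inc {x, y} \<in> vec.span (inc ` (G - {{x, y}}))"
    by (rule linked_odd_cycle_edge_span[OF G(1) cG(1) c(2) c' cG(2) d(2) out'(1) cG(3)])
      (use p out in \<open>auto simp: c'\<close>)
  moreover have "inc {x', y'} \<in> vec.span (inc ` (G - {{x', y'}}))"
    by (rule linked_odd_cycle_edge_span[OF G(1) cG(2) d(2) d' cG(1) c(2) out'(3) walk_rev[OF cG(3)]])
      (use p out \<open>p \<noteq> []\<close> in \<open>auto simp: d' hd_rev last_rev\<close>)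
  moreover have "{x, y} \<in> G" "{x', y'} \<in> G"
    by (auto simp: G_def c' d' walk_edges_Cons)
  moreover have "{x, y} \<inter> {x', y'} = {}" using out' by (auto simp: d')
  ultimately have "\<exists>z\<in>{x', y'}. {x, z} \<in> G"
    using gap_zero_join[OF G, of "{x, y}" "{x', y'}" x] by simp
  then obtain z where z: "z \<in> {x', y'}" "{x, z} \<in> G" by blast
  from z(2) consider "{x, z} \<in> walk_edges (c @ [hd c])" | "{x, z} \<in> walk_edges p" | "{x, z} \<in> walk_edges (d @ [hd d])"
    by (auto simp: G_def)
  then show False
    using walk_edges_subset_set[of "{x, z}"] out out' z(1)
    by cases (fastforce simp: c' d')+
qed

lemma cyc_rotate_to:
  assumes "cyc F c" "u \<in> set c"
  obtains c' where "cyc F c'" "hd c' = u" "set c' = set c" "length c' = length c"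
proof -
  obtain xs ys where c: "c = xs @ u # ys" using assms(2) by (meson split_list)
  show ?thesis
    by (rule that[of "u # ys @ xs"]) (use cyc_rotate[of F xs "u # ys"] assms(1) c in auto)
qed

text \<open>
  A shortest walk between two disjoint cycles meets each of them only in its ends, so the previous lemma
  applies after rotating the cycles.
\<close>

lemma gap_zero_odd_cycles_meet:
  fixes F :: "'n::finite set set"
  assumes "simple_graph F" "gap F = 0"
    and c: "cyc F c" "odd (length c)" and d: "cyc F d" "odd (length d)"
    and disj: "set c \<inter> set d = {}"
    and w: "walk F w" "hd w \<in> set c" "last w \<in> set d"
  shows False
proof -
  define P where "P q \<longleftrightarrow> walk F q \<and> hd q \<in> set c \<and> last q \<in> set d" for q
  have "P w" using w by (simp add: P_def)
  define p where "p = arg_min length P"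
  have "P p" and min: "P q \<Longrightarrow> length p \<le> length q" for q
    using arg_min_nat_lemma[of P w length, OF \<open>P w\<close>] by (auto simp: p_def)
  have p: "walk F p" "hd p \<in> set c" "last p \<in> set d" "p \<noteq> []"
    using \<open>P p\<close> by (auto simp: P_def walk_def)
  have 1: "v = hd p" if "v \<in> set p" "v \<in> set c" for v
  proof -
    obtain xs ys where q: "p = xs @ v # ys" using \<open>v \<in> set p\<close> by (meson split_list)
    have "xs = []"
    proof (rule ccontr)
      assume "xs \<noteq> []"
      then have "P (v # ys)" using p that(2) unfolding P_def q by (auto simp: walk_append_iff)
      then show False using min[of "v # ys"] \<open>xs \<noteq> []\<close> by (simp add: q)
    qed
    then show ?thesis by (simp add: q)
  qed
  have 2: "v = last p" if "v \<in> set p" "v \<in> set d" for v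
  proof -
    obtain xs ys where q: "p = xs @ v # ys" using \<open>v \<in> set p\<close> by (meson split_list)
    have "ys = []"
    proof (rule ccontr)
      assume "ys \<noteq> []"
      have "p = (xs @ [v]) @ ys" by (simp add: q)
      then have "walk F (xs @ [v])"
        using p(1) \<open>ys \<noteq> []\<close> walk_append_iff[of "xs @ [v]" ys F] by (simp del: append_assoc)
      moreover have "hd (xs @ [v]) = hd p" by (cases xs) (auto simp: q)
      ultimately have "P (xs @ [v])" using p that(2) unfolding P_def by simp
      then show False using min[of "xs @ [v]"] \<open>ys \<noteq> []\<close> by (simp add: q)
    qed
    then show ?thesis by (simp add: q)
  qed
  obtain c' where c': "cyc F c'" "hd c' = hd p" "set c' = set c" "length c' = length c"
    using cyc_rotate_to[OF c(1) p(2)] .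
  obtain d' where d': "cyc F d'" "hd d' = last p" "set d' = set d" "length d' = length d"
    using cyc_rotate_to[OF d(1) p(3)] .
  have "hd p \<in> set p" "last p \<in> set p" using p(4) by auto
  have "set p \<inter> set c' = {hd c'}" "set p \<inter> set d' = {hd d'}" "set c' \<inter> set d' \<subseteq> set p"
    unfolding c'(2,3) d'(2,3) using 1 2 p(2,3) disj \<open>hd p \<in> set p\<close> \<open>last p \<in> set p\<close> by blast+
  from gap_zero_no_linked_odd_cycles[OF assms(1,2) c'(1) _ d'(1) _ p(1) _ _ this]
  show False using c(2) d(2) c'(2,4) d'(2,4) by simp
qed

lemma gap_zero_primitive_walk:
  fixes F :: "'n::finite set set"
  assumes "simple_graph F" "gap F = 0" "primitive_even_walk F W"
  shows "four_cycle F W"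
  using assms(3)
proof cases
  case even_cycle
  then obtain xs where xs: "cyc F xs" "W = xs @ [hd xs]" "even (length xs)"
    by (auto simp: graph_cycle_iff_cyc walk_length_def)
  then show ?thesis
    using gap_zero_no_long_even_cycle[OF assms(1,2) xs(1,3)] even_cycle
    by (simp add: four_cycle_def walk_length_def)
next
  case (two_cycles c1 c2 v)
  obtain c where c: "cyc F c" "odd (length c)" "c1 = c @ [hd c]"
    using two_cycles(2) by (auto simp: odd_cycle_iff_cyc)
  obtain d where d: "cyc F d" "odd (length d)" "c2 = d @ [hd d]"
    using two_cycles(3) by (auto simp: odd_cycle_iff_cyc)
  have ne: "c \<noteq> []" "d \<noteq> []" using c d by auto
  have "hd c = v" "hd d = v" using two_cycles(4,5) c d ne by auto
  moreover from this have "v \<in> set c" "v \<in> set d" using ne by (metis hd_in_set)+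
  moreover have "set c1 \<inter> set c2 = set c \<inter> set d" using ne hd_in_set[OF ne(1)] hd_in_set[OF ne(2)] unfolding c(3) d(3) by (auto simp del: hd_in_set)
  then have "set c \<inter> set d = {v}" using two_cycles by simp
  ultimately have False
    using gap_zero_no_linked_odd_cycles[OF assms(1,2) c(1,2) d(1,2), of "[v]"] by auto
  then show ?thesis ..
next
  case (two_cycles_connected c1 c2 v1 v2 w1 w2)
  obtain c where c: "cyc F c" "odd (length c)" "c1 = c @ [hd c]"
    using two_cycles_connected(2) by (auto simp: odd_cycle_iff_cyc)
  obtain d where d: "cyc F d" "odd (length d)" "c2 = d @ [hd d]"
    using two_cycles_connected(3) by (auto simp: odd_cycle_iff_cyc)
  have ne: "c \<noteq> []" "d \<noteq> []" using c d by auto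
  have "hd c = v1" "hd d = v2" using two_cycles_connected(4,5) c d ne by auto
  moreover from this have "v1 \<in> set c" "v2 \<in> set d" using ne by (metis hd_in_set)+
  moreover have "set c \<inter> set d = {}" using two_cycles_connected(6) c(3) d(3) by auto
  ultimately have False
    using gap_zero_odd_cycles_meet[OF assms(1,2) c(1,2) d(1,2), of w1] two_cycles_connected(7)
    by (auto simp: walk_between_def)
  then show ?thesis ..
qed

section \<open>The 4-cycles of graphs with gap zero\<close>

text \<open>
  4-cycles by their vertices in cyclic order; \<open>{a, c}\<close> and \<open>{b, d}\<close> are the diagonals.
\<close>

definition square :: "'n set set \<Rightarrow> 'n \<Rightarrow> 'n \<Rightarrow> 'n \<Rightarrow> 'n \<Rightarrow> bool" where
  "square F a b c d \<longleftrightarrow> distinct [a, b, c, d] \<and> {a, b} \<in> F \<and> {b, c} \<in> F \<and> {c, d} \<in> F \<and> {d, a} \<in> F"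

lemma square_iff_cyc: "square F a b c d \<longleftrightarrow> cyc F [a, b, c, d]"
  by (auto simp: square_def cyc_def walk_Cons)

lemma four_cycle_iff_square: "four_cycle F p \<longleftrightarrow> (\<exists>a b c d. p = [a, b, c, d, a] \<and> square F a b c d)"
proof
  assume *: "four_cycle F p"
  then obtain xs where xs: "cyc F xs" "p = xs @ [hd xs]" "length xs = 4"
    by (auto simp: four_cycle_def graph_cycle_iff_cyc walk_length_def)
  then obtain a b c d where "xs = [a, b, c, d]"
    by (auto simp: numeral_eq_Suc length_Suc_conv)
  then show "\<exists>a b c d. p = [a, b, c, d, a] \<and> square F a b c d"
    using xs by (auto simp: square_iff_cyc)
next
  assume "\<exists>a b c d. p = [a, b, c, d, a] \<and> square F a b c d"
  then show "four_cycle F p"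
    unfolding four_cycle_def graph_cycle_iff_cyc square_iff_cyc walk_length_def
    by (auto intro!: exI[of _ "butlast p"])
qed

lemma square_rotate: "square F a b c d \<Longrightarrow> square F b c d a"
  by (auto simp: square_def)

lemma square_mono: "square F a b c d \<Longrightarrow> F \<subseteq> F' \<Longrightarrow> square F' a b c d"
  by (auto simp: square_def)

lemma square_span:
  fixes F :: "'n::finite set set"
  assumes "simple_graph F" "square F a b c d"
  shows "inc {a, b} \<in> vec.span (inc ` (F - {{a, b}}))"
  using even_cycle_span[OF assms(1), of a b "[c, d]"] assms(2) by (simp add: square_iff_cyc)

text \<open>
  The four edges of the square \<open>a c b d\<close> all meet the edge \<open>ab\<close>, hence are not opposite to it; they
  would have to be independent, but the edges of a square are dependent.
\<close>

lemma gap_zero_no_K4: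
  fixes F :: "'n::finite set set"
  assumes "simple_graph F" "gap F = 0" "square F a b c d" "{a, c} \<in> F" "{b, d} \<in> F"
  shows False
proof -
  have d: "distinct [a, b, c, d]" and e: "{a, b} \<in> F" "{b, c} \<in> F" "{c, d} \<in> F" "{d, a} \<in> F"
    using assms(3) by (auto simp: square_def)
  let ?G = "F - opposite F {a, b}"
  have ind: "vec.independent (inc ` ?G)"
    using gap_zero_independent[OF assms(1,2) e(1) square_span[OF assms(1,3)]] .
  have "g \<in> ?G" if "g \<in> F" "g \<inter> {a, b} \<noteq> {}" for g
  proof -
    have "g \<inter> {a, b} = {}" if "g \<in> opposite F {a, b}"
      by (rule mem_oppositeE[OF assms(1) e(1) that]) auto
    then show ?thesis using that by blast
  qed
  then have G: "{a, c} \<in> ?G" "{b, d} \<in> ?G" "{a, d} \<in> ?G" "{b, c} \<in> ?G"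
    using assms e by (auto simp: insert_commute)
  have "square ?G a c b d"
    using d G by (auto simp: square_def insert_commute)
  then have "inc {a, c} \<in> vec.span (inc ` (?G - {{a, c}}))"
    using square_span simple_graph_subset[OF assms(1)] by blast
  then have "vec.dependent (inc ` ?G)"
    using G(1) inc_image_diff[of ?G "{{a, c}}"] unfolding vec.dependent_def
    by (intro bexI[of _ "inc {a, c}"]) (simp_all del: inc_image_diff)
  then show False using ind by simp
qed

text \<open>
  In the union of both squares the vertex \<open>a'\<close> has only the neighbours \<open>b'\<close> and \<open>d'\<close>. An edge of the first
  square that avoids \<open>b'\<close> is disjoint from \<open>a'b'\<close>, hence joined to \<open>a'\<close>, hence contains \<open>d'\<close>. So \<open>{b', d'}\<close>
  meets all edges of the first square, and only diagonals do this.
\<close>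

lemma gap_zero_squares_cover:
  fixes F :: "'n::finite set set"
  assumes "simple_graph F" "gap F = 0"
    and s: "square F a b c d" and s': "square F a' b' c' d'" and a': "a' \<notin> {a, b, c, d}"
  shows "{a, c} = {b', d'} \<or> {b, d} = {b', d'}"
proof -
  \<comment> \<open>in this subgraph the neighbours of \<open>a'\<close> are known\<close>
  define G where "G = {{a, b}, {b, c}, {c, d}, {d, a}, {a', b'}, {b', c'}, {c', d'}, {d', a'}}"
  have sG: "square G a b c d" "square G a' b' c' d'" using s s' by (auto simp: square_def G_def)
  have "G \<subseteq> F" using s s' by (auto simp: square_def G_def)
  then have G: "simple_graph G" "gap G = 0"
    using simple_graph_subset[OF assms(1)] gap_zero_subset[OF assms(1,2)] by auto
  have nb: "w = b' \<or> w = d'" if "{a', w} \<in> G" for w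
    using that a' s' by (auto simp: G_def doubleton_eq_iff square_def)
  have *: "d' = p \<or> d' = q \<or> b' = p \<or> b' = q" if pq: "square G p q x y" "{p, q} \<subseteq> {a, b, c, d}" for p q x y
  proof (rule ccontr)
    assume n: "\<not> (d' = p \<or> d' = q \<or> b' = p \<or> b' = q)"
    have "{a', b'} \<inter> {p, q} = {}" using n a' pq by auto
    moreover have "{a', b'} \<in> G" "{p, q} \<in> G" using sG pq by (auto simp: square_def)
    ultimately obtain w where "w \<in> {p, q}" "{a', w} \<in> G"
      using gap_zero_join[OF G _ square_span[OF G(1) sG(2)] _ square_span[OF G(1) pq(1)], of a'] by blast
    then show False using nb n by auto
  qed
  have "d' = a \<or> d' = b \<or> b' = a \<or> b' = b" "d' = b \<or> d' = c \<or> b' = b \<or> b' = c"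
    "d' = c \<or> d' = d \<or> b' = c \<or> b' = d" "d' = d \<or> d' = a \<or> b' = d \<or> b' = a"
    using *[OF sG(1)] *[OF square_rotate[OF sG(1)]] *[OF square_rotate[OF square_rotate[OF sG(1)]]]
      *[OF square_rotate[OF square_rotate[OF square_rotate[OF sG(1)]]]] by simp_all
  moreover have "distinct [a, b, c, d]" using s by (simp add: square_def)
  ultimately show ?thesis by (auto simp: doubleton_eq_iff)
qed

text \<open>
  Two squares on the same four vertices without a common diagonal would span a complete graph \<open>K\<^sub>4\<close>.
\<close>

lemma gap_zero_share_diagonal:
  fixes F :: "'n::finite set set"
  assumes "simple_graph F" "gap F = 0"
    and s: "square F a b c d" and s': "square F a' b' c' d'"
  shows "{a, c} = {a', c'} \<or> {a, c} = {b', d'} \<or> {b, d} = {a', c'} \<or> {b, d} = {b', d'}"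
proof (cases "{a', b', c', d'} \<subseteq> {a, b, c, d}")
  case False
  note r1 = square_rotate[OF s']
  note r2 = square_rotate[OF r1]
  note r3 = square_rotate[OF r2]
  have sw: "{c', a'} = {a', c'}" "{d', b'} = {b', d'}" by blast+
  from False consider "a' \<notin> {a, b, c, d}" | "b' \<notin> {a, b, c, d}" | "c' \<notin> {a, b, c, d}" | "d' \<notin> {a, b, c, d}"
    by blast
  then show ?thesis
  proof cases
    case 1
    show ?thesis using gap_zero_squares_cover[OF assms(1,2) s s' 1] by argo
  next
    case 2
    show ?thesis using gap_zero_squares_cover[OF assms(1,2) s r1 2] unfolding sw by argo
  next
    case 3
    show ?thesis using gap_zero_squares_cover[OF assms(1,2) s r2 3] unfolding sw by argo
  next
    case 4
    show ?thesis using gap_zero_squares_cover[OF assms(1,2) s r3 4] unfolding sw by argo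
  qed
next
  case True
  have d: "distinct [a, b, c, d]" "distinct [a', b', c', d']" using s s' by (auto simp: square_def)
  have no: "\<not> ({a, c} \<in> F \<and> {b, d} \<in> F)" using gap_zero_no_K4[OF assms(1,2) s] by blast
  have e: "{x, y} \<in> F" if "x \<in> {a', c'}" "y \<in> {b', d'}" for x y
    using s' that by (auto simp: square_def insert_commute)
  have X: "{a', b', c', d'} = {a, b, c, d}"
    using True d by (intro card_subset_eq) auto
  have other: "{b', d'} = {a, b, c, d} - {a', c'}" unfolding X[symmetric] using d(2) by auto
  show ?thesis
  proof (rule ccontr)
    assume n: "\<not> ?thesis"
    have "a' \<in> {a, b, c, d}" "c' \<in> {a, b, c, d}" "a' \<noteq> c'" using True d by auto
    then have "{a', c'} \<in> {{a, b}, {a, c}, {a, d}, {b, c}, {b, d}, {c, d}}"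
      by (elim insertE emptyE) (simp_all add: doubleton_eq_iff)
    moreover have "{a', c'} \<noteq> {a, c}" "{a', c'} \<noteq> {b, d}" using n by argo+
    ultimately have "{a', c'} = {a, b} \<or> {a', c'} = {c, d} \<or> {a', c'} = {a, d} \<or> {a', c'} = {b, c}"
      unfolding insert_iff empty_iff by argo
    then consider "{a', c'} = {a, b}" | "{a', c'} = {c, d}" | "{a', c'} = {a, d}" | "{a', c'} = {b, c}"
      by argo
    then show False
    proof cases
      case 1
      then show False using e[of a c] e[of b d] no d(1) unfolding other 1 by (auto simp: insert_commute)
    next
      case 2
      then show False using e[of c a] e[of d b] no d(1) unfolding other 2 by (auto simp: insert_commute)
    next
      case 3
      then show False using e[of a c] e[of d b] no d(1) unfolding other 3 by (auto simp: insert_commute)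
    next
      case 4
      then show False using e[of c a] e[of b d] no d(1) unfolding other 4 by (auto simp: insert_commute)
    qed
  qed
qed

lemma square_with_diagonal:
  assumes "square F w x y z" "{p, q} = {w, y} \<or> {p, q} = {x, z}"
  obtains r s where "square F p r q s" "{p, q} = {w, y} \<and> {r, s} = {x, z} \<or> {p, q} = {x, z} \<and> {r, s} = {w, y}"
proof -
  have flip: "square F p x q z" if "square F w x y z" "{p, q} = {w, y}" for w x y z
    using that by (auto simp: square_def doubleton_eq_iff insert_commute)
  show ?thesis
    using assms(2)
  proof
    assume "{p, q} = {w, y}"
    then show ?thesis using that[of x z] flip[OF assms(1)] by blast
  next
    assume "{p, q} = {x, z}"
    then show ?thesis using that[of y w] flip[OF square_rotate[OF assms(1)]] by blast
  qed
qed

text \<open>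
  The pairs of diagonals of the squares intersect pairwise. If they have no common element, they form
  a triangle \<open>{P, Q}, {Q, R}, {P, R}\<close>, so that \<open>P, Q, R\<close> span an octahedron. With \<open>P = {a, c}\<close>, \<open>Q = {b, d}\<close> and
  \<open>r \<in> R\<close>, the square \<open>a b r d\<close> has the diagonals \<open>{a, r}\<close> and \<open>Q\<close> and shares none with the square \<open>{P, R}\<close>.
\<close>

lemma gap_zero_common_diagonal:
  fixes F :: "'n::finite set set"
  assumes "simple_graph F" "gap F = 0" and s: "square F a b c d"
  shows "\<exists>A. card A = 2 \<and> (\<forall>a b c d. square F a b c d \<longrightarrow> A = {a, c} \<or> A = {b, d})"
proof (rule ccontr)
  assume no: "\<nexists>A. card A = 2 \<and> (\<forall>a b c d. square F a b c d \<longrightarrow> A = {a, c} \<or> A = {b, d})"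
  note share = gap_zero_share_diagonal[OF assms(1,2)]
  have ds: "distinct [a, b, c, d]" using s by (simp add: square_def)
  then have "card {a, c} = 2" "card {b, d} = 2" by auto
  then obtain a1 b1 c1 d1 a2 b2 c2 d2 where
    s1: "square F a1 b1 c1 d1" "{a, c} \<noteq> {a1, c1}" "{a, c} \<noteq> {b1, d1}" and
    s2: "square F a2 b2 c2 d2" "{b, d} \<noteq> {a2, c2}" "{b, d} \<noteq> {b2, d2}"
    using no by meson
  have "{b, d} = {a1, c1} \<or> {b, d} = {b1, d1}" using share[OF s s1(1)] s1(2,3) by argo
  then obtain r t where rt: "square F b r d t" "{r, t} \<noteq> {a, c}"
    by (rule square_with_diagonal[OF s1(1)]) (use s1 in metis)
  have "{a, c} = {a2, c2} \<or> {a, c} = {b2, d2}" using share[OF s s2(1)] s2(2,3) by argo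
  then obtain v w where vw: "square F a v c w" "{v, w} \<noteq> {b, d}"
    by (rule square_with_diagonal[OF s2(1)]) (use s2 in metis)
  have drt: "distinct [b, r, d, t]" and dvw: "distinct [a, v, c, w]" using rt vw by (auto simp: square_def)
  have ne: "{b, d} \<noteq> {a, c}" using ds by (auto simp: doubleton_eq_iff)
  have eq: "{r, t} = {v, w}" using share[OF rt(1) vw(1)] ne rt(2) vw(2) by metis
  then have r: "r \<noteq> a" "r \<noteq> c" "t \<noteq> a" using dvw by (auto simp: doubleton_eq_iff)
  have "square F a b r d" using s rt r ds drt by (auto simp: square_def)
  from share[OF this vw(1)] have "{a, r} = {a, c} \<or> {a, r} = {r, t} \<or> {b, d} = {a, c} \<or> {b, d} = {v, w}"
    unfolding eq .
  then show False using r ne vw(2) by (auto simp: doubleton_eq_iff)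
qed

section \<open>The graphs with gap zero\<close>

definition diagonal_of_squares :: "'n set set \<Rightarrow> 'n set \<Rightarrow> bool" where
  "diagonal_of_squares F A \<longleftrightarrow> card A = 2 \<and> (\<forall>a b c d. square F a b c d \<longrightarrow> A = {a, c} \<or> A = {b, d})"

lemma four_cycle_edges_eq: "four_cycle_edges F = (\<Union>p\<in>{p. four_cycle F p}. walk_edges p)"
  by (simp add: four_cycle_edges_def walk_edges_def)

lemma square_four_cycle_edges: "square F a b c d \<Longrightarrow> {a, b} \<in> four_cycle_edges F"
  unfolding four_cycle_edges_eq four_cycle_iff_square by (fastforce simp: walk_edges_Cons)

lemma four_cycle_edgesE:
  assumes "e \<in> four_cycle_edges F"
  obtains a b c d where "square F a b c d" "e = {a, b}"
proof -
  obtain a b c d where s: "square F a b c d" "e \<in> walk_edges [a, b, c, d, a]"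
    using assms unfolding four_cycle_edges_eq four_cycle_iff_square by blast
  note r = square_rotate[OF s(1)]
  note rr = square_rotate[OF r]
  note rrr = square_rotate[OF rr]
  from s(2) have "e = {a, b} \<or> e = {b, c} \<or> e = {c, d} \<or> e = {d, a}"
    by (simp add: walk_edges_Cons)
  then show ?thesis using that s(1) r rr rrr by metis
qed

lemma four_cycle_verts_iff: "v \<in> four_cycle_verts F \<longleftrightarrow> (\<exists>b c d. square F v b c d)"
proof
  assume "v \<in> four_cycle_verts F"
  then obtain a b c d where s: "square F a b c d" "v \<in> {a, b, c, d}"
    unfolding four_cycle_verts_def four_cycle_iff_square by auto
  note r = square_rotate[OF s(1)]
  note rr = square_rotate[OF r]
  show "\<exists>b c d. square F v b c d"
    using s r rr square_rotate[OF rr] by auto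
next
  assume "\<exists>b c d. square F v b c d"
  then obtain b c d where "square F v b c d" by blast
  then show "v \<in> four_cycle_verts F"
    unfolding four_cycle_verts_def four_cycle_iff_square by (intro UN_I[of "[v, b, c, d, v]"]) auto
qed

text \<open>
  In a bipartition of the 4-cycle edges each 4-cycle has a diagonal in the class of two vertices.
  Conversely a common diagonal can serve as this class, since every edge of a 4-cycle has exactly
  one end on each diagonal.
\<close>

lemma bipartite_iff_diagonal:
  fixes F :: "'n::finite set set"
  shows "(\<exists>s. bipartite_of_type (four_cycle_verts F) (four_cycle_edges F) 2 s) \<longleftrightarrow>
    (\<exists>a b c d. square F a b c d) \<and> (\<exists>A. diagonal_of_squares F A)"
proof
  assume "\<exists>s. bipartite_of_type (four_cycle_verts F) (four_cycle_edges F) 2 s"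
  then obtain A B where AB: "A \<inter> B = {}" "A \<union> B = four_cycle_verts F" "card A = 2"
    and e: "\<forall>e\<in>four_cycle_edges F. \<exists>u\<in>A. \<exists>v\<in>B. e = {u, v}"
    unfolding bipartite_of_type_def by blast
  have "A \<noteq> {}" using AB(3) by auto
  then have ex: "\<exists>a b c d. square F a b c d" using AB(2) four_cycle_verts_iff[of _ F] by blast
  have step: "(a \<in> A \<longleftrightarrow> b \<in> B) \<and> (a \<in> B \<longleftrightarrow> b \<in> A) \<and> a \<in> A \<union> B" if abcd: "square F a b c d" for a b c d
  proof -
    obtain u v where "u \<in> A" "v \<in> B" "{a, b} = {u, v}"
      using e square_four_cycle_edges[OF abcd] by blast
    then show ?thesis using AB(1) by (auto simp: doubleton_eq_iff)
  qed
  have "A = {a, c} \<or> A = {b, d}" if s: "square F a b c d" for a b c d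
  proof -
    have ne: "a \<noteq> c" "b \<noteq> d" using s by (auto simp: square_def)
    note r = square_rotate[OF s]
    have "{a, c} \<subseteq> A \<or> {b, d} \<subseteq> A"
      using step[OF s] step[OF r] step[OF square_rotate[OF r]] by blast
    then have "{a, c} = A \<or> {b, d} = A"
      using AB(3) ne using card_subset_eq[OF finite, of "{a, c}" A] card_subset_eq[OF finite, of "{b, d}" A] by auto
    then show ?thesis by argo
  qed
  then show "(\<exists>a b c d. square F a b c d) \<and> (\<exists>A. diagonal_of_squares F A)"
    using ex AB(3) unfolding diagonal_of_squares_def by blast
next
  assume "(\<exists>a b c d. square F a b c d) \<and> (\<exists>A. diagonal_of_squares F A)"
  then obtain a b c d A where s: "square F a b c d" and A: "card A = 2"
    "\<And>a b c d. square F a b c d \<Longrightarrow> A = {a, c} \<or> A = {b, d}"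
    unfolding diagonal_of_squares_def by blast
  define B where "B = four_cycle_verts F - A"
  note r = square_rotate[OF s]
  have "a \<in> four_cycle_verts F" "b \<in> four_cycle_verts F" "c \<in> four_cycle_verts F" "d \<in> four_cycle_verts F"
    unfolding four_cycle_verts_iff using s r square_rotate[OF r] square_rotate[OF square_rotate[OF r]] by blast+
  then have "A \<union> B = four_cycle_verts F" using A(2)[OF s] by (auto simp: B_def)
  moreover have "\<exists>u\<in>A. \<exists>v\<in>B. e = {u, v}" if e: "e \<in> four_cycle_edges F" for e
  proof -
    obtain a b c d where t: "square F a b c d" "e = {a, b}" by (rule four_cycle_edgesE[OF e])
    have d: "distinct [a, b, c, d]" using t(1) by (simp add: square_def)
    have v: "a \<in> four_cycle_verts F" "b \<in> four_cycle_verts F"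
      unfolding four_cycle_verts_iff using t(1) square_rotate[OF t(1)] by blast+
    from A(2)[OF t(1)] show ?thesis
    proof
      assume "A = {a, c}"
      then have "a \<in> A" "b \<in> B" using d v by (auto simp: B_def)
      then show ?thesis using t(2) by blast
    next
      assume "A = {b, d}"
      then have "b \<in> A" "a \<in> B" using d v by (auto simp: B_def)
      then show ?thesis using t(2) insert_commute[of a b "{}"] by blast
    qed
  qed
  moreover have "A \<inter> B = {}" by (auto simp: B_def)
  ultimately have "bipartite_of_type (four_cycle_verts F) (four_cycle_edges F) 2 (card B)"
    unfolding bipartite_of_type_def using A(1) finite by metis
  then show "\<exists>s. bipartite_of_type (four_cycle_verts F) (four_cycle_edges F) 2 s" ..
qed

text \<open>
  A square \<open>u z v w\<close> has a vertex \<open>z \<noteq> x\<close>, up to renaming, and then \<open>uz\<close> is opposite to \<open>vx\<close> in \<open>u z v x\<close>.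
\<close>

lemma diagonal_squares_opposite:
  fixes F :: "'n::finite set set"
  assumes "diagonal_of_squares F {u, v}" and s: "square F u x v y"
  shows "\<not> square (F - opposite F {v, x}) a b c d"
proof
  let ?G = "F - opposite F {v, x}"
  assume t: "square ?G a b c d"
  have "square F a b c d" using square_mono[OF t] by auto
  then have "{u, v} = {a, c} \<or> {u, v} = {b, d}" using assms(1) unfolding diagonal_of_squares_def by blast
  then obtain z w where zw: "square ?G u z v w" using square_with_diagonal[OF t] by metis
  have key: False if zw: "square ?G u z v w" and "z \<noteq> x" for z w
  proof -
    have G: "{u, z} \<in> ?G" "{z, v} \<in> F" "u \<noteq> z" "z \<noteq> v" "u \<noteq> v" using zw by (auto simp: square_def)
    have F: "{u, x} \<in> F" "{x, v} \<in> F" "x \<noteq> u" "x \<noteq> v" using s by (auto simp: square_def)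
    have "inc {v, x} + inc {u, z} = inc {z, v} + inc {u, x}"
      using G F by (simp add: inc_edge algebra_simps)
    moreover have "{z, v} \<noteq> {v, x}" "{u, x} \<noteq> {v, x}" using G F \<open>z \<noteq> x\<close> by (auto simp: doubleton_eq_iff)
    ultimately have "{u, z} \<in> opposite F {v, x}"
      using G F unfolding opposite_def by blast
    then show False using G by blast
  qed
  have "z \<noteq> w" using zw by (auto simp: square_def)
  moreover have "square ?G u w v z" using zw by (auto simp: square_def insert_commute)
  ultimately show False using key[OF zw] key[of w z] by blast
qed

text \<open>
  Induction on the number of edges. If some square \<open>u x v y\<close> is left, removing \<open>vx\<close> keeps the hypotheses,
  and the edges not opposite to \<open>vx\<close> contain no square, hence are independent.
\<close>

lemma gap_zero_of_diagonal:
  fixes F :: "'n::finite set set"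
  assumes "simple_graph F" "diagonal_of_squares F A"
    and "\<And>W. primitive_even_walk F W \<Longrightarrow> four_cycle F W"
  shows "gap F = 0"
proof -
  have gen: "simple_graph F \<and> diagonal_of_squares F A \<and> (\<forall>W. primitive_even_walk F W \<longrightarrow> four_cycle F W)
      \<longrightarrow> gap F = 0" for F
  proof (induction "card F" arbitrary: F rule: less_induct)
    case less
    show ?case
    proof (intro impI, elim conjE)
      assume F: "simple_graph F" "diagonal_of_squares F A" "\<forall>W. primitive_even_walk F W \<longrightarrow> four_cycle F W"
      have sub: "simple_graph G \<and> diagonal_of_squares G A \<and> (\<forall>W. primitive_even_walk G W \<longrightarrow> four_cycle G W)"
        if "G \<subseteq> F" for G
      proof (intro conjI allI impI)
        show "simple_graph G" by (rule simple_graph_subset[OF F(1) that])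
        show "diagonal_of_squares G A"
          using F(2) square_mono[OF _ that] unfolding diagonal_of_squares_def by blast
        fix W assume W: "primitive_even_walk G W"
        then have "walk_length W = 4"
          using F(3) primitive_even_walk_mono[OF W that] by (simp add: four_cycle_def)
        then show "four_cycle G W" using short_primitive_even_walk[OF W] by simp
      qed
      show "gap F = 0"
      proof (cases "no_primitive F")
        case True
        then show ?thesis using gap_independent no_primitive_independent[OF F(1)] by blast
      next
        case False
        then obtain a b c d where sq0: "square F a b c d"
          using F(3) unfolding no_primitive_def four_cycle_iff_square by blast
        obtain u v where uv: "A = {u, v}" using F(2) unfolding diagonal_of_squares_def card_2_iff by blast
        then have "{u, v} = {a, c} \<or> {u, v} = {b, d}"
          using F(2) sq0 unfolding diagonal_of_squares_def by blast
        then obtain x y where s: "square F u x v y" using square_with_diagonal[OF sq0] by metis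
        have e: "{v, x} \<in> F" using s by (simp add: square_def insert_commute)
        have "card (F - {{v, x}}) < card F" by (rule card_Diff1_less[OF finite e])
        then have "gap (F - {{v, x}}) = 0" using less sub[OF Diff_subset] by blast
        moreover have "no_primitive (F - opposite F {v, x})"
          using sub[OF Diff_subset, of "opposite F {v, x}"] diagonal_squares_opposite[OF F(2)[unfolded uv] s]
          unfolding no_primitive_def four_cycle_iff_square by blast
        then have "vec.independent (inc ` (F - opposite F {v, x}))"
          using no_primitive_independent simple_graph_subset[OF F(1)] by blast
        ultimately show ?thesis using gap_zeroI[OF F(1) e] by blast
      qed
    qed
  qed
  then show ?thesis using assms by blast
qed

theorem gap_zero_iff:
  fixes E :: "'n::finite set set"
  assumes "simple_graph E"
  shows "gap E = 0 \<longleftrightarrow>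
      (\<nexists>W. primitive_even_walk E W) \<or>
      ((\<exists>s. bipartite_of_type (four_cycle_verts E) (four_cycle_edges E) 2 s) \<and>
       (\<nexists>W. primitive_even_walk E W \<and> walk_length W > 4))"
proof (intro iffI)
  assume gap: "gap E = 0"
  have four: "four_cycle E W" if "primitive_even_walk E W" for W
    using gap_zero_primitive_walk[OF assms gap that] .
  show "(\<nexists>W. primitive_even_walk E W) \<or>
      ((\<exists>s. bipartite_of_type (four_cycle_verts E) (four_cycle_edges E) 2 s) \<and>
       (\<nexists>W. primitive_even_walk E W \<and> walk_length W > 4))"
  proof (cases "\<exists>W. primitive_even_walk E W")
    case True
    then obtain W where "four_cycle E W" using four by blast
    then obtain a b c d where s: "square E a b c d" unfolding four_cycle_iff_square by blast
    then have "\<exists>A. diagonal_of_squares E A"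
      using gap_zero_common_diagonal[OF assms gap] unfolding diagonal_of_squares_def by blast
    moreover have "\<nexists>W. primitive_even_walk E W \<and> walk_length W > 4"
      using four by (auto simp: four_cycle_def)
    ultimately show ?thesis using s bipartite_iff_diagonal[of E] by blast
  qed blast
next
  assume rhs: "(\<nexists>W. primitive_even_walk E W) \<or>
      ((\<exists>s. bipartite_of_type (four_cycle_verts E) (four_cycle_edges E) 2 s) \<and>
       (\<nexists>W. primitive_even_walk E W \<and> walk_length W > 4))"
  show "gap E = 0"
  proof (cases "no_primitive E")
    case True
    then show ?thesis using gap_independent no_primitive_independent[OF assms] by blast
  next
    case False
    then have "\<exists>A. diagonal_of_squares E A" and short: "\<And>W. primitive_even_walk E W \<Longrightarrow> walk_length W \<le> 4"
      using rhs bipartite_iff_diagonal[of E] by (auto simp: no_primitive_def not_less)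
    then obtain A where A: "diagonal_of_squares E A" by blast
    show ?thesis
      by (rule gap_zero_of_diagonal[OF assms A short_primitive_even_walk[OF _ short]])
  qed
qed

section \<open>Monomial ideals and their numbers of generators\<close>

type_synonym 'n exps = "'n \<Rightarrow>\<^sub>0 nat"
type_synonym ('n, 'k) mpoly = "('n \<Rightarrow>\<^sub>0 nat) \<Rightarrow>\<^sub>0 'k"

abbreviation lookup :: "('a \<Rightarrow>\<^sub>0 'b::zero) \<Rightarrow> 'a \<Rightarrow> 'b" where
  "lookup \<equiv> Poly_Mapping.lookup"

abbreviation keys :: "('a \<Rightarrow>\<^sub>0 'b::zero) \<Rightarrow> 'a set" where
  "keys \<equiv> Poly_Mapping.keys"

abbreviation tring :: "'a::comm_ring_1 ring" where
  "tring \<equiv> ring_of_type_algebra"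

lemma tring_simps [simp]:
  "carrier tring = UNIV" "monoid.mult tring = (*)" "one tring = 1" "ring.zero tring = 0" "add tring = (+)"
  by (simp_all add: ring_of_type_algebra_def fun_eq_iff)

lemma cring_tring: "cring (tring :: 'a::comm_ring_1 ring)"
  by (rule cring_from_type_algebra)

lemma ring_tring: "ring (tring :: 'a::comm_ring_1 ring)"
  by (rule ring_from_type_algebra)

lemma tring_a_inv: "\<ominus>\<^bsub>tring\<^esub> (x :: 'a::comm_ring_1) = - x"
  using abelian_group.minus_equality[of tring "- x" x] ring.is_abelian_group[OF ring_tring] by force

lemma ideal_tring_iff:
  "ideal I (tring :: 'a::comm_ring_1 ring) \<longleftrightarrow>
     0 \<in> I \<and> (\<forall>x\<in>I. \<forall>y\<in>I. x + y \<in> I) \<and> (\<forall>x\<in>I. \<forall>r. r * x \<in> I)"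
proof
  assume "ideal I (tring :: 'a ring)"
  note * = this
  show "0 \<in> I \<and> (\<forall>x\<in>I. \<forall>y\<in>I. x + y \<in> I) \<and> (\<forall>x\<in>I. \<forall>r. r * x \<in> I)"
    using additive_subgroup.zero_closed[OF ideal.axioms(1)[OF *]]
      additive_subgroup.a_closed[OF ideal.axioms(1)[OF *]] ideal.I_l_closed[OF *] by auto
next
  assume *: "0 \<in> I \<and> (\<forall>x\<in>I. \<forall>y\<in>I. x + y \<in> I) \<and> (\<forall>x\<in>I. \<forall>r. r * x \<in> I)"
  show "ideal I (tring :: 'a ring)"
  proof (rule idealI[OF ring_tring])
    interpret R: ring "tring :: 'a ring" by (rule ring_tring)
    have "- x \<in> I" if "x \<in> I" for x
      using *[THEN conjunct2, THEN conjunct2, rule_format, OF that, of "- 1"] by simp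
    then have "inv\<^bsub>add_monoid tring\<^esub> x \<in> I" if "x \<in> I" for x
      using that tring_a_inv[of x] by (simp add: a_inv_def)
    then show "subgroup I (add_monoid (tring :: 'a ring))"
      using * by (auto intro!: subgroup.intro)
  qed (use * in \<open>auto simp: mult.commute\<close>)
qed

lemma ideal_tring_sum:
  assumes "ideal I (tring :: 'a::comm_ring_1 ring)" "\<And>x. x \<in> A \<Longrightarrow> f x \<in> I"
  shows "sum f A \<in> I"
  using assms by (induction A rule: infinite_finite_induct) (auto simp: ideal_tring_iff)

lemma genideal_subset:
  "ideal I (tring :: 'a::comm_ring_1 ring) \<Longrightarrow> S \<subseteq> I \<Longrightarrow> Idl\<^bsub>tring\<^esub> S \<subseteq> I"
  by (auto simp: genideal_def)

lemma genideal_superset: "S \<subseteq> Idl\<^bsub>(tring :: 'a::comm_ring_1 ring)\<^esub> S"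
  by (auto simp: genideal_def)

lemma genideal_is_ideal: "ideal (Idl\<^bsub>(tring :: 'a::comm_ring_1 ring)\<^esub> S) tring"
  by (rule ring.genideal_ideal[OF ring_tring]) simp

text \<open>
  The monomial \<open>x\<^sup>m\<close>.
\<close>

definition xpow :: "'a \<Rightarrow> ('a::comm_monoid_add) \<Rightarrow>\<^sub>0 'k::comm_ring_1" where
  "xpow m = Poly_Mapping.single m 1"

lemma xpow_mult: "xpow a * xpow b = xpow (a + b)"
  by (simp add: xpow_def mult_single)

lemma keys_xpow [simp]: "keys (xpow m :: _ \<Rightarrow>\<^sub>0 'k::comm_ring_1) = {m}"
  by (simp add: xpow_def)

lemma lookup_xpow: "lookup (xpow a :: _ \<Rightarrow>\<^sub>0 'k::comm_ring_1) m = (if a = m then 1 else 0)"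
  by (simp add: xpow_def lookup_single)

abbreviation coeff_const :: "'k::comm_ring_1 \<Rightarrow> ('a::comm_monoid_add) \<Rightarrow>\<^sub>0 'k" where
  "coeff_const c \<equiv> Poly_Mapping.single 0 c"

lemma poly_expand:
  fixes p :: "('a::comm_monoid_add) \<Rightarrow>\<^sub>0 'k::comm_ring_1"
  assumes "finite S" "keys p \<subseteq> S"
  shows "p = (\<Sum>m\<in>S. coeff_const (lookup p m) * xpow m)"
proof (rule poly_mapping_eqI)
  fix k
  have "lookup (\<Sum>m\<in>S. coeff_const (lookup p m) * xpow m) k = (\<Sum>m\<in>S. lookup p m when m = k)"
    unfolding lookup_sum xpow_def mult_single by (simp add: lookup_single)
  also have "\<dots> = lookup p k"
    using assms by (auto simp: when_def sum.delta in_keys_iff)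
  finally show "lookup p k = lookup (\<Sum>m\<in>S. coeff_const (lookup p m) * xpow m) k" ..
qed

text \<open>
  The ideal of all polynomials whose monomials are multiples of monomials with exponents in \<open>U\<close>. This explicit
  form makes membership in products and powers of monomial ideals a matter of exponents.
\<close>

definition mon_ideal :: "('a::comm_monoid_add) set \<Rightarrow> ('a \<Rightarrow>\<^sub>0 'k::comm_ring_1) set" where
  "mon_ideal U = {p. \<forall>m\<in>keys p. \<exists>a\<in>U. \<exists>b. m = a + b}"

lemma ideal_mon_ideal: "ideal (mon_ideal U :: ('a::comm_monoid_add \<Rightarrow>\<^sub>0 'k::comm_ring_1) set) tring"
  unfolding ideal_tring_iff
proof (intro conjI ballI allI)
  fix p q :: "'a \<Rightarrow>\<^sub>0 'k" assume "p \<in> mon_ideal U" "q \<in> mon_ideal U"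
  then show "p + q \<in> mon_ideal U"
    using keys_add[of p q] unfolding mon_ideal_def by blast
next
  fix p r :: "'a \<Rightarrow>\<^sub>0 'k" assume p: "p \<in> mon_ideal U"
  show "r * p \<in> mon_ideal U"
    unfolding mon_ideal_def mem_Collect_eq
  proof
    fix m assume "m \<in> keys (r * p)"
    then obtain u v where "m = u + v" "v \<in> keys p" using keys_mult[of r p] by blast
    moreover from this obtain a b where "a \<in> U" "v = a + b" using p by (auto simp: mon_ideal_def)
    ultimately have "m = a + (u + b)" by (simp add: algebra_simps)
    then show "\<exists>a\<in>U. \<exists>b. m = a + b" using \<open>a \<in> U\<close> by blast
  qed
qed (simp add: mon_ideal_def)

lemma xpow_in_mon_ideal: "a \<in> U \<Longrightarrow> xpow (a + b) \<in> mon_ideal U"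
  by (auto simp: mon_ideal_def)

lemma mon_ideal_least:
  assumes I: "ideal I (tring :: ('a::comm_monoid_add \<Rightarrow>\<^sub>0 'k::comm_ring_1) ring)"
    and "xpow ` U \<subseteq> I"
  shows "mon_ideal U \<subseteq> I"
proof
  fix p :: "'a \<Rightarrow>\<^sub>0 'k" assume p: "p \<in> mon_ideal U"
  have "(\<Sum>m\<in>keys p. coeff_const (lookup p m) * xpow m) \<in> I"
  proof (rule ideal_tring_sum[OF I])
    fix m assume "m \<in> keys p"
    then obtain a b where "a \<in> U" "m = a + b" using p by (auto simp: mon_ideal_def)
    then have "coeff_const (lookup p m) * xpow m = (coeff_const (lookup p m) * xpow b) * xpow a"
      by (simp add: xpow_mult mult.assoc add.commute)
    moreover have "xpow a \<in> I" using \<open>a \<in> U\<close> assms(2) by blast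
    ultimately show "coeff_const (lookup p m) * xpow m \<in> I"
      using I unfolding ideal_tring_iff by metis
  qed
  then show "p \<in> I" using poly_expand[of "keys p" p] by simp
qed

lemma Idl_xpow: "Idl\<^bsub>tring\<^esub> (xpow ` U) = (mon_ideal U :: ('a::comm_monoid_add \<Rightarrow>\<^sub>0 'k::comm_ring_1) set)"
proof
  show "Idl\<^bsub>tring\<^esub> (xpow ` U) \<subseteq> (mon_ideal U :: ('a \<Rightarrow>\<^sub>0 'k) set)"
    by (rule genideal_subset[OF ideal_mon_ideal]) (use xpow_in_mon_ideal[of _ U 0] in auto)
  show "(mon_ideal U :: ('a \<Rightarrow>\<^sub>0 'k) set) \<subseteq> Idl\<^bsub>tring\<^esub> (xpow ` U)"
    by (rule mon_ideal_least[OF genideal_is_ideal genideal_superset])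
qed

definition sumset :: "('a::comm_monoid_add) set \<Rightarrow> 'a set \<Rightarrow> 'a set" where
  "sumset U V = {a + b | a b. a \<in> U \<and> b \<in> V}"

lemma mon_ideal_mult:
  assumes "p \<in> mon_ideal U" "q \<in> mon_ideal V"
  shows "p * q \<in> mon_ideal (sumset U V)"
  unfolding mon_ideal_def mem_Collect_eq
proof
  fix m assume "m \<in> keys (p * q)"
  then obtain u v where "m = u + v" "u \<in> keys p" "v \<in> keys q" using keys_mult[of p q] by blast
  moreover from this obtain a b where "a \<in> U" "u = a + b" using assms by (auto simp: mon_ideal_def)
  moreover from calculation obtain c d where "c \<in> V" "v = c + d" using assms by (auto simp: mon_ideal_def)
  ultimately have "m = (a + c) + (b + d)" "a + c \<in> sumset U V" by (auto simp: algebra_simps sumset_def)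
  then show "\<exists>a\<in>sumset U V. \<exists>b. m = a + b" by blast
qed

lemma ideal_prod_mon_ideal:
  "mon_ideal U \<cdot>\<^bsub>tring\<^esub> mon_ideal V = (mon_ideal (sumset U V) :: ('a::comm_monoid_add \<Rightarrow>\<^sub>0 'k::comm_ring_1) set)"
proof
  show "mon_ideal U \<cdot>\<^bsub>tring\<^esub> mon_ideal V \<subseteq> (mon_ideal (sumset U V) :: ('a \<Rightarrow>\<^sub>0 'k) set)"
  proof
    fix p :: "'a \<Rightarrow>\<^sub>0 'k" assume "p \<in> mon_ideal U \<cdot>\<^bsub>tring\<^esub> mon_ideal V"
    then show "p \<in> mon_ideal (sumset U V)"
      by (induction rule: ideal_prod.induct)
        (use ideal_mon_ideal[of "sumset U V", unfolded ideal_tring_iff] in \<open>auto simp: mon_ideal_mult\<close>)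
  qed
  have "ideal (mon_ideal U \<cdot>\<^bsub>tring\<^esub> mon_ideal V) (tring :: ('a \<Rightarrow>\<^sub>0 'k) ring)"
    by (rule ring.ideal_prod_is_ideal[OF ring_tring ideal_mon_ideal ideal_mon_ideal])
  moreover have "xpow ` sumset U V \<subseteq> mon_ideal U \<cdot>\<^bsub>tring\<^esub> (mon_ideal V :: ('a \<Rightarrow>\<^sub>0 'k) set)"
  proof clarify
    fix m assume "m \<in> sumset U V"
    then obtain a b where "a \<in> U" "b \<in> V" "m = a + b" by (auto simp: sumset_def)
    then have "xpow m = xpow a \<otimes>\<^bsub>(tring :: ('a \<Rightarrow>\<^sub>0 'k) ring)\<^esub> xpow b" by (simp add: xpow_mult)
    also have "\<dots> \<in> mon_ideal U \<cdot>\<^bsub>tring\<^esub> mon_ideal V"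
      using \<open>a \<in> U\<close> \<open>b \<in> V\<close> xpow_in_mon_ideal[of a U 0] xpow_in_mon_ideal[of b V 0]
      by (intro ideal_prod.prod) auto
    finally show "xpow m \<in> mon_ideal U \<cdot>\<^bsub>tring\<^esub> (mon_ideal V :: ('a \<Rightarrow>\<^sub>0 'k) set)" .
  qed
  ultimately show "(mon_ideal (sumset U V) :: ('a \<Rightarrow>\<^sub>0 'k) set) \<subseteq> mon_ideal U \<cdot>\<^bsub>tring\<^esub> mon_ideal V"
    by (rule mon_ideal_least)
qed

primrec ksum :: "('a::comm_monoid_add) set \<Rightarrow> nat \<Rightarrow> 'a set" where
  "ksum U 0 = {0}"
| "ksum U (Suc k) = sumset (ksum U k) U"

lemma ideal_power_mon_ideal:
  "ideal_power tring (mon_ideal U :: ('a::comm_monoid_add \<Rightarrow>\<^sub>0 'k::comm_ring_1) set) k = mon_ideal (ksum U k)"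
proof (induction k)
  case 0
  then show ?case by (simp add: ideal_power_def ideals_set_def mon_ideal_def)
next
  case (Suc k)
  then show ?case
    by (simp add: ideal_power_def ideals_set_def ideal_prod_mon_ideal)
qed

definition cscale :: "'k::field \<Rightarrow> ('a::comm_monoid_add \<Rightarrow>\<^sub>0 'k) \<Rightarrow> ('a \<Rightarrow>\<^sub>0 'k)" where
  "cscale c p = coeff_const c * p"

lemma lookup_cscale: "lookup (cscale c p) m = c * lookup p m"
proof -
  have "cscale c p = Poly_Mapping.map ((*) c) p" by (simp add: cscale_def mult_map_scale_conv_mult)
  then show ?thesis by (simp add: Poly_Mapping.map.rep_eq when_def)
qed

interpretation poly: vector_space "cscale :: 'k::field \<Rightarrow> ('a::comm_monoid_add \<Rightarrow>\<^sub>0 'k) \<Rightarrow> _"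
proof
  fix a b :: 'k and x y :: "'a \<Rightarrow>\<^sub>0 'k"
  show "cscale a (x + y) = cscale a x + cscale a y" by (simp add: cscale_def algebra_simps)
  show "cscale (a + b) x = cscale a x + cscale b x" by (simp add: cscale_def algebra_simps single_add)
  show "cscale a (cscale b x) = cscale (a * b) x"
    by (simp add: cscale_def mult_single flip: mult.assoc)
  show "cscale 1 x = x" by (simp add: cscale_def)
qed

lemma span_xpow:
  fixes p :: "'a::comm_monoid_add \<Rightarrow>\<^sub>0 'k::field"
  assumes "keys p \<subseteq> S"
  shows "p \<in> poly.span (xpow ` S)"
proof -
  have "(\<Sum>m\<in>keys p. cscale (lookup p m) (xpow m)) \<in> poly.span (xpow ` S)"
    using assms by (intro poly.span_sum poly.span_scale poly.span_base) auto
  then show ?thesis using poly_expand[of "keys p" p] by (simp add: cscale_def)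
qed

lemma inj_xpow: "inj (xpow :: 'a::comm_monoid_add \<Rightarrow> ('a \<Rightarrow>\<^sub>0 'k::field))"
  by (rule injI) (metis keys_xpow singleton_inject)

lemma independent_xpow: "poly.independent (xpow ` S :: ('a::comm_monoid_add \<Rightarrow>\<^sub>0 'k::field) set)"
proof
  assume "poly.dependent (xpow ` S :: ('a \<Rightarrow>\<^sub>0 'k) set)"
  then obtain T u v where T: "finite T" "T \<subseteq> xpow ` S" "(\<Sum>x\<in>T. cscale (u x) x) = (0 :: 'a \<Rightarrow>\<^sub>0 'k)"
    and v: "v \<in> T" "u v \<noteq> 0"
    unfolding poly.dependent_explicit by blast
  obtain m where m: "v = xpow m" using T v by auto
  have "0 = lookup (\<Sum>x\<in>T. cscale (u x) x) m" using T by simp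
  also have "\<dots> = (\<Sum>x\<in>T. u x * lookup x m)" by (simp add: lookup_sum lookup_cscale)
  also have "\<dots> = (\<Sum>x\<in>T. if x = v then u v else 0)"
  proof (rule sum.cong)
    fix x assume "x \<in> T"
    then obtain a where "x = xpow a" using T by auto
    then show "u x * lookup x m = (if x = v then u v else 0)"
      using m by (simp add: inj_eq[OF inj_xpow] lookup_xpow)
  qed simp
  also have "\<dots> = u v" using T v by simp
  finally show False using v by simp
qed

text \<open>
  Indexed families are used because different indices may give the same polynomial.
\<close>

lemma linear_relation:
  fixes v :: "'i \<Rightarrow> ('a::comm_monoid_add \<Rightarrow>\<^sub>0 'k::field)"
  assumes "finite I" "finite U" "\<And>i. i \<in> I \<Longrightarrow> keys (v i) \<subseteq> U" "card U < card I"
  obtains c where "\<exists>i\<in>I. c i \<noteq> 0" "(\<Sum>i\<in>I. cscale (c i) (v i)) = 0"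
proof (cases "inj_on v I")
  case False
  then obtain i j where ij: "i \<in> I" "j \<in> I" "i \<noteq> j" "v i = v j" by (auto simp: inj_on_def)
  let ?c = "\<lambda>k. if k = i then 1 else if k = j then -1 else (0 :: 'k)"
  have "(\<Sum>k\<in>I. cscale (?c k) (v k)) = (\<Sum>k\<in>{i, j}. cscale (?c k) (v k))"
    by (rule sum.mono_neutral_right) (use ij assms in \<open>auto simp: cscale_def\<close>)
  also have "\<dots> = 0" using ij by (simp add: cscale_def single_uminus)
  finally have "(\<Sum>k\<in>I. cscale (?c k) (v k)) = 0" .
  moreover have "\<exists>k\<in>I. ?c k \<noteq> 0" by (rule bexI[of _ i]) (use ij in auto)
  ultimately show ?thesis by (rule that[rotated])
next
  case True
  have sp: "v ` I \<subseteq> poly.span (xpow ` U)" using span_xpow[OF assms(3)] by blast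
  have "poly.dependent (v ` I)"
  proof (rule ccontr)
    assume "\<not> poly.dependent (v ` I)"
    then have "card (v ` I) \<le> card (xpow ` U :: ('a \<Rightarrow>\<^sub>0 'k) set)"
      using poly.independent_span_bound[OF finite_imageI[OF assms(2)] _ sp] by blast
    then show False
      using assms(4) card_image[OF True] card_image_le[OF assms(2), of "xpow :: 'a \<Rightarrow> ('a \<Rightarrow>\<^sub>0 'k)"]
      by linarith
  qed
  then obtain u w where u: "(\<Sum>x\<in>v ` I. cscale (u x) x) = 0" "w \<in> v ` I" "u w \<noteq> 0"
    using assms(1) by (auto simp: poly.dependent_finite)
  show ?thesis
  proof (rule that)
    show "\<exists>i\<in>I. (u \<circ> v) i \<noteq> 0" using u by auto
    show "(\<Sum>i\<in>I. cscale ((u \<circ> v) i) (v i)) = 0" using u(1) by (simp add: sum.reindex[OF True])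
  qed
qed

definition mdeg :: "('n::finite) exps \<Rightarrow> nat" where
  "mdeg m = (\<Sum>i\<in>UNIV. lookup m i)"

lemma mdeg_add: "mdeg (a + b) = mdeg a + mdeg b"
  by (simp add: mdeg_def lookup_add sum.distrib)

lemma mdeg_eq_0_iff: "mdeg m = 0 \<longleftrightarrow> m = 0"
  by (simp add: mdeg_def poly_mapping_eq_iff fun_eq_iff)

lemma mdeg_zero [simp]: "mdeg 0 = 0" by (simp add: mdeg_eq_0_iff)

definition part :: "'a set \<Rightarrow> ('a::comm_monoid_add \<Rightarrow>\<^sub>0 'k::comm_ring_1) \<Rightarrow> ('a \<Rightarrow>\<^sub>0 'k)" where
  "part S p = (\<Sum>m\<in>keys p \<inter> S. Poly_Mapping.single m (lookup p m))"

lemma lookup_part: "lookup (part S p) m = (if m \<in> S then lookup p m else 0)"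
proof -
  have "lookup (part S p) m = (\<Sum>x\<in>keys p \<inter> S. if x = m then lookup p m else 0)"
    unfolding part_def lookup_sum by (rule sum.cong) (auto simp: lookup_single when_def)
  then show ?thesis by (auto simp: in_keys_iff)
qed

lemma keys_part: "keys (part S p) = keys p \<inter> S"
  by (auto simp: in_keys_iff lookup_part split: if_splits)

lemma part_add: "part S (p + q) = part S p + part S q"
  by (rule poly_mapping_eqI) (simp add: lookup_part lookup_add)

lemma part_0 [simp]: "part S 0 = 0"
  by (rule poly_mapping_eqI) (simp add: lookup_part)

text \<open>
  In the lowest degree of \<open>p\<close> only the constant term of \<open>r\<close> contributes.
\<close>

lemma part_mult_equal_degree:
  fixes p r :: "('n::finite, 'k::field) mpoly"
  assumes "p \<in> mon_ideal U" "\<And>a. a \<in> U \<Longrightarrow> mdeg a = d"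
  shows "part U (r * p) = cscale (lookup r 0) (part U p)"
proof (rule poly_mapping_eqI)
  fix m
  show "lookup (part U (r * p)) m = lookup (cscale (lookup r 0) (part U p)) m"
  proof (cases "m \<in> U")
    case True
    \<comment> \<open>multiplication by \<open>r - r\<^sub>0\<close> raises the degree\<close>
    define r' where "r' = r - coeff_const (lookup r 0)"
    have "m \<notin> keys (r' * p)"
    proof
      assume "m \<in> keys (r' * p)"
      then obtain u v where uv: "m = u + v" "u \<in> keys r'" "v \<in> keys p" using keys_mult[of r' p] by blast
      obtain a b where "a \<in> U" "v = a + b" using assms(1) uv(3) by (auto simp: mon_ideal_def)
      then have "mdeg u = 0" using assms(2)[OF True] assms(2)[of a] uv(1) by (simp add: mdeg_add)
      then have "u = 0" by (simp add: mdeg_eq_0_iff)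
      then show False using uv(2) by (simp add: r'_def in_keys_iff lookup_minus)
    qed
    moreover have "r * p = r' * p + cscale (lookup r 0) p" by (simp add: r'_def cscale_def algebra_simps)
    ultimately show ?thesis using True by (simp add: lookup_part lookup_add lookup_cscale in_keys_iff)
  qed (simp add: lookup_part lookup_cscale)
qed

text \<open>
  Taking the coefficients at the generators \<open>U\<close> is a map from the ideal onto a vector space of dimension \<open>|U|\<close>.
  By the previous lemma it maps the ideal generated by any \<open>B\<close> into the span of the images of \<open>B\<close>. This covers
  inhomogeneous generating sets \<open>B\<close> as well.
\<close>

lemma min_num_gens_mon_ideal:
  fixes U :: "('n::finite) exps set"
  assumes "finite U" "\<And>a. a \<in> U \<Longrightarrow> mdeg a = d"
  shows "min_num_gens tring (mon_ideal U :: ('n, 'k::field) mpoly set) = card U"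
  unfolding min_num_gens_def
proof (rule Least_equality)
  show "\<exists>B. B \<subseteq> carrier tring \<and> finite B \<and> card B = card U \<and> Idl\<^bsub>tring\<^esub> B = (mon_ideal U :: ('n, 'k) mpoly set)"
    by (rule exI[of _ "xpow ` U"]) (use assms Idl_xpow card_image[OF inj_on_subset[OF inj_xpow]] in auto)
next
  fix n assume "\<exists>B. B \<subseteq> carrier tring \<and> finite B \<and> card B = n \<and> Idl\<^bsub>tring\<^esub> B = (mon_ideal U :: ('n, 'k) mpoly set)"
  then obtain B where B: "finite B" "card B = n" "Idl\<^bsub>tring\<^esub> B = (mon_ideal U :: ('n, 'k) mpoly set)" by blast
  \<comment> \<open>an ideal that contains \<open>B\<close> and hence all of \<open>mon_ideal U\<close>\<close>
  define J where "J = {p \<in> mon_ideal U. part U p \<in> poly.span (part U ` B)}"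
  have "ideal J tring"
    unfolding ideal_tring_iff
  proof (intro conjI ballI allI)
    show "0 \<in> J" using ideal_mon_ideal[of U, unfolded ideal_tring_iff] by (auto simp: J_def poly.span_zero)
    show "x + y \<in> J" if "x \<in> J" "y \<in> J" for x y
      using that ideal_mon_ideal[of U, unfolded ideal_tring_iff] by (auto simp: J_def part_add poly.span_add)
    show "r * x \<in> J" if "x \<in> J" for x r
      using that ideal_mon_ideal[of U, unfolded ideal_tring_iff] part_mult_equal_degree[OF _ assms(2), of x U r]
      by (auto simp: J_def poly.span_scale)
  qed
  moreover have "B \<subseteq> J" using genideal_superset[of B] B(3) by (auto simp: J_def poly.span_base)
  ultimately have "mon_ideal U \<subseteq> J" using genideal_subset B(3) by blast
  then have "xpow ` U \<subseteq> J" using xpow_in_mon_ideal[of _ U 0] by auto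
  then have "part U (xpow a) \<in> poly.span (part U ` B)" if "a \<in> U" for a using that by (auto simp: J_def)
  moreover have "part U (xpow a) = (xpow a :: _ \<Rightarrow>\<^sub>0 'k)" if "a \<in> U" for a
    by (rule poly_mapping_eqI) (use that in \<open>auto simp: lookup_part xpow_def lookup_single when_def\<close>)
  ultimately have "(xpow ` U :: ('n, 'k) mpoly set) \<subseteq> poly.span (part U ` B)"
    by (intro image_subsetI) simp
  from poly.independent_span_bound[OF finite_imageI[OF B(1)] independent_xpow this]
  have "card (xpow ` U :: ('n, 'k) mpoly set) \<le> card (part U ` B)" by (rule conjunct2)
  also have "\<dots> \<le> n" using card_image_le[OF B(1)] B(2) by blast
  finally show "card U \<le> n" unfolding card_image[OF inj_on_subset[OF inj_xpow subset_UNIV]] .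
qed

section \<open>Chains of prime ideals\<close>

lemma krull_dim_mono:
  assumes h: "ring_hom_ring R S h" and "cring R" and surj: "h ` carrier R = carrier S"
  shows "krull_dim S \<le> krull_dim R"
  unfolding krull_dim_def
proof (rule Sup_subset_mono, clarify)
  fix r P assume P: "\<forall>i\<le>r. primeideal (P i) S" "\<forall>i<r. P i \<subset> P (Suc i)"
  define Q where "Q i = {x \<in> carrier R. h x \<in> P i}" for i :: nat
  have "primeideal (Q i) R" if "i \<le> r" for i
    unfolding Q_def using ring_hom_ring.primeideal_vimage[OF h assms(2)] P(1) that by blast
  moreover have "Q i \<subset> Q (Suc i)" if ir: "i < r" for i
  proof -
    have "P (Suc i) \<subseteq> carrier S"
      using P(1) ir by (simp add: Suc_leI additive_subgroup.a_subset ideal.axioms(1) primeideal.axioms(1))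
    moreover obtain y where "y \<in> P (Suc i)" "y \<notin> P i" using P(2) ir by blast
    ultimately have "y \<in> h ` carrier R" "y \<in> P (Suc i)" "y \<notin> P i" using surj by auto
    then obtain x where "x \<in> carrier R" "h x \<in> P (Suc i)" "h x \<notin> P i" by blast
    then show ?thesis using P(2) ir unfolding Q_def by blast
  qed
  ultimately show "\<exists>r'. enat r = enat r' \<and>
    (\<exists>P. (\<forall>i\<le>r'. primeideal (P i) R) \<and> (\<forall>i<r'. P i \<subset> P (Suc i)))"
    by blast
qed

lemma krull_dim_iso:
  assumes h: "h \<in> ring_iso R S" and R: "cring R" and S: "cring S"
  shows "krull_dim R = krull_dim S"
proof (rule antisym)
  have hom: "ring_hom_ring R S h"
    using h R S by (intro ring_hom_ringI2) (auto simp: ring_iso_def cring.axioms(1))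
  show "krull_dim S \<le> krull_dim R"
    by (rule krull_dim_mono[OF hom R]) (use h in \<open>auto simp: ring_iso_def bij_betw_def\<close>)
  have g: "inv_into (carrier R) h \<in> ring_iso S R"
    by (rule ring_iso_set_sym[OF cring.axioms(1)[OF R] h])
  have "ring_hom_ring S R (inv_into (carrier R) h)"
    using g R S by (intro ring_hom_ringI2) (auto simp: ring_iso_def cring.axioms(1))
  then show "krull_dim R \<le> krull_dim S"
    by (rule krull_dim_mono[OF _ S]) (use g in \<open>auto simp: ring_iso_def bij_betw_def\<close>)
qed

definition subalg :: "('a::comm_monoid_add) set \<Rightarrow> ('a \<Rightarrow>\<^sub>0 'k::comm_ring_1) set" where
  "subalg M = {p. keys p \<subseteq> M}"

abbreviation alg_ring :: "('a::comm_monoid_add) set \<Rightarrow> ('a \<Rightarrow>\<^sub>0 'k::comm_ring_1) ring" where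
  "alg_ring M \<equiv> tring\<lparr>carrier := subalg M\<rparr>"

definition submonoid_add :: "('a::comm_monoid_add) set \<Rightarrow> bool" where
  "submonoid_add M \<longleftrightarrow> 0 \<in> M \<and> (\<forall>a\<in>M. \<forall>b\<in>M. a + b \<in> M)"

lemma subalg_mult: "submonoid_add M \<Longrightarrow> p \<in> subalg M \<Longrightarrow> q \<in> subalg M \<Longrightarrow> p * q \<in> subalg M"
  unfolding subalg_def submonoid_add_def using keys_mult[of p q] by blast

lemma subalg_add: "p \<in> subalg M \<Longrightarrow> q \<in> subalg M \<Longrightarrow> p + q \<in> subalg M"
  unfolding subalg_def using keys_add[of p q] by blast

lemma subalg_const: "submonoid_add M \<Longrightarrow> coeff_const c \<in> subalg M"
  by (auto simp: subalg_def submonoid_add_def)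

lemma subalg_0: "0 \<in> subalg M"
  by (auto simp: subalg_def)

lemma subalg_1: "submonoid_add M \<Longrightarrow> 1 \<in> subalg M"
  using subalg_const[of M 1] by simp

lemma subalg_sum: "(\<And>x. x \<in> A \<Longrightarrow> f x \<in> subalg M) \<Longrightarrow> sum f A \<in> subalg M"
  by (induction A rule: infinite_finite_induct) (auto simp: subalg_0 subalg_add)

lemma cring_alg_ring:
  assumes "submonoid_add M"
  shows "cring (alg_ring M :: ('a::comm_monoid_add \<Rightarrow>\<^sub>0 'k::comm_ring_1) ring)"
proof -
  interpret R: cring "tring :: ('a \<Rightarrow>\<^sub>0 'k) ring" by (rule cring_tring)
  have neg: "- p \<in> subalg M" if "p \<in> subalg M" for p :: "'a \<Rightarrow>\<^sub>0 'k"
    using that by (auto simp: subalg_def in_keys_iff)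
  have "subring (subalg M) (tring :: ('a \<Rightarrow>\<^sub>0 'k) ring)"
    by (rule R.subringI)
      (use assms neg in \<open>auto simp: subalg_1 subalg_mult subalg_add tring_a_inv\<close>)
  then show ?thesis
    using R.subcringI' R.subcring_iff[of "subalg M"] by simp
qed

text \<open>
  Prime ideals of a subring \<open>A\<close> of a type in terms of the operations of the type, which spares the record
  operations in the computations below.
\<close>

definition prime_in :: "'a::comm_ring_1 set \<Rightarrow> 'a set \<Rightarrow> bool" where
  "prime_in A P \<longleftrightarrow> P \<subseteq> A \<and> 0 \<in> P \<and> (\<forall>x\<in>P. \<forall>y\<in>P. x + y \<in> P) \<and> (\<forall>x\<in>P. \<forall>r\<in>A. r * x \<in> P) \<and>
     1 \<notin> P \<and> (\<forall>x\<in>A. \<forall>y\<in>A. x * y \<in> P \<longrightarrow> x \<in> P \<or> y \<in> P)"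

lemma prime_inD:
  assumes "prime_in A P"
  shows "P \<subseteq> A" "1 \<notin> P" "x \<in> P \<Longrightarrow> y \<in> P \<Longrightarrow> x + y \<in> P" "x \<in> P \<Longrightarrow> r \<in> A \<Longrightarrow> r * x \<in> P"
    "x \<in> A \<Longrightarrow> y \<in> A \<Longrightarrow> x * y \<in> P \<Longrightarrow> x \<in> P \<or> y \<in> P"
  using assms unfolding prime_in_def by auto

lemma primeideal_imp_prime_in:
  assumes P: "primeideal P (tring\<lparr>carrier := A\<rparr> :: 'a::comm_ring_1 ring)"
  shows "prime_in A P"
proof -
  note I = primeideal.axioms(1)[OF P]
  have "P \<subseteq> A" using additive_subgroup.a_subset[OF ideal.axioms(1)[OF I]] by simp
  moreover have "0 \<in> P" using additive_subgroup.zero_closed[OF ideal.axioms(1)[OF I]] by simp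
  moreover have "x + y \<in> P" if "x \<in> P" "y \<in> P" for x y
    using additive_subgroup.a_closed[OF ideal.axioms(1)[OF I] that] by simp
  moreover have "r * x \<in> P" if "x \<in> P" "r \<in> A" for x r
    using ideal.I_l_closed[OF I that(1), of r] that(2) by simp
  moreover have "1 \<notin> P"
  proof
    assume "1 \<in> P"
    then have "A \<subseteq> P" using calculation(4) by fastforce
    then show False using primeideal.I_notcarr[OF P] \<open>P \<subseteq> A\<close> by simp
  qed
  moreover have "x \<in> P \<or> y \<in> P" if "x \<in> A" "y \<in> A" "x * y \<in> P" for x y
    using primeideal.I_prime[OF P, of x y] that by simp
  ultimately show ?thesis unfolding prime_in_def by blast
qed

lemma prime_in_imp_primeideal:
  assumes P: "prime_in A P" and A: "cring (tring\<lparr>carrier := A\<rparr> :: 'a::comm_ring_1 ring)"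
    and neg: "- 1 \<in> A" and one: "1 \<in> A"
  shows "primeideal P (tring\<lparr>carrier := A\<rparr>)"
proof (rule primeidealI[OF _ A])
  interpret A: cring "tring\<lparr>carrier := A\<rparr> :: 'a ring" by (rule A)
  have ex: "\<exists>y\<in>P. y + x = 0" if "x \<in> P" for x
  proof (rule bexI)
    show "-1 * x \<in> P" using that neg P unfolding prime_in_def by blast
    show "-1 * x + x = 0" by simp
  qed
  have inv: "inv\<^bsub>add_monoid (tring\<lparr>carrier := A\<rparr>)\<^esub> x \<in> P" if x: "x \<in> P" for x
  proof -
    obtain y where y: "y \<in> P" "y + x = 0" using ex[OF x] by blast
    have "y \<in> A" "x \<in> A" using y x P by (auto simp: prime_in_def)
    then have "\<ominus>\<^bsub>tring\<lparr>carrier := A\<rparr>\<^esub> x = y" using A.minus_equality[of y x] y by simp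
    then show ?thesis using y by (simp add: a_inv_def)
  qed
  show "ideal P (tring\<lparr>carrier := A\<rparr>)"
  proof (rule idealI[OF A.ring_axioms])
    show "subgroup P (add_monoid (tring\<lparr>carrier := A\<rparr>))"
      using P inv by (auto intro!: subgroup.intro simp: prime_in_def)
  qed (use P in \<open>auto simp: prime_in_def mult.commute\<close>)
  show "carrier (tring\<lparr>carrier := A\<rparr>) \<noteq> P" using P one by (auto simp: prime_in_def)
qed (use P in \<open>auto simp: prime_in_def\<close>)

text \<open>
  The product of the powers \<open>x\<^sub>i\<^bsup>e\<^sub>i\<^esup>\<close>.
\<close>

fun mpow :: "'a::comm_ring_1 list \<Rightarrow> nat list \<Rightarrow> 'a" where
  "mpow (x # xs) (e # es) = x ^ e * mpow xs es"
| "mpow _ _ = 1"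

definition subring_type :: "'a::comm_ring_1 set \<Rightarrow> bool" where
  "subring_type A \<longleftrightarrow> 0 \<in> A \<and> 1 \<in> A \<and> -1 \<in> A \<and> (\<forall>x\<in>A. \<forall>y\<in>A. x + y \<in> A) \<and> (\<forall>x\<in>A. \<forall>y\<in>A. x * y \<in> A)"

lemma subring_type_power: "subring_type A \<Longrightarrow> x \<in> A \<Longrightarrow> x ^ n \<in> A"
  by (induction n) (auto simp: subring_type_def)

lemma subring_type_sum: "subring_type A \<Longrightarrow> (\<And>x. x \<in> S \<Longrightarrow> f x \<in> A) \<Longrightarrow> sum f S \<in> A"
  by (induction S rule: infinite_finite_induct) (auto simp: subring_type_def)

lemma mpow_in: "subring_type A \<Longrightarrow> set xs \<subseteq> A \<Longrightarrow> mpow xs es \<in> A"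
  by (induction xs es rule: mpow.induct) (auto simp: subring_type_power, auto simp: subring_type_def subring_type_power)

lemma prime_in_sum:
  assumes "prime_in A P" "\<And>x. x \<in> S \<Longrightarrow> f x \<in> P"
  shows "sum f S \<in> P"
  using assms by (induction S rule: infinite_finite_induct) (auto simp: prime_in_def)

lemma prime_in_power:
  assumes "subring_type A" "prime_in A P" "x \<in> A" "x ^ n \<in> P"
  shows "x \<in> P"
  using assms(4)
proof (induction n)
  case 0
  then show ?case using assms(2) by (auto simp: prime_in_def)
next
  case (Suc n)
  then show ?case
    using prime_inD(5)[OF assms(2,3) subring_type_power[OF assms(1,3), of n]] by auto
qed

text \<open>
  If the combination were in \<open>P\<^sub>0\<close>, cancel the largest possible power of \<open>x\<^sub>0 \<notin> P\<^sub>0\<close> from all terms and then drop the terms still divisible by \<open>x\<^sub>0 \<in> P\<^sub>1\<close>: this leaves a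
  combination of power products of the remaining elements in \<open>P\<^sub>1\<close>. At the end a coefficient would lie in
  the last prime.
\<close>

lemma no_relation_along_chain:
  fixes xs :: "'a::comm_ring_1 list"
  assumes A: "subring_type A"
    and "\<forall>i\<le>length xs. prime_in A (P i)"
    and "\<forall>i<length xs. P i \<subseteq> P (Suc i) \<and> xs ! i \<in> P (Suc i) \<and> xs ! i \<notin> P i"
    and "finite S" "S \<noteq> {}" "\<forall>es\<in>S. length es = length xs"
    and "\<forall>es\<in>S. c es \<in> A \<and> c es \<notin> P (length xs)"
  shows "(\<Sum>es\<in>S. c es * mpow xs es) \<notin> P 0"
  using assms(2-)
proof (induction xs arbitrary: P S c)
  case Nil
  then have "S = {[]}" by auto
  then show ?case using Nil by simp
next
  case (Cons x xs)
  define m where "m = Min (hd ` S)"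
  \<comment> \<open>the terms that are not divisible by a higher power of \<open>x\<close>\<close>
  define S0 where "S0 = {es \<in> S. hd es = m}"
  have m: "m \<le> hd es" if "es \<in> S" for es using that Cons.prems(3) by (simp add: m_def)
  have "m \<in> hd ` S" unfolding m_def using Cons.prems(3,4) by (intro Min_in) auto
  then have S0: "S0 \<noteq> {}" "finite S0" using Cons.prems(3) by (auto simp: S0_def)
  have shape: "es = hd es # tl es \<and> length (tl es) = length xs" if "es \<in> S" for es
    using Cons.prems(5) that by (cases es) auto
  have P0: "prime_in A (P 0)" and P1: "prime_in A (P 1)" using Cons.prems(1) by auto
  have x: "x \<in> P 1" "x \<notin> P 0" "P 0 \<subseteq> P 1" using Cons.prems(2) by auto
  have xA: "x \<in> A" using x P1 by (auto simp: prime_in_def)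
  have xsA: "set xs \<subseteq> A"
  proof
    fix y assume "y \<in> set xs"
    then obtain i where i: "i < length xs" "y = xs ! i" by (auto simp: in_set_conv_nth)
    then have "y \<in> P (Suc (Suc i))" using Cons.prems(2)[rule_format, of "Suc i"] by simp
    moreover have "prime_in A (P (Suc (Suc i)))" using Cons.prems(1) i by simp
    ultimately show "y \<in> A" by (auto simp: prime_in_def)
  qed
  have mp: "c es * mpow (x # xs) es = x ^ m * (c es * x ^ (hd es - m) * mpow xs (tl es))" if "es \<in> S" for es
  proof -
    have "mpow (x # xs) es = x ^ hd es * mpow xs (tl es)" using shape[OF that] mpow.simps(1)[of x xs "hd es" "tl es"] by simp
    also have "x ^ hd es = x ^ m * x ^ (hd es - m)" using m[OF that] by (simp flip: power_add)
    finally show ?thesis by (simp add: algebra_simps)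
  qed
  define t where "t es = c es * x ^ (hd es - m) * mpow xs (tl es)" for es
  have tA: "t es \<in> A" if "es \<in> S" for es
    using A Cons.prems(6) that mpow_in[OF A xsA] subring_type_power[OF A xA] unfolding t_def subring_type_def by blast
  show ?case
  proof
    assume "(\<Sum>es\<in>S. c es * mpow (x # xs) es) \<in> P 0"
    moreover have "(\<Sum>es\<in>S. c es * mpow (x # xs) es) = x ^ m * (\<Sum>es\<in>S. t es)"
      using mp by (simp add: t_def sum_distrib_left)
    ultimately have "x ^ m * (\<Sum>es\<in>S. t es) \<in> P 0" by simp
    moreover have "(\<Sum>es\<in>S. t es) \<in> A" by (rule subring_type_sum[OF A tA])
    moreover have "x ^ m \<notin> P 0" using prime_in_power[OF A P0 xA, of m] x(2) by blast
    ultimately have "(\<Sum>es\<in>S. t es) \<in> P 1"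
      using prime_inD(5)[OF P0 subring_type_power[OF A xA]] x(3) by blast
    moreover have "(\<Sum>es\<in>S - S0. t es) \<in> P 1"
    proof (rule prime_in_sum[OF P1])
      fix es assume es: "es \<in> S - S0"
      then have "m < hd es" using m by (fastforce simp: S0_def)
      then have "hd es - m = Suc (hd es - m - 1)" by linarith
      then obtain k where k: "hd es - m = Suc k" ..
      have "t es = (c es * x ^ k * mpow xs (tl es)) * x" by (simp add: t_def k algebra_simps)
      moreover have "c es * x ^ k * mpow xs (tl es) \<in> A"
        using A Cons.prems(6) es mpow_in[OF A xsA] subring_type_power[OF A xA] unfolding subring_type_def by blast
      ultimately show "t es \<in> P 1" using prime_inD(4)[OF P1 x(1)] by simp
    qed
    then have "-1 * (\<Sum>es\<in>S - S0. t es) \<in> P 1"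
      using prime_inD(4)[OF P1] A unfolding subring_type_def by blast
    ultimately have "(\<Sum>es\<in>S. t es) + -1 * (\<Sum>es\<in>S - S0. t es) \<in> P 1"
      by (rule prime_inD(3)[OF P1])
    moreover have "(\<Sum>es\<in>S. t es) = (\<Sum>es\<in>S - S0. t es) + (\<Sum>es\<in>S0. t es)"
      using Cons.prems(3) by (intro sum.subset_diff) (auto simp: S0_def)
    ultimately have "(\<Sum>es\<in>S0. t es) \<in> P 1" by simp
    moreover have "(\<Sum>es\<in>S0. t es) = (\<Sum>fs\<in>tl ` S0. c (m # fs) * mpow xs fs)"
    proof (subst sum.reindex)
      show "inj_on tl S0" unfolding inj_on_def S0_def using shape by (metis (mono_tags, lifting) mem_Collect_eq)
      show "(\<Sum>es\<in>S0. t es) = sum ((\<lambda>fs. c (m # fs) * mpow xs fs) \<circ> tl) S0"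
        by (rule sum.cong) (use shape in \<open>auto simp: S0_def t_def\<close>)
    qed
    moreover have "(\<Sum>fs\<in>tl ` S0. c (m # fs) * mpow xs fs) \<notin> (\<lambda>i. P (Suc i)) 0"
    proof (rule Cons.IH)
      show "\<forall>es\<in>tl ` S0. c (m # es) \<in> A \<and> c (m # es) \<notin> P (Suc (length xs))"
        using Cons.prems(6) shape by (force simp: S0_def)
    qed (use Cons.prems S0 shape in \<open>auto simp: S0_def\<close>)
    ultimately show False by simp
  qed
qed

section \<open>The Krull dimension of a monoid algebra\<close>

text \<open>
  For the monoids below, a minimal separating set has as many elements as the rank of the monoid. Working
  with such a set keeps linear algebra out of the computation of the Krull dimension.
\<close>

definition separates :: "'n set \<Rightarrow> 'n exps set \<Rightarrow> bool" where
  "separates T M \<longleftrightarrow> (\<forall>m\<in>M. \<forall>m'\<in>M. (\<forall>i\<in>T. lookup m i = lookup m' i) \<longrightarrow> m = m')"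

definition bounded_by :: "nat \<Rightarrow> 'n exps set" where
  "bounded_by b = {m. \<forall>i. lookup m i \<le> b}"

lemma card_bounded_by:
  fixes M :: "('n::finite) exps set"
  assumes "separates T M"
  shows "finite (M \<inter> bounded_by b)" "card (M \<inter> bounded_by b) \<le> Suc b ^ card T"
proof -
  define f :: "'n exps \<Rightarrow> ('n \<Rightarrow> nat)" where "f m = restrict (lookup m) T" for m
  have inj: "inj_on f (M \<inter> bounded_by b)"
  proof (rule inj_onI)
    fix m m' assume m: "m \<in> M \<inter> bounded_by b" "m' \<in> M \<inter> bounded_by b" "f m = f m'"
    have "lookup m i = lookup m' i" if "i \<in> T" for i
      using fun_cong[OF m(3), of i] that by (simp add: f_def)
    then show "m = m'" using assms m by (auto simp: separates_def)
  qed
  have sub: "f ` (M \<inter> bounded_by b) \<subseteq> T \<rightarrow>\<^sub>E {..b}"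
    by (auto simp: f_def bounded_by_def)
  have fin: "finite (T \<rightarrow>\<^sub>E {..b})" by (intro finite_PiE) auto
  show "finite (M \<inter> bounded_by b)"
    by (rule finite_imageD[OF finite_subset[OF sub fin] inj])
  have "card (M \<inter> bounded_by b) = card (f ` (M \<inter> bounded_by b))" by (simp add: card_image[OF inj])
  also have "\<dots> \<le> card (T \<rightarrow>\<^sub>E {..b})" by (rule card_mono[OF fin sub])
  also have "\<dots> = Suc b ^ card T" by (simp add: card_PiE)
  finally show "card (M \<inter> bounded_by b) \<le> Suc b ^ card T" .
qed

lemma keys_power_bounded:
  fixes p :: "('n, 'k::comm_ring_1) mpoly"
  assumes "keys p \<subseteq> bounded_by b"
  shows "keys (p ^ n) \<subseteq> bounded_by (n * b)"
proof (induction n)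
  case 0
  then show ?case by (auto simp: bounded_by_def)
next
  case (Suc n)
  show ?case
  proof
    fix m assume "m \<in> keys (p ^ Suc n)"
    then obtain u v where "m = u + v" "u \<in> keys p" "v \<in> keys (p ^ n)"
      using keys_mult[of p "p ^ n"] by auto
    then have "\<forall>i. lookup u i \<le> b" "\<forall>i. lookup v i \<le> n * b" "m = u + v"
      using Suc assms by (auto simp: bounded_by_def)
    then show "m \<in> bounded_by (Suc n * b)"
      by (auto simp: bounded_by_def lookup_add add_mono)
  qed
qed

lemma keys_mpow_bounded:
  fixes xs :: "('n, 'k::comm_ring_1) mpoly list"
  assumes "\<forall>x\<in>set xs. keys x \<subseteq> bounded_by b" "set es \<subseteq> {..N}"
  shows "keys (mpow xs es) \<subseteq> bounded_by (length xs * (N * b))"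
  using assms
proof (induction xs es rule: mpow.induct)
  case (1 x xs e es)
  show ?case
  proof
    fix m assume "m \<in> keys (mpow (x # xs) (e # es))"
    then obtain u v where uv: "m = u + v" "u \<in> keys (x ^ e)" "v \<in> keys (mpow xs es)"
      using keys_mult[of "x ^ e" "mpow xs es"] by auto
    have "\<forall>i. lookup u i \<le> e * b" using keys_power_bounded[of x b e] 1 uv by (auto simp: bounded_by_def)
    moreover have "e * b \<le> N * b" using 1 by simp
    moreover have "\<forall>i. lookup v i \<le> length xs * (N * b)" using 1 uv by (auto simp: bounded_by_def)
    ultimately have "lookup u i + lookup v i \<le> N * b + length xs * (N * b)" for i
      by (meson add_mono le_trans)
    then show "m \<in> bounded_by (length (x # xs) * (N * b))"
      using uv by (auto simp: bounded_by_def lookup_add)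
  qed
qed (auto simp: bounded_by_def)

lemma subring_type_subalg:
  "submonoid_add M \<Longrightarrow> subring_type (subalg M :: ('a::comm_monoid_add \<Rightarrow>\<^sub>0 'k::comm_ring_1) set)"
  using subalg_const[of M "-1"] by (auto simp: subring_type_def subalg_0 subalg_1 subalg_add subalg_mult single_uminus)

text \<open>
  The power products of \<open>d > |T|\<close> elements with exponents up to \<open>N\<close> number \<open>(N + 1)\<^sup>d\<close>, while they involve only
  monomials from \<open>M\<close> with exponents bounded by a multiple of \<open>N\<close>, of which there are \<open>O(N\<^bsup>|T|\<^esup>)\<close>.
\<close>

lemma algebraic_relation:
  fixes xs :: "('n::finite, 'k::field) mpoly list"
  assumes M: "submonoid_add M" "separates T M" and xs: "set xs \<subseteq> subalg M" "card T < length xs"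
  obtains S c where "finite S" "S \<noteq> {}" "\<forall>es\<in>S. length es = length xs" "\<forall>es\<in>S. c es \<noteq> 0"
    "(\<Sum>es\<in>S. coeff_const (c es) * mpow xs es) = 0"
proof -
  let ?l = "card T" and ?d = "length xs"
  have "finite (\<Union>x\<in>set xs. keys x)" by simp
  then have fin: "finite ((\<lambda>(m, i). lookup m i) ` ((\<Union>x\<in>set xs. keys x) \<times> UNIV))" by simp
  obtain b where b0: "\<forall>n\<in>(\<lambda>(m, i). lookup m i) ` ((\<Union>x\<in>set xs. keys x) \<times> UNIV). n \<le> b"
    using finite_nat_set_iff_bounded_le[THEN iffD1, OF fin] by blast
  have b: "lookup m i \<le> b" if "m \<in> (\<Union>x\<in>set xs. keys x)" for m i
    using b0[rule_format, OF image_eqI[of _ _ "(m, i)"]] that by simp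
  \<comment> \<open>\<open>C (N + 1)\<close> bounds the exponents, so \<open>(C (N + 1))\<^sup>l < (N + 1)\<^bsup>l + 1\<^esup>\<close> as soon as \<open>N \<ge> C\<^sup>l\<close>\<close>
  define C where "C = Suc (?d * b)"
  define N where "N = C ^ ?l"
  define I where "I = {es. set es \<subseteq> {..N} \<and> length es = ?d}"
  define U where "U = M \<inter> bounded_by (?d * (N * b))"
  have "card I = Suc N ^ ?d" unfolding I_def by (subst card_lists_length_eq) auto
  have I: "finite I" unfolding I_def by (rule finite_lists_length_eq) simp
  have "Suc (?d * (N * b)) \<le> C * Suc N" by (simp add: C_def algebra_simps)
  then have "Suc (?d * (N * b)) ^ ?l \<le> (C * Suc N) ^ ?l" by (rule power_mono) simp
  also have "\<dots> = N * Suc N ^ ?l" unfolding power_mult_distrib by (simp add: N_def)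
  also have "\<dots> < Suc N * Suc N ^ ?l" by simp
  also have "\<dots> = Suc N ^ Suc ?l" by simp
  also have "\<dots> \<le> Suc N ^ ?d" using xs(2) by (intro power_increasing) auto
  finally have less: "Suc (?d * (N * b)) ^ ?l < card I" using \<open>card I = Suc N ^ ?d\<close> by simp
  have U: "finite U" "card U < card I"
    using card_bounded_by[OF M(2), of "?d * (N * b)"] less by (auto simp: U_def)
  have keys: "keys (mpow xs es) \<subseteq> U" if "es \<in> I" for es
  proof -
    have "mpow xs es \<in> subalg M" by (rule mpow_in[OF subring_type_subalg[OF M(1)] xs(1)])
    moreover have "keys (mpow xs es) \<subseteq> bounded_by (?d * (N * b))"
      by (rule keys_mpow_bounded) (use b that in \<open>auto simp: bounded_by_def I_def\<close>)
    ultimately show ?thesis by (auto simp: U_def subalg_def)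
  qed
  obtain c where c: "\<exists>es\<in>I. c es \<noteq> 0" "(\<Sum>es\<in>I. cscale (c es) (mpow xs es)) = 0"
    by (rule linear_relation[OF I U(1) keys U(2)])
  define S where "S = {es \<in> I. c es \<noteq> 0}"
  have "(\<Sum>es\<in>S. coeff_const (c es) * mpow xs es) = (\<Sum>es\<in>I. coeff_const (c es) * mpow xs es)"
    by (rule sum.mono_neutral_left) (use I in \<open>auto simp: S_def\<close>)
  also have "\<dots> = 0" using c(2) by (simp add: cscale_def)
  finally have "(\<Sum>es\<in>S. coeff_const (c es) * mpow xs es) = 0" .
  moreover have "finite S" by (rule finite_subset[OF _ I]) (auto simp: S_def)
  moreover have "S \<noteq> {}" "\<forall>es\<in>S. length es = length xs" "\<forall>es\<in>S. c es \<noteq> 0"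
    using c(1) by (auto simp: S_def I_def)
  ultimately show ?thesis by (rule that[rotated -1])
qed

lemma krull_dim_alg_ring_le:
  assumes M: "submonoid_add M" "separates T M"
  shows "krull_dim (alg_ring M :: ('n::finite, 'k::field) mpoly ring) \<le> enat (card T)"
  unfolding krull_dim_def
proof (rule Sup_least, clarify)
  fix r and P :: "nat \<Rightarrow> ('n, 'k) mpoly set"
  assume P: "\<forall>i\<le>r. primeideal (P i) (alg_ring M)" "\<forall>i<r. P i \<subset> P (Suc i)"
  show "enat r \<le> enat (card T)"
  proof (rule ccontr)
    assume "\<not> enat r \<le> enat (card T)"
    then have r: "card T < r" by simp
    have "\<exists>x. x \<in> P (Suc i) \<and> x \<notin> P i" if "i < r" for i using P(2) that by blast
    then obtain x where x: "\<And>i. i < r \<Longrightarrow> x i \<in> P (Suc i) \<and> x i \<notin> P i" by metis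
    have prime: "prime_in (subalg M) (P i)" if "i \<le> r" for i
      using primeideal_imp_prime_in P(1) that by blast
    define xs where "xs = map x [0..<r]"
    have xsM: "set xs \<subseteq> subalg M"
    proof
      fix y assume "y \<in> set xs"
      then obtain i where i: "i < r" "y = x i" by (auto simp: xs_def)
      then show "y \<in> subalg M" using x[OF i(1)] prime_inD(1)[OF prime[of "Suc i"]] by auto
    qed
    obtain S c where S: "finite S" "S \<noteq> {}" "\<forall>es\<in>S. length es = length xs" "\<forall>es\<in>S. c es \<noteq> (0::'k)"
      "(\<Sum>es\<in>S. coeff_const (c es) * mpow xs es) = 0"
      by (rule algebraic_relation[OF M xsM]) (use r in \<open>auto simp: xs_def\<close>)
    have "coeff_const (c es) \<in> subalg M \<and> coeff_const (c es) \<notin> P (length xs)" if "es \<in> S" for es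
    proof
      show "coeff_const (c es) \<in> subalg M" by (rule subalg_const[OF M(1)])
      show "coeff_const (c es) \<notin> P (length xs)"
      proof
        assume "coeff_const (c es) \<in> P (length xs)"
        moreover have pr: "prime_in (subalg M) (P (length xs))" by (rule prime) (simp add: xs_def)
        ultimately have "coeff_const (inverse (c es)) * coeff_const (c es) \<in> P (length xs)"
          using prime_inD(4) subalg_const[OF M(1)] by blast
        then have "1 \<in> P (length xs)" using S(4) that by (simp add: mult_single)
        then show False using prime_inD(2)[OF pr] by blast
      qed
    qed
    moreover have "\<forall>i\<le>length xs. prime_in (subalg M) (P i)" using prime by (simp add: xs_def)
    moreover have "\<forall>i<length xs. P i \<subseteq> P (Suc i) \<and> xs ! i \<in> P (Suc i) \<and> xs ! i \<notin> P i"
      using x P(2) by (auto simp: xs_def)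
    ultimately have "(\<Sum>es\<in>S. coeff_const (c es) * mpow xs es) \<notin> P 0"
      by (intro no_relation_along_chain[OF subring_type_subalg[OF M(1)] _ _ S(1-3)]) auto
    then show False using S(5) prime[of 0] by (auto simp: prime_in_def)
  qed
qed

text \<open>
  The linear extension of a map between exponents; for additive maps it is a ring homomorphism.
\<close>

definition push :: "('a \<Rightarrow> 'b) \<Rightarrow> ('a \<Rightarrow>\<^sub>0 'k::comm_ring_1) \<Rightarrow> ('b \<Rightarrow>\<^sub>0 'k)" where
  "push g p = (\<Sum>m\<in>keys p. Poly_Mapping.single (g m) (lookup p m))"

lemma push_superset:
  assumes "finite S" "keys p \<subseteq> S"
  shows "push g p = (\<Sum>m\<in>S. Poly_Mapping.single (g m) (lookup p m))"
  unfolding push_def by (rule sum.mono_neutral_left) (use assms in \<open>auto simp: in_keys_iff\<close>)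

lemma push_0 [simp]: "push g 0 = 0"
  by (simp add: push_def)

lemma push_add: "push g (p + q) = push g p + push g q"
proof -
  let ?S = "keys p \<union> keys q"
  have "push g (p + q) = (\<Sum>m\<in>?S. Poly_Mapping.single (g m) (lookup (p + q) m))"
    by (rule push_superset) (use keys_add[of p q] in auto)
  also have "\<dots> = push g p + push g q"
    using push_superset[of ?S p g] push_superset[of ?S q g]
    by (simp add: lookup_add single_add sum.distrib)
  finally show ?thesis .
qed

lemma push_single [simp]: "push g (Poly_Mapping.single m c) = Poly_Mapping.single (g m) c"
  using push_superset[of "{m}" "Poly_Mapping.single m c" g] by simp

lemma push_sum: "push g (sum f A) = (\<Sum>x\<in>A. push g (f x))"
  by (induction A rule: infinite_finite_induct) (auto simp: push_add)

lemma sum_single: "(\<Sum>m\<in>keys p. Poly_Mapping.single m (lookup p m)) = (p :: 'a::comm_monoid_add \<Rightarrow>\<^sub>0 'k::comm_ring_1)"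
  using poly_expand[of "keys p" p] by (simp add: xpow_def mult_single)

lemma push_mult:
  fixes p q :: "'a::comm_monoid_add \<Rightarrow>\<^sub>0 'k::comm_ring_1" and g :: "'a \<Rightarrow> 'b::comm_monoid_add"
  assumes g: "\<And>a b. g (a + b) = g a + g b"
  shows "push g (p * q) = push g p * push g q"
proof -
  have "p * q = (\<Sum>a\<in>keys p. \<Sum>b\<in>keys q. Poly_Mapping.single (a + b) (lookup p a * lookup q b))"
    by (subst sum_single[of p, symmetric], subst sum_single[of q, symmetric])
      (simp add: sum_product mult_single)
  then have "push g (p * q) = (\<Sum>a\<in>keys p. \<Sum>b\<in>keys q. Poly_Mapping.single (g a) (lookup p a) * Poly_Mapping.single (g b) (lookup q b))"
    by (simp add: push_sum g mult_single)
  then show ?thesis by (simp add: push_def sum_product)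
qed

lemma push_comp: "push (g \<circ> f) p = push g (push f p)"
  unfolding push_def[of f] push_sum push_single by (simp add: push_def)

text \<open>
  The exponents \<open>nat \<Rightarrow>\<^sub>0 nat\<close> in the target are linearly ordered, which makes it an integral domain.
\<close>

lemma push_kernel_prime_in:
  fixes g :: "'a::comm_monoid_add \<Rightarrow> nat \<Rightarrow>\<^sub>0 nat"
  assumes "submonoid_add M" "\<And>a b. g (a + b) = g a + g b" "g 0 = 0"
  shows "prime_in (subalg M) {p \<in> subalg M. push g p = (0 :: (nat \<Rightarrow>\<^sub>0 nat) \<Rightarrow>\<^sub>0 'k::field)}"
proof -
  have "push g 1 = (1 :: (nat \<Rightarrow>\<^sub>0 nat) \<Rightarrow>\<^sub>0 'k)"
    using push_single[of g 0 "1::'k"] assms(3) by simp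
  then show ?thesis
    unfolding prime_in_def
    by (auto simp: subalg_0 subalg_add subalg_mult[OF assms(1)] push_add push_mult[of g, OF assms(2)])
qed

text \<open>
  The substitution that keeps the variables \<open>t 0, \<dots>, t (j - 1)\<close> and puts all others equal to \<open>1\<close>.
\<close>

definition coords :: "(nat \<Rightarrow> 'n) \<Rightarrow> nat \<Rightarrow> 'n exps \<Rightarrow> (nat \<Rightarrow>\<^sub>0 nat)" where
  "coords t j m = (\<Sum>i<j. Poly_Mapping.single i (lookup m (t i)))"

lemma lookup_coords: "lookup (coords t j m) i = (if i < j then lookup m (t i) else 0)"
proof -
  have "lookup (coords t j m) i = (\<Sum>k<j. if k = i then lookup m (t i) else 0)"
    unfolding coords_def lookup_sum by (rule sum.cong) (auto simp: lookup_single when_def)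
  then show ?thesis by simp
qed

text \<open>
  Keeping \<open>|T| - j\<close> variables gives a prime \<open>P\<^sub>j\<close>. By minimality there are distinct \<open>m, m' \<in> M\<close> which agree on \<open>T\<close>
  except for the next variable to be dropped, and \<open>x\<^sup>m - x\<^bsup>m'\<^esup>\<close> shows that \<open>P\<^sub>j\<^sub>+\<^sub>1\<close> is strictly larger than \<open>P\<^sub>j\<close>.
\<close>

lemma krull_dim_alg_ring_ge:
  assumes M: "submonoid_add M" "separates T M" and min: "\<And>t. t \<in> T \<Longrightarrow> \<not> separates (T - {t}) M"
  shows "krull_dim (alg_ring M :: ('n::finite, 'k::field) mpoly ring) \<ge> enat (card T)"
proof -
  obtain t where t: "bij_betw t {0..<card T} T" using ex_bij_betw_nat_finite[of T] by auto
  define g where "g j = coords t (card T - j)" for j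
  define P where "P j = {p \<in> subalg M. push (g j) p = (0 :: (nat \<Rightarrow>\<^sub>0 nat) \<Rightarrow>\<^sub>0 'k)}" for j
  have add: "g j (a + b) = g j a + g j b" "g j 0 = 0" for j a b
    by (auto intro!: poly_mapping_eqI simp: g_def lookup_coords lookup_add)
  have prime: "primeideal (P j) (alg_ring M)" for j
  proof (rule prime_in_imp_primeideal)
    show "prime_in (subalg M) (P j)"
      unfolding P_def by (rule push_kernel_prime_in[OF M(1) add])
    show "cring (alg_ring M :: ('n, 'k) mpoly ring)" by (rule cring_alg_ring[OF M(1)])
  qed (use subring_type_subalg[OF M(1)] in \<open>auto simp: subring_type_def\<close>)
  have strict: "P j \<subset> P (Suc j)" if j: "j < card T" for j
  proof
    have "g (Suc j) = coords id (card T - Suc j) \<circ> g j"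
      by (rule ext, rule poly_mapping_eqI) (auto simp: g_def lookup_coords)
    then have "push (g (Suc j)) p = push (coords id (card T - Suc j)) (push (g j) p)" for p :: "_ \<Rightarrow>\<^sub>0 'k"
      by (simp add: push_comp)
    then show "P j \<subseteq> P (Suc j)" by (auto simp: P_def)
    define k where "k = card T - Suc j"
    have k: "k < card T" "card T - j = Suc k" using j by (auto simp: k_def)
    then have "t k \<in> T" using t by (auto simp: bij_betw_def)
    then obtain m m' where m: "m \<in> M" "m' \<in> M" "m \<noteq> m'" "\<forall>i\<in>T - {t k}. lookup m i = lookup m' i"
      using min[of "t k"] unfolding separates_def by blast
    have ne: "lookup m (t k) \<noteq> lookup m' (t k)"
    proof
      assume "lookup m (t k) = lookup m' (t k)"
      then have "\<forall>i\<in>T. lookup m i = lookup m' i" using m(4) by (metis DiffI singletonD)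
      then show False using M(2) m unfolding separates_def by blast
    qed
    define p :: "('n, 'k) mpoly" where "p = xpow m + Poly_Mapping.single m' (-1)"
    have pM: "p \<in> subalg M" unfolding p_def
      by (rule subalg_add) (use m in \<open>auto simp: subalg_def xpow_def\<close>)
    have pg: "push h p = Poly_Mapping.single (h m) 1 - Poly_Mapping.single (h m') 1" for h :: "_ \<Rightarrow> (nat \<Rightarrow>\<^sub>0 nat)"
      unfolding p_def push_add xpow_def push_single by (simp add: single_uminus)
    have "t i \<in> T - {t k}" if "i < k" for i
      using t that k unfolding bij_betw_def inj_on_def by fastforce
    then have "g (Suc j) m = g (Suc j) m'"
      using m(4) by (intro poly_mapping_eqI) (auto simp: g_def lookup_coords k_def)
    then have "p \<in> P (Suc j)" using pM by (simp add: P_def pg)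
    moreover have "lookup (g j m) k \<noteq> lookup (g j m') k" using ne k by (simp add: g_def lookup_coords)
    then have "g j m \<noteq> g j m'" by auto
    then have "push (g j) p \<noteq> 0" unfolding pg by (simp add: inj_eq[OF inj_xpow[unfolded xpow_def]])
    then have "p \<notin> P j" by (simp add: P_def)
    ultimately show "P j \<noteq> P (Suc j)" by blast
  qed
  show ?thesis
    unfolding krull_dim_def
    by (rule Sup_upper) (use prime strict in blast)
qed

theorem krull_dim_alg_ring:
  assumes "submonoid_add M" "separates T M" "\<And>t. t \<in> T \<Longrightarrow> \<not> separates (T - {t}) M"
  shows "krull_dim (alg_ring M :: ('n::finite, 'k::field) mpoly ring) = enat (card T)"
  by (rule antisym[OF krull_dim_alg_ring_le[OF assms(1,2)] krull_dim_alg_ring_ge[OF assms]])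

section \<open>The fiber cone of an equigenerated monomial ideal\<close>

definition unit_exps :: "'n exps set" where
  "unit_exps = range (\<lambda>i. Poly_Mapping.single i 1)"

lemma irrelevant_ideal_eq: "irrelevant_ideal = (mon_ideal unit_exps :: ('n, 'k::field) mpoly set)"
proof -
  have "range mvar = (xpow ` unit_exps :: ('n, 'k) mpoly set)"
    by (auto simp: mvar_def xpow_def unit_exps_def image_image)
  then show ?thesis by (simp add: irrelevant_ideal_def Idl_xpow)
qed

lemma mdeg_unit_exps: "u \<in> unit_exps \<Longrightarrow> mdeg u = 1"
  by (auto simp: unit_exps_def mdeg_def lookup_single when_def)

lemma ksum_mdeg:
  assumes "\<And>a. a \<in> U \<Longrightarrow> mdeg a = D" "m \<in> ksum U k"
  shows "mdeg m = k * D"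
  using assms(2) by (induction k arbitrary: m) (auto simp: sumset_def mdeg_add assms(1))

lemma ksum_add: "a \<in> ksum U i \<Longrightarrow> b \<in> ksum U j \<Longrightarrow> a + b \<in> ksum U (i + j)"
proof (induction j arbitrary: b)
  case (Suc j)
  then obtain c d where b: "b = c + d" "c \<in> ksum U j" "d \<in> U" by (auto simp: sumset_def)
  then have "a + c \<in> ksum U (i + j)" using Suc by blast
  moreover have "a + b = (a + c) + d" by (simp add: b add.assoc)
  ultimately have "a + b \<in> sumset (ksum U (i + j)) U" using b(3) unfolding sumset_def by blast
  then show ?case by simp
qed simp

definition cone_monoid :: "('a::comm_monoid_add) set \<Rightarrow> 'a set" where
  "cone_monoid U = (\<Union>k. ksum U k)"

lemma submonoid_cone_monoid: "submonoid_add (cone_monoid U)"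
  unfolding submonoid_add_def cone_monoid_def
proof (intro conjI ballI)
  show "0 \<in> (\<Union>k. ksum U k)" by (rule UN_I[of 0]) auto
qed (use ksum_add in blast)

text \<open>
  The product of the irrelevant ideal with the \<open>k\<close>-th power of the monomial ideal of \<open>U\<close> (\<open>mpower_ideal_eq\<close>).
\<close>

definition mpower_ideal :: "'n exps set \<Rightarrow> nat \<Rightarrow> ('n, 'k::field) mpoly set" where
  "mpower_ideal U k = mon_ideal (sumset unit_exps (ksum U k))"

lemma ideal_mpower_ideal: "ideal (mpower_ideal U k) tring"
  unfolding mpower_ideal_def by (rule ideal_mon_ideal)

lemmas mpower_ideal_closed = ideal_mpower_ideal[unfolded ideal_tring_iff]

lemma mpower_ideal_eq: "irrelevant_ideal \<cdot>\<^bsub>tring\<^esub> mon_ideal (ksum U k) = (mpower_ideal U k :: ('n, 'k::field) mpoly set)"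
  by (simp add: irrelevant_ideal_eq ideal_prod_mon_ideal mpower_ideal_def)

text \<open>
  All exponents in \<open>ksum U k\<close> have the same degree, and every other exponent of the \<open>k\<close>-th power is a proper
  multiple of one of them. So the quotient in degree \<open>k\<close> of the fiber cone has the monomials with exponents in
  \<open>ksum U k\<close> as a basis.
\<close>

lemma mem_mpower_ideal_iff:
  fixes p :: "('n::finite, 'k::field) mpoly"
  assumes "\<And>a. a \<in> U \<Longrightarrow> mdeg a = D"
  shows "p \<in> mpower_ideal U k \<longleftrightarrow> p \<in> mon_ideal (ksum U k) \<and> part (ksum U k) p = 0"
proof
  assume p: "p \<in> mpower_ideal U k"
  have *: "\<exists>a\<in>ksum U k. \<exists>u\<in>unit_exps. \<exists>b. m = a + (u + b)" if m: "m \<in> keys p" for m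
  proof -
    obtain c b where "c \<in> sumset unit_exps (ksum U k)" "m = c + b"
      using p m unfolding mpower_ideal_def mon_ideal_def by blast
    moreover from this obtain u a where "u \<in> unit_exps" "a \<in> ksum U k" "c = u + a" by (auto simp: sumset_def)
    ultimately have "m = a + (u + b)" by (simp add: algebra_simps)
    then show ?thesis using \<open>u \<in> unit_exps\<close> \<open>a \<in> ksum U k\<close> by blast
  qed
  have "p \<in> mon_ideal (ksum U k)" unfolding mon_ideal_def using * by blast
  moreover have "keys p \<inter> ksum U k = {}"
  proof (rule ccontr)
    assume "keys p \<inter> ksum U k \<noteq> {}"
    then obtain m where m: "m \<in> keys p" "m \<in> ksum U k" by blast
    then obtain a u b where aub: "a \<in> ksum U k" "u \<in> unit_exps" "m = a + (u + b)" using * by blast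
    then have "mdeg m = k * D + (1 + mdeg b)"
      using ksum_mdeg[OF assms aub(1)] mdeg_unit_exps[OF aub(2)] by (simp add: mdeg_add)
    then show False using ksum_mdeg[OF assms m(2)] by simp
  qed
  then have "part (ksum U k) p = 0"
    by (intro poly_mapping_eqI) (auto simp: lookup_part in_keys_iff)
  ultimately show "p \<in> mon_ideal (ksum U k) \<and> part (ksum U k) p = 0" by blast
next
  assume p: "p \<in> mon_ideal (ksum U k) \<and> part (ksum U k) p = 0"
  show "p \<in> mpower_ideal U k"
    unfolding mpower_ideal_def mon_ideal_def mem_Collect_eq
  proof
    fix m assume m: "m \<in> keys p"
    then obtain a b where ab: "a \<in> ksum U k" "m = a + b" using p unfolding mon_ideal_def by blast
    have "m \<notin> ksum U k" using p m keys_part[of "ksum U k" p] by auto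
    then have "b \<noteq> 0" using ab by auto
    then obtain i where i: "lookup b i \<noteq> 0" by (auto simp: poly_mapping_eq_iff fun_eq_iff)
    have "b = Poly_Mapping.single i 1 + (b - Poly_Mapping.single i 1)"
      by (rule poly_mapping_eqI) (use i in \<open>auto simp: lookup_add lookup_minus lookup_single when_def\<close>)
    then have "m = (Poly_Mapping.single i 1 + a) + (b - Poly_Mapping.single i 1)"
      using ab by (simp add: algebra_simps)
    moreover have "Poly_Mapping.single i 1 + a \<in> sumset unit_exps (ksum U k)"
      using ab by (auto simp: sumset_def unit_exps_def)
    ultimately show "\<exists>c\<in>sumset unit_exps (ksum U k). \<exists>b. m = c + b" by blast
  qed
qed

definition mpower_coset :: "'n exps set \<Rightarrow> nat \<Rightarrow> ('n, 'k::field) mpoly \<Rightarrow> ('n, 'k) mpoly set" where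
  "mpower_coset U k a = (\<lambda>j. j + a) ` mpower_ideal U k"

lemma a_r_coset_mpower_ideal: "mpower_ideal U k +>\<^bsub>tring\<^esub> a = mpower_coset U k a"
  by (auto simp: a_r_coset_def' mpower_coset_def)

lemma mpower_coset_eqI: "a - b \<in> mpower_ideal U k \<Longrightarrow> mpower_coset U k a = mpower_coset U k (b :: ('n, 'k::field) mpoly)"
proof -
  assume ab: "a - b \<in> mpower_ideal U k"
  have sub: "mpower_coset U k a \<subseteq> mpower_coset U k b" if "a - b \<in> mpower_ideal U k" for a b :: "('n, 'k) mpoly"
  proof
    fix x assume "x \<in> mpower_coset U k a"
    then obtain j where j: "j \<in> mpower_ideal U k" "x = j + a" by (auto simp: mpower_coset_def)
    then have "x = (j + (a - b)) + b" "j + (a - b) \<in> mpower_ideal U k" using mpower_ideal_closed that by auto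
    then show "x \<in> mpower_coset U k b" unfolding mpower_coset_def by blast
  qed
  have "-1 * (a - b) \<in> mpower_ideal U k" using mpower_ideal_closed ab by blast
  then have "b - a \<in> mpower_ideal U k" by simp
  then show ?thesis using sub ab by blast
qed

lemma mpower_coset_self: "a \<in> mpower_coset U k a"
  unfolding mpower_coset_def using mpower_ideal_closed[of U k] by (intro image_eqI[of _ _ 0]) auto

lemma mpower_coset_eqD: "mpower_coset U k a = mpower_coset U k b \<Longrightarrow> a - b \<in> mpower_ideal U k"
  using mpower_coset_self[of a U k] by (auto simp: mpower_coset_def)

lemma part_in_mon_ideal: "part S p \<in> mon_ideal S"
  unfolding mon_ideal_def by (auto simp: keys_part intro!: bexI exI[of _ 0])

lemma part_part [simp]: "part S (part S p) = part S p"
  by (rule poly_mapping_eqI) (simp add: lookup_part)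

lemma part_minus: "part S (p - q) = part S p - part S q"
  by (rule poly_mapping_eqI) (simp add: lookup_part lookup_minus)

lemma mon_ideal_minus: "p \<in> mon_ideal S \<Longrightarrow> q \<in> mon_ideal S \<Longrightarrow> p - q \<in> mon_ideal S"
  unfolding mon_ideal_def using keys_diff[of p q] by blast

lemma mpower_coset_part:
  fixes a :: "('n::finite, 'k::field) mpoly"
  assumes "\<And>a. a \<in> U \<Longrightarrow> mdeg a = D" "a \<in> mon_ideal (ksum U k)"
  shows "mpower_coset U k (part (ksum U k) a) = mpower_coset U k a"
proof (rule mpower_coset_eqI)
  show "part (ksum U k) a - a \<in> mpower_ideal U k"
    by (subst mem_mpower_ideal_iff[OF assms(1)])
      (simp_all add: part_minus mon_ideal_minus[OF part_in_mon_ideal assms(2)])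
qed

lemma rcoset_mult_mpower_coset:
  fixes a b :: "('n::finite, 'k::field) mpoly"
  assumes "a \<in> mon_ideal (ksum U i)" "b \<in> mon_ideal (ksum U j)" "i + j = k"
  shows "rcoset_mult tring (mpower_ideal U k) (mpower_coset U i a) (mpower_coset U j b) = mpower_coset U k (a * b)"
proof -
  have ss: "sumset (ksum U i) (ksum U j) \<subseteq> ksum U k"
    using ksum_add[of _ U i _ j] assms(3) by (auto simp: sumset_def)
  have mono: "mon_ideal S \<subseteq> mon_ideal S'" if "S \<subseteq> S'" for S S' :: "'n exps set"
    using that unfolding mon_ideal_def by blast
  have 1: "x * y \<in> mpower_ideal U k" if "x \<in> mpower_ideal U i" "y \<in> mon_ideal (ksum U j)" for x y :: "('n, 'k) mpoly"
  proof -
    have "x * y \<in> mon_ideal (sumset (sumset unit_exps (ksum U i)) (ksum U j))"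
      using that unfolding mpower_ideal_def by (rule mon_ideal_mult)
    moreover have "sumset (sumset unit_exps (ksum U i)) (ksum U j) \<subseteq> sumset unit_exps (ksum U k)"
    proof
      fix m assume "m \<in> sumset (sumset unit_exps (ksum U i)) (ksum U j)"
      then obtain u a b where "u \<in> unit_exps" "a \<in> ksum U i" "b \<in> ksum U j" "m = (u + a) + b"
        by (auto simp: sumset_def)
      then have "m = u + (a + b)" "a + b \<in> ksum U k" using ss by (auto simp: sumset_def add.assoc)
      then show "m \<in> sumset unit_exps (ksum U k)" using \<open>u \<in> unit_exps\<close> by (auto simp: sumset_def)
    qed
    ultimately show ?thesis unfolding mpower_ideal_def using mono by blast
  qed
  have 2: "x * y \<in> mpower_ideal U k" if "x \<in> mon_ideal (ksum U i)" "y \<in> mpower_ideal U j" for x y :: "('n, 'k) mpoly"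
  proof -
    have "x * y \<in> mon_ideal (sumset (ksum U i) (sumset unit_exps (ksum U j)))"
      using that unfolding mpower_ideal_def by (rule mon_ideal_mult)
    moreover have "sumset (ksum U i) (sumset unit_exps (ksum U j)) \<subseteq> sumset unit_exps (ksum U k)"
    proof
      fix m assume "m \<in> sumset (ksum U i) (sumset unit_exps (ksum U j))"
      then obtain u a b where "u \<in> unit_exps" "a \<in> ksum U i" "b \<in> ksum U j" "m = a + (u + b)"
        by (auto simp: sumset_def)
      then have "m = u + (a + b)" "a + b \<in> ksum U k" using ss by (auto simp: sumset_def algebra_simps)
      then show "m \<in> sumset unit_exps (ksum U k)" using \<open>u \<in> unit_exps\<close> by (auto simp: sumset_def)
    qed
    ultimately show ?thesis unfolding mpower_ideal_def using mono by blast
  qed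
  have J: "mpower_ideal U i \<subseteq> mon_ideal (ksum U i)"
  proof -
    have "\<exists>a\<in>ksum U i. \<exists>b. m = a + b" if c: "c \<in> sumset unit_exps (ksum U i)" "m = c + b" for m c b
    proof -
      obtain u a where "a \<in> ksum U i" "c = u + a" using c(1) unfolding sumset_def by blast
      then have "m = a + (u + b)" using c(2) by (simp add: algebra_simps)
      then show ?thesis using \<open>a \<in> ksum U i\<close> by blast
    qed
    then show ?thesis unfolding mpower_ideal_def mon_ideal_def by blast
  qed
  have "mpower_coset U k (x * y) = mpower_coset U k (a * b)" if xy: "x \<in> mpower_coset U i a" "y \<in> mpower_coset U j b" for x y
  proof -
    obtain p q where p: "p \<in> mpower_ideal U i" "x = p + a" and q: "q \<in> mpower_ideal U j" "y = q + b"
      using xy unfolding mpower_coset_def by blast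
    have "x * y - a * b = p * b + (p * q + a * q)" by (simp add: p q algebra_simps)
    moreover have "p * b \<in> mpower_ideal U k" "p * q \<in> mpower_ideal U k" "a * q \<in> mpower_ideal U k"
      using 1[OF p(1) assms(2)] 2[OF _ q(1)] J p(1) assms(1) by blast+
    ultimately have "x * y - a * b \<in> mpower_ideal U k" using mpower_ideal_closed by metis
    then show ?thesis by (rule mpower_coset_eqI)
  qed
  note const = this
  have "(\<Union>x\<in>mpower_coset U i a. \<Union>y\<in>mpower_coset U j b. mpower_coset U k (x * y)) =
      (\<Union>x\<in>mpower_coset U i a. \<Union>y\<in>mpower_coset U j b. mpower_coset U k (a * b))"
    by (intro SUP_cong refl const)
  moreover have "mpower_coset U i a \<noteq> {}" "mpower_coset U j b \<noteq> {}"
    using mpower_coset_self[of a U i] mpower_coset_self[of b U j] by blast+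
  ultimately show ?thesis
    by (simp only: rcoset_mult_def a_r_coset_mpower_ideal tring_simps UN_constant if_False)
qed

lemma finsum_tring: "finite A \<Longrightarrow> finsum (tring :: 'a::comm_ring_1 ring) f A = sum f A"
proof (induction rule: finite_induct)
  case empty
  interpret R: cring "tring :: 'a ring" by (rule cring_tring)
  show ?case by simp
next
  case (insert x A)
  interpret R: cring "tring :: 'a ring" by (rule cring_tring)
  show ?case using insert by (subst R.finsum_insert) auto
qed

lemma finsum_mpower_coset:
  fixes f :: "nat \<Rightarrow> ('n, 'k::field) mpoly"
  assumes "finite A"
  shows "finsum (tring Quot mpower_ideal U k) (\<lambda>i. mpower_coset U k (f i)) A = mpower_coset U k (sum f A)"
proof -
  interpret h: ring_hom_ring "tring :: ('n, 'k) mpoly ring" "tring Quot mpower_ideal U k"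
      "(+>\<^bsub>tring\<^esub>) (mpower_ideal U k)"
    by (rule ideal.rcos_ring_hom_ring[OF ideal_mpower_ideal])
  show ?thesis
    using h.hom_finsum[of f A] by (simp add: a_r_coset_mpower_ideal finsum_tring[OF assms] comp_def)
qed

lemma set_add_mpower_coset: "mpower_coset U k a \<oplus>\<^bsub>tring Quot mpower_ideal U k\<^esub> mpower_coset U k b = mpower_coset U k (a + b)"
  using ideal.rcos_ring_hom_ring[OF ideal_mpower_ideal[of U k]] ring_hom_add[OF ideal.rcos_ring_hom[OF ideal_mpower_ideal[of U k]], of a b]
  by (simp add: a_r_coset_mpower_ideal)

lemma mpower_coset_in_carrier: "mpower_coset U k a \<in> carrier (tring Quot mpower_ideal U k)"
  using ring_hom_closed[OF ideal.rcos_ring_hom[OF ideal_mpower_ideal[of U k]], of a] by (simp add: a_r_coset_mpower_ideal)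

text \<open>
  The isomorphism from the monoid algebra to the fiber cone: the graded pieces of a polynomial, as cosets.
\<close>

definition to_fiber :: "('n::finite) exps set \<Rightarrow> ('n, 'k::field) mpoly \<Rightarrow> nat \<Rightarrow> ('n, 'k) mpoly set" where
  "to_fiber U p k = mpower_coset U k (part (ksum U k) p)"

lemma fiber_cone_mon_ideal:
  "fiber_cone tring irrelevant_ideal (mon_ideal U :: ('n::finite, 'k::field) mpoly set) =
    \<lparr> carrier = {f. (\<forall>k. f k \<in> mpower_coset U k ` mon_ideal (ksum U k)) \<and> finite {k. f k \<noteq> mpower_ideal U k}},
      monoid.mult = (\<lambda>f g k. \<Oplus>\<^bsub>tring Quot mpower_ideal U k\<^esub>i\<in>{..k}. rcoset_mult tring (mpower_ideal U k) (f i) (g (k - i))),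
      one = (\<lambda>k. if k = 0 then mpower_coset U 0 1 else mpower_ideal U k),
      zero = mpower_ideal U,
      add = (\<lambda>f g k. f k \<oplus>\<^bsub>tring Quot mpower_ideal U k\<^esub> g k) \<rparr>"
  unfolding fiber_cone_def Let_def ideal_power_mon_ideal mpower_ideal_eq a_r_coset_mpower_ideal tring_simps(3) by simp

lemma mpower_coset_0: "mpower_coset U k 0 = mpower_ideal U k"
  by (simp add: mpower_coset_def)

lemma ksum_disjoint:
  assumes "\<And>a. a \<in> U \<Longrightarrow> mdeg a = D" "D > 0" "m \<in> ksum U i" "m \<in> ksum U j"
  shows "i = j"
  using ksum_mdeg[OF assms(1,3)] ksum_mdeg[OF assms(1,4)] assms(2) by simp

lemma part_eq_self: "keys p \<subseteq> S \<Longrightarrow> part S p = p"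
  by (rule poly_mapping_eqI) (auto simp: lookup_part in_keys_iff)

lemma part_eq_0: "keys p \<inter> S = {} \<Longrightarrow> part S p = 0"
  by (rule poly_mapping_eqI) (auto simp: lookup_part in_keys_iff)

lemma part_sum: "part S (sum f A) = (\<Sum>x\<in>A. part S (f x))"
  by (induction A rule: infinite_finite_induct) (auto simp: part_add)

lemma part_ksum_part:
  assumes "\<And>a. a \<in> U \<Longrightarrow> mdeg a = D" "D > 0"
  shows "part (ksum U k) (part (ksum U j) p) = (if j = k then part (ksum U k) p else 0)"
proof (cases "j = k")
  case False
  then have "ksum U j \<inter> ksum U k = {}" using ksum_disjoint[OF assms] by blast
  then show ?thesis using False by (simp add: part_eq_0 keys_part Int_assoc)
qed simp

lemma part_high_degree:
  assumes "\<And>a. a \<in> U \<Longrightarrow> mdeg a = D" "D > 0" "\<forall>m\<in>keys p. mdeg m < n" "n \<le> k"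
  shows "part (ksum U k) p = 0"
proof (rule part_eq_0, rule ccontr)
  assume "keys p \<inter> ksum U k \<noteq> {}"
  then obtain m where "m \<in> keys p" "m \<in> ksum U k" by blast
  then have "k * D < n" using assms(3) ksum_mdeg[OF assms(1)] by force
  moreover have "k * 1 \<le> k * D" using assms(2) by (intro mult_le_mono2) simp
  ultimately show False using assms(4) by simp
qed

lemma cone_decomposition:
  assumes "\<And>a. a \<in> U \<Longrightarrow> mdeg a = D" "D > 0" "p \<in> subalg (cone_monoid U)"
    "\<forall>m\<in>keys p. mdeg m < n"
  shows "p = (\<Sum>i<n. part (ksum U i) p)"
proof (rule poly_mapping_eqI)
  fix m
  show "lookup p m = lookup (\<Sum>i<n. part (ksum U i) p) m"
  proof (cases "m \<in> keys p")
    case True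
    then obtain j where j: "m \<in> ksum U j" using assms(3) by (auto simp: subalg_def cone_monoid_def)
    have "part (ksum U j) p \<noteq> 0"
      using True j keys_part[of "ksum U j" p] by auto
    then have jn: "j < n" using part_high_degree[OF assms(1,2,4)] by (meson not_le)
    have "lookup (\<Sum>i<n. part (ksum U i) p) m = (\<Sum>i<n. if i = j then lookup p m else 0)"
      unfolding lookup_sum lookup_part
      by (rule sum.cong) (use j ksum_disjoint[OF assms(1,2)] in auto)
    then show ?thesis using jn by simp
  next
    case False
    then have "lookup p m = 0" by (simp add: in_keys_iff)
    then have "lookup (part (ksum U i) p) m = 0" for i by (simp add: lookup_part)
    then show ?thesis using \<open>lookup p m = 0\<close> by (simp add: lookup_sum)
  qed
qed

lemma degree_bound:
  fixes p q :: "('n::finite, 'k::zero) mpoly"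
  shows "\<exists>n>k. (\<forall>m\<in>keys p. mdeg m < n) \<and> (\<forall>m\<in>keys q. mdeg m < n)"
proof -
  let ?n = "Suc (k + (\<Sum>m\<in>keys p. mdeg m) + (\<Sum>m\<in>keys q. mdeg m))"
  have "mdeg m < ?n" if "m \<in> keys p" for m
    using member_le_sum[of m "keys p" mdeg] that by simp
  moreover have "mdeg m < ?n" if "m \<in> keys q" for m
    using member_le_sum[of m "keys q" mdeg] that by simp
  ultimately show ?thesis by (intro exI[of _ ?n]) auto
qed

lemma part_mult_cone:
  fixes p q :: "('n::finite, 'k::field) mpoly"
  assumes U: "\<And>a. a \<in> U \<Longrightarrow> mdeg a = D" "D > 0"
    and p: "p \<in> subalg (cone_monoid U)" and q: "q \<in> subalg (cone_monoid U)"
  shows "part (ksum U k) (p * q) = (\<Sum>i\<le>k. part (ksum U i) p * part (ksum U (k - i)) q)"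
proof -
  obtain n where n: "k < n" "\<forall>m\<in>keys p. mdeg m < n" "\<forall>m\<in>keys q. mdeg m < n"
    using degree_bound[of k p q] by blast
  define f where "f i = part (ksum U i) p" for i
  define g where "g i = part (ksum U i) q" for i
  have keys: "keys (f i * g j) \<subseteq> ksum U (i + j)" for i j
    using keys_mult[of "f i" "g j"] ksum_add unfolding f_def g_def keys_part by blast
  have trm: "part (ksum U k) (f i * g j) = (if i + j = k then f i * g j else 0)" for i j
  proof (cases "i + j = k")
    case True
    then show ?thesis using keys[of i j] by (simp add: part_eq_self)
  next
    case False
    then have "ksum U (i + j) \<inter> ksum U k = {}" using ksum_disjoint[OF U] by blast
    then show ?thesis using False keys[of i j] by (simp add: part_eq_0 disjoint_iff subset_iff)
  qed
  have "p * q = (\<Sum>i<n. f i) * (\<Sum>j<n. g j)"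
    unfolding f_def g_def using cone_decomposition[OF U p n(2)] cone_decomposition[OF U q n(3)] by simp
  then have "part (ksum U k) (p * q) = (\<Sum>i<n. \<Sum>j<n. if i + j = k then f i * g j else 0)"
    by (simp add: sum_product part_sum trm)
  also have "\<dots> = (\<Sum>i<n. if i \<le> k then f i * g (k - i) else 0)"
  proof (rule sum.cong[OF refl])
    fix i assume "i \<in> {..<n}"
    have "(\<Sum>j<n. if i + j = k then f i * g j else 0) = (\<Sum>j<n. if j = k - i then (if i \<le> k then f i * g (k - i) else 0) else 0)"
      by (rule sum.cong) auto
    also have "\<dots> = (if i \<le> k then f i * g (k - i) else 0)" using n(1) by (cases "i \<le> k") auto
    finally show "(\<Sum>j<n. if i + j = k then f i * g j else 0) = (if i \<le> k then f i * g (k - i) else 0)" .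
  qed
  also have "\<dots> = (\<Sum>i\<le>k. f i * g (k - i))"
    by (rule sum.mono_neutral_cong_right) (use n(1) in auto)
  finally show ?thesis by (simp add: f_def g_def)
qed

theorem fiber_cone_iso:
  fixes U :: "('n::finite) exps set"
  assumes U: "\<And>a. a \<in> U \<Longrightarrow> mdeg a = D" "D > 0"
  shows "to_fiber U \<in> ring_iso (alg_ring (cone_monoid U))
    (fiber_cone tring irrelevant_ideal (mon_ideal U :: ('n, 'k::field) mpoly set))"
  unfolding fiber_cone_mon_ideal
proof (rule ring_iso_memI; simp)
  let ?A = "subalg (cone_monoid U) :: ('n, 'k) mpoly set"
  have closed: "to_fiber U p k \<in> mpower_coset U k ` mon_ideal (ksum U k)" for p :: "('n, 'k) mpoly" and k
    unfolding to_fiber_def by (rule imageI[OF part_in_mon_ideal])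
  have fin: "finite {k. to_fiber U p k \<noteq> mpower_ideal U k}" for p :: "('n, 'k) mpoly"
  proof -
    obtain n where n: "\<forall>m\<in>keys p. mdeg m < n"
      using degree_bound[of 0 p p] by blast
    have "{k. to_fiber U p k \<noteq> mpower_ideal U k} \<subseteq> {..<n}"
    proof
      fix k assume k: "k \<in> {k. to_fiber U p k \<noteq> mpower_ideal U k}"
      have "part (ksum U k) p = 0" if "n \<le> k"
        by (rule part_high_degree[OF U n that])
      then show "k \<in> {..<n}" using k by (auto simp: to_fiber_def mpower_coset_0 not_le[symmetric] simp del: not_le)
    qed
    then show ?thesis by (rule finite_subset) simp
  qed
  show "(\<forall>k. to_fiber U p k \<in> mpower_coset U k ` mon_ideal (ksum U k)) \<and> finite {k. to_fiber U p k \<noteq> mpower_ideal U k}"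
    if "p \<in> ?A" for p using closed fin by blast
  show "to_fiber U (p * q) = (\<lambda>k. \<Oplus>\<^bsub>tring Quot mpower_ideal U k\<^esub>i\<in>{..k}.
      rcoset_mult tring (mpower_ideal U k) (to_fiber U p i) (to_fiber U q (k - i)))"
    if pq: "p \<in> ?A" "q \<in> ?A" for p q
  proof
    fix k
    interpret Q: ring "tring Quot (mpower_ideal U k :: ('n, 'k) mpoly set)"
      by (rule ideal.quotient_is_ring[OF ideal_mpower_ideal])
    have "(\<Oplus>\<^bsub>tring Quot mpower_ideal U k\<^esub>i\<in>{..k}. rcoset_mult tring (mpower_ideal U k) (to_fiber U p i) (to_fiber U q (k - i)))
        = (\<Oplus>\<^bsub>tring Quot mpower_ideal U k\<^esub>i\<in>{..k}. mpower_coset U k (part (ksum U i) p * part (ksum U (k - i)) q))"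
    proof (rule Q.finsum_cong')
      show "(\<lambda>i. mpower_coset U k (part (ksum U i) p * part (ksum U (k - i)) q)) \<in> {..k} \<rightarrow> carrier (tring Quot mpower_ideal U k)"
        by (simp add: mpower_coset_in_carrier)
      fix i assume "i \<in> {..k}"
      then show "rcoset_mult tring (mpower_ideal U k) (to_fiber U p i) (to_fiber U q (k - i)) =
          mpower_coset U k (part (ksum U i) p * part (ksum U (k - i)) q)"
        unfolding to_fiber_def by (intro rcoset_mult_mpower_coset part_in_mon_ideal) simp
    qed simp
    also have "\<dots> = mpower_coset U k (\<Sum>i\<le>k. part (ksum U i) p * part (ksum U (k - i)) q)"
      by (rule finsum_mpower_coset) simp
    also have "\<dots> = to_fiber U (p * q) k"
      by (simp only: to_fiber_def part_mult_cone[OF U pq])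
    finally show "to_fiber U (p * q) k = (\<Oplus>\<^bsub>tring Quot mpower_ideal U k\<^esub>i\<in>{..k}.
      rcoset_mult tring (mpower_ideal U k) (to_fiber U p i) (to_fiber U q (k - i)))" ..
  qed
  show "to_fiber U (p + q) = (\<lambda>k. to_fiber U p k \<oplus>\<^bsub>tring Quot mpower_ideal U k\<^esub> to_fiber U q k)"
    if "p \<in> ?A" "q \<in> ?A" for p q
    unfolding to_fiber_def part_add set_add_mpower_coset ..
  show "to_fiber U (1 :: ('n, 'k) mpoly) = (\<lambda>k. if k = 0 then mpower_coset U 0 1 else mpower_ideal U k)"
  proof
    fix k
    show "to_fiber U 1 k = (if k = 0 then mpower_coset U 0 (1 :: ('n, 'k) mpoly) else mpower_ideal U k)"
    proof (cases "k = 0")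
      case True
      then show ?thesis by (simp add: to_fiber_def part_eq_self)
    next
      case False
      have "part (ksum U k) (1 :: ('n, 'k) mpoly) = 0"
        by (rule part_high_degree[OF U, where n = 1]) (use False in auto)
      then show ?thesis using False by (simp add: to_fiber_def mpower_coset_0)
    qed
  qed
  show "bij_betw (to_fiber U) ?A {f. (\<forall>k. f k \<in> mpower_coset U k ` mon_ideal (ksum U k)) \<and> finite {k. f k \<noteq> mpower_ideal U k}}"
  proof (rule bij_betw_imageI)
    show "inj_on (to_fiber U) ?A"
    proof (rule inj_onI)
      fix p q :: "('n, 'k) mpoly"
      assume pq: "p \<in> ?A" "q \<in> ?A" and eq: "to_fiber U p = to_fiber U q"
      have "part (ksum U k) p = part (ksum U k) q" for k
      proof -
        have "part (ksum U k) p - part (ksum U k) q \<in> mpower_ideal U k"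
          using fun_cong[OF eq, of k] unfolding to_fiber_def by (rule mpower_coset_eqD)
        then have "part (ksum U k) (part (ksum U k) p - part (ksum U k) q) = 0"
          by (subst (asm) mem_mpower_ideal_iff[OF U(1)]) simp_all
        then show ?thesis by (simp add: part_minus)
      qed
      moreover obtain n where n: "\<forall>m\<in>keys p. mdeg m < n" "\<forall>m\<in>keys q. mdeg m < n"
        using degree_bound[of 0 p q] by blast
      ultimately show "p = q"
        using cone_decomposition[OF U pq(1) n(1)] cone_decomposition[OF U pq(2) n(2)] by simp
    qed
    show "to_fiber U ` ?A = {f. (\<forall>k. f k \<in> mpower_coset U k ` mon_ideal (ksum U k)) \<and> finite {k. f k \<noteq> mpower_ideal U k}}"
    proof (intro equalityI subsetI)
      fix f :: "nat \<Rightarrow> ('n, 'k) mpoly set"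
      assume "f \<in> {f. (\<forall>k. f k \<in> mpower_coset U k ` mon_ideal (ksum U k)) \<and> finite {k. f k \<noteq> mpower_ideal U k}}"
      then have f: "\<forall>k. \<exists>a\<in>mon_ideal (ksum U k). f k = mpower_coset U k a" "finite {k. f k \<noteq> mpower_ideal U k}" by blast+
      obtain a where a: "\<And>k. a k \<in> mon_ideal (ksum U k)" "\<And>k. f k = mpower_coset U k (a k)"
        using f(1) by metis
      define K where "K = {k. f k \<noteq> mpower_ideal U k}"
      define p where "p = (\<Sum>k\<in>K. part (ksum U k) (a k))"
      have "p \<in> ?A" unfolding p_def
        by (rule subalg_sum) (auto simp: subalg_def keys_part cone_monoid_def)
      moreover have "to_fiber U p k = f k" for k
      proof -
        have "part (ksum U k) p = (\<Sum>j\<in>K. if j = k then part (ksum U k) (a k) else 0)"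
          unfolding p_def part_sum by (rule sum.cong) (auto simp: part_ksum_part[OF U])
        then have *: "part (ksum U k) p = (if k \<in> K then part (ksum U k) (a k) else 0)"
          using f(2) by (simp add: K_def)
        show ?thesis
        proof (cases "k \<in> K")
          case True
          then show ?thesis using mpower_coset_part[OF U(1) a(1)] a(2) by (simp add: to_fiber_def *)
        next
          case False
          then show ?thesis by (simp add: to_fiber_def * mpower_coset_0 K_def)
        qed
      qed
      ultimately show "f \<in> to_fiber U ` ?A" by (intro image_eqI[of _ _ p]) auto
    qed (use closed fin in auto)
  qed
qed

theorem krull_dim_fiber_cone:
  fixes U :: "('n::finite) exps set"
  assumes U: "\<And>a. a \<in> U \<Longrightarrow> mdeg a = D" "D > 0"
    and T: "separates T (cone_monoid U)" "\<And>t. t \<in> T \<Longrightarrow> \<not> separates (T - {t}) (cone_monoid U)"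
  shows "analytic_spread tring irrelevant_ideal (mon_ideal U :: ('n, 'k::field) mpoly set) = enat (card T)"
proof -
  let ?F = "fiber_cone tring irrelevant_ideal (mon_ideal U :: ('n, 'k) mpoly set)"
  let ?S = "alg_ring (cone_monoid U) :: ('n, 'k) mpoly ring"
  note iso = fiber_cone_iso[OF U, where 'k = 'k]
  have S: "cring ?S" by (rule cring_alg_ring[OF submonoid_cone_monoid])
  have "to_fiber U (0 :: ('n, 'k) mpoly) = mpower_ideal U"
    by (rule ext) (simp add: to_fiber_def mpower_coset_0)
  then have "?F\<lparr>zero := to_fiber U (ring.zero ?S)\<rparr> = ?F"
    unfolding fiber_cone_mon_ideal by simp
  then have "cring ?F" using cring.ring_iso_imp_img_cring[OF S iso] by simp
  then have "krull_dim ?F = krull_dim ?S" using krull_dim_iso[OF iso S] by simp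
  then show ?thesis
    unfolding analytic_spread_def using krull_dim_alg_ring[OF submonoid_cone_monoid T] by simp
qed

section \<open>Freiman edge ideals\<close>

lemma span_incidence_induct:
  "v \<in> vec.span (inc ` F) \<Longrightarrow> P v" if
  "P 0" "\<And>x y. P x \<Longrightarrow> P y \<Longrightarrow> P (x + y)" "\<And>c x. P x \<Longrightarrow> P (c *s x)" "\<And>e. e \<in> F \<Longrightarrow> P (inc e)"
  for v :: "rat ^ 'n::finite"
  by (induction rule: vec.span_induct_alt) (use that in auto)

definition edge_exp :: "'n set \<Rightarrow> 'n \<Rightarrow>\<^sub>0 nat" where
  "edge_exp e = (\<Sum>i\<in>e. Poly_Mapping.single i 1)"

lemma lookup_edge_exp: "finite e \<Longrightarrow> lookup (edge_exp e) i = (if i \<in> e then 1 else 0)"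
  unfolding edge_exp_def lookup_sum by (simp add: lookup_single when_def)

lemma mdeg_edge_exp: "mdeg (edge_exp (e :: 'n::finite set)) = card e"
  unfolding mdeg_def by (simp add: lookup_edge_exp sum.If_cases)

definition rvec :: "('n::finite) exps \<Rightarrow> rat ^ 'n" where
  "rvec m = (\<chi> i. of_nat (lookup m i))"

lemma rvec_add: "rvec (a + b) = rvec a + rvec b"
  by (simp add: rvec_def vec_eq_iff lookup_add)

lemma rvec_0 [simp]: "rvec 0 = 0"
  by (simp add: rvec_def vec_eq_iff)

lemma rvec_edge_exp: "rvec (edge_exp e) = inc e"
  by (simp add: rvec_def inc_def vec_eq_iff lookup_edge_exp)

lemma inj_rvec: "inj rvec"
  by (rule injI) (simp add: rvec_def vec_eq_iff poly_mapping_eq_iff fun_eq_iff)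

lemma edge_ideal_eq:
  assumes "simple_graph E"
  shows "edge_ideal E = (mon_ideal (edge_exp ` E) :: ('n::finite, 'k::field) mpoly set)"
proof -
  have "{mvar i * mvar j | i j. {i, j} \<in> E} = (xpow ` edge_exp ` E :: ('n, 'k) mpoly set)"
  proof -
    have eq: "mvar i * mvar j = (xpow (edge_exp {i, j}) :: ('n, 'k) mpoly)" if "{i, j} \<in> E" for i j
      using simple_graph_no_loop[OF assms that]
      by (simp add: mvar_def xpow_def mult_single edge_exp_def)
    have "\<exists>i j. e = {i, j} \<and> {i, j} \<in> E" if e: "e \<in> E" for e
    proof -
      have "card e = 2" using assms e by (simp add: simple_graph_def)
      then obtain i j where "e = {i, j}" by (meson card_2_iff)
      then show ?thesis using e by blast
    qed
    note split = this
    show ?thesis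
    proof (intro equalityI subsetI)
      fix x :: "('n, 'k) mpoly" assume "x \<in> {mvar i * mvar j | i j. {i, j} \<in> E}"
      then obtain i j where "x = mvar i * mvar j" "{i, j} \<in> E" by blast
      then show "x \<in> xpow ` edge_exp ` E" using eq by simp
    next
      fix x :: "('n, 'k) mpoly" assume "x \<in> xpow ` edge_exp ` E"
      then obtain e where e: "e \<in> E" "x = xpow (edge_exp e)" by blast
      then obtain i j where ij: "e = {i, j}" "{i, j} \<in> E" using split by blast
      then have "x = mvar i * mvar j" using e(2) eq by simp
      then show "x \<in> {mvar i * mvar j | i j. {i, j} \<in> E}" using ij(2) by blast
    qed
  qed
  then show ?thesis by (simp add: edge_ideal_def Idl_xpow)
qed

lemma rvec_ksum:
  "m \<in> ksum (edge_exp ` E) k \<Longrightarrow> rvec m \<in> vec.span (inc ` E)"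
proof (induction k arbitrary: m)
  case 0
  then show ?case by (simp add: vec.span_zero)
next
  case (Suc k)
  then obtain a e where "m = a + edge_exp e" "a \<in> ksum (edge_exp ` E) k" "e \<in> E"
    by (auto simp: sumset_def)
  then show ?case
    using Suc.IH by (simp add: rvec_add rvec_edge_exp vec.span_add vec.span_base)
qed

lemma cone_nat_mult: "m \<in> cone_monoid U \<Longrightarrow> \<exists>m'\<in>cone_monoid U. rvec m' = of_nat n *s rvec (m :: 'n::finite \<Rightarrow>\<^sub>0 nat)"
proof (induction n)
  case 0
  then show ?case using submonoid_cone_monoid[of U] by (auto simp: submonoid_add_def intro!: bexI[of _ 0])
next
  case (Suc n)
  then obtain m' where "m' \<in> cone_monoid U" "rvec m' = of_nat n *s rvec m" by blast
  then show ?case using submonoid_cone_monoid[of U] Suc.prems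
    by (intro bexI[of _ "m + m'"])
      (auto simp: submonoid_add_def rvec_add vec_eq_iff algebra_simps)
qed

text \<open>
  Sums and rational multiples of such vectors are of the same form, with the product of the denominators as
  factor; a negative multiple exchanges the two points of the monoid.
\<close>

lemma span_clear_denominators:
  fixes E :: "'n::finite set set"
  assumes "v \<in> vec.span (inc ` E)"
  shows "\<exists>N::nat. N > 0 \<and> (\<exists>m\<in>cone_monoid (edge_exp ` E). \<exists>m'\<in>cone_monoid (edge_exp ` E).
    of_nat N *s v = rvec m - rvec m')"
proof (rule span_incidence_induct[OF _ _ _ _ assms])
  let ?M = "cone_monoid (edge_exp ` E)"
  let ?P = "\<lambda>v. \<exists>N::nat. N > 0 \<and> (\<exists>m\<in>?M. \<exists>m'\<in>?M. of_nat N *s v = rvec m - rvec m')"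
  have M: "0 \<in> ?M" "\<And>a b. a \<in> ?M \<Longrightarrow> b \<in> ?M \<Longrightarrow> a + b \<in> ?M"
    using submonoid_cone_monoid[of "edge_exp ` E"] by (auto simp: submonoid_add_def)
  show "?P 0" using M(1) by (intro exI[of _ 1] conjI bexI[of _ 0]) auto
  show "?P (inc e)" if "e \<in> E" for e
  proof -
    have "edge_exp e \<in> ksum (edge_exp ` E) 1" using that by (auto simp: sumset_def)
    then have "edge_exp e \<in> ?M" unfolding cone_monoid_def by blast
    then show ?thesis using M(1)
      by (intro exI[of _ 1] conjI bexI[of _ 0] bexI[of _ "edge_exp e"]) (auto simp: rvec_edge_exp)
  qed
  show "?P (x + y)" if xP: "?P x" and yP: "?P y" for x y
  proof -
    obtain N a a' where x: "N > 0" "a \<in> ?M" "a' \<in> ?M" "of_nat N *s x = rvec a - rvec a'" using xP by blast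
    obtain K b b' where y: "K > 0" "b \<in> ?M" "b' \<in> ?M" "of_nat K *s y = rvec b - rvec b'" using yP by blast
    obtain c where c: "c \<in> ?M" "rvec c = of_nat K *s rvec a" using cone_nat_mult[OF x(2)] by blast
    obtain c' where c': "c' \<in> ?M" "rvec c' = of_nat K *s rvec a'" using cone_nat_mult[OF x(3)] by blast
    obtain d where d: "d \<in> ?M" "rvec d = of_nat N *s rvec b" using cone_nat_mult[OF y(2)] by blast
    obtain d' where d': "d' \<in> ?M" "rvec d' = of_nat N *s rvec b'" using cone_nat_mult[OF y(3)] by blast
    have "of_nat (N * K) *s (x + y) = of_nat K *s (of_nat N *s x) + of_nat N *s (of_nat K *s y)"
      by (simp add: vec_eq_iff algebra_simps)
    also have "\<dots> = rvec (c + d) - rvec (c' + d')"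
      unfolding x(4) y(4) rvec_add c d c' d' by (simp add: vec_eq_iff algebra_simps)
    finally show ?thesis
      using x(1) y(1) M(2)[OF c(1) d(1)] M(2)[OF c'(1) d'(1)]
      by (intro exI[of _ "N * K"] conjI bexI[of _ "c' + d'"] bexI[of _ "c + d"]) auto
  qed
  show "?P (r *s x)" if xP: "?P x" for r x
  proof -
    obtain N a a' where x: "N > 0" "a \<in> ?M" "a' \<in> ?M" "of_nat N *s x = rvec a - rvec a'" using xP by blast
    obtain p q where r: "r = of_int p / of_int q" "q > 0" by (cases r) (auto simp: Fract_of_int_quotient)
    obtain c where c: "c \<in> ?M" "rvec c = of_nat (nat \<bar>p\<bar>) *s rvec a" using cone_nat_mult[OF x(2)] by blast
    obtain c' where c': "c' \<in> ?M" "rvec c' = of_nat (nat \<bar>p\<bar>) *s rvec a'" using cone_nat_mult[OF x(3)] by blast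
    have *: "of_nat (N * nat q) *s (r *s x) = of_int p *s (of_nat N *s x)"
      using r(2) by (simp add: vec_eq_iff r(1) field_simps)
    have pos: "N * nat q > 0" using x(1) r(2) by simp
    show ?thesis
    proof (cases "p \<ge> 0")
      case True
      then have "of_nat (N * nat q) *s (r *s x) = rvec c - rvec c'"
        unfolding * x(4) c c' by (simp add: vec_eq_iff algebra_simps)
      then show ?thesis using pos c(1) c'(1) by blast
    next
      case False
      then have "of_nat (N * nat q) *s (r *s x) = rvec c' - rvec c"
        unfolding * x(4) c c' by (simp add: vec_eq_iff algebra_simps)
      then show ?thesis using pos c(1) c'(1) by blast
    qed
  qed
qed

text \<open>
  After clearing denominators, a vector of the span that vanishes on \<open>T\<close> is a difference of two points of the
  monoid that agree on \<open>T\<close>.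
\<close>

lemma separates_span:
  fixes E :: "'n::finite set set"
  assumes T: "separates T (cone_monoid (edge_exp ` E))" and v: "v \<in> vec.span (inc ` E)" "\<forall>i\<in>T. v $ i = 0"
  shows "v = 0"
proof -
  obtain N m m' where N: "N > 0" and m: "m \<in> cone_monoid (edge_exp ` E)" "m' \<in> cone_monoid (edge_exp ` E)"
    and eq: "of_nat N *s v = rvec m - rvec m'"
    using span_clear_denominators[OF v(1)] by blast
  have "lookup m i = lookup m' i" if "i \<in> T" for i
  proof -
    have "(of_nat N *s v) $ i = 0" using v(2) that by simp
    then show ?thesis unfolding eq by (simp add: rvec_def)
  qed
  then have "m = m'" using T m unfolding separates_def by blast
  then have "of_nat N *s v = 0" using eq by simp
  then show ?thesis using N by (simp add: vec_eq_iff)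
qed

text \<open>
  Restricting to the coordinates \<open>T\<close> is injective on the span of the edges. By minimality of \<open>T\<close> the span contains,
  for each \<open>t \<in> T\<close>, a vector whose only nonzero coordinate in \<open>T\<close> is the one at \<open>t\<close>. These vectors form a basis.
\<close>

lemma card_minimal_separating:
  fixes E :: "'n::finite set set"
  assumes T: "separates T (cone_monoid (edge_exp ` E))"
    and min: "\<And>t. t \<in> T \<Longrightarrow> \<not> separates (T - {t}) (cone_monoid (edge_exp ` E))"
  shows "card T = edge_rank E"
proof -
  have "\<exists>v. v \<in> vec.span (inc ` E) \<and> v $ t \<noteq> 0 \<and> (\<forall>i\<in>T - {t}. v $ i = 0)" if t: "t \<in> T" for t
  proof -
    obtain m m' where m: "m \<in> cone_monoid (edge_exp ` E)" "m' \<in> cone_monoid (edge_exp ` E)" "m \<noteq> m'"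
      "\<forall>i\<in>T - {t}. lookup m i = lookup m' i"
      using min[OF t] unfolding separates_def by blast
    have "lookup m t \<noteq> lookup m' t"
    proof
      assume "lookup m t = lookup m' t"
      then have "\<forall>i\<in>T. lookup m i = lookup m' i" using m(4) by blast
      then show False using T m unfolding separates_def by blast
    qed
    moreover have "rvec m \<in> vec.span (inc ` E)" "rvec m' \<in> vec.span (inc ` E)"
      using m rvec_ksum unfolding cone_monoid_def by blast+
    then have "rvec m - rvec m' \<in> vec.span (inc ` E)" by (rule vec.span_diff)
    ultimately show ?thesis using m(4) by (intro exI[of _ "rvec m - rvec m'"]) (simp add: rvec_def)
  qed
  then obtain v where v: "\<And>t. t \<in> T \<Longrightarrow> v t \<in> vec.span (inc ` E)" "\<And>t. t \<in> T \<Longrightarrow> v t $ t \<noteq> 0"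
    "\<And>t i. t \<in> T \<Longrightarrow> i \<in> T \<Longrightarrow> i \<noteq> t \<Longrightarrow> v t $ i = 0"
    by (metis Diff_iff singletonD)
  have inj: "inj_on v T"
    by (rule inj_onI) (metis v(2,3))
  have ind: "vec.independent (v ` T)"
  proof
    assume "vec.dependent (v ` T)"
    then obtain u w where u: "(\<Sum>x\<in>v ` T. u x *s x) = 0" "w \<in> v ` T" "u w \<noteq> 0"
      by (auto simp: vec.dependent_finite)
    then obtain t where t: "t \<in> T" "w = v t" by blast
    have "0 = (\<Sum>s\<in>T. u (v s) *s v s) $ t" using u(1) by (simp add: sum.reindex[OF inj])
    also have "\<dots> = (\<Sum>s\<in>T. u (v s) * v s $ t)" by simp
    also have "\<dots> = (\<Sum>s\<in>T. if s = t then u w * v t $ t else 0)"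
      by (rule sum.cong) (use v(3) t in auto)
    also have "\<dots> = u w * v t $ t" using t by simp
    finally show False using u(3) v(2)[OF t(1)] by simp
  qed
  have "inc ` E \<subseteq> vec.span (v ` T)"
  proof clarify
    fix e assume "e \<in> E"
    define w where "w = (\<Sum>t\<in>T. (inc e $ t / v t $ t) *s v t)"
    have w: "w \<in> vec.span (v ` T)" "w \<in> vec.span (inc ` E)"
      unfolding w_def by (auto intro!: vec.span_sum vec.span_scale v(1) intro: vec.span_base)
    have "inc e - w \<in> vec.span (inc ` E)"
      using \<open>e \<in> E\<close> by (intro vec.span_diff w(2) vec.span_base) simp
    moreover have "(inc e - w) $ i = 0" if i: "i \<in> T" for i
    proof -
      have "w $ i = (\<Sum>t\<in>T. inc e $ t / v t $ t * v t $ i)" by (simp add: w_def)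
      also have "\<dots> = (\<Sum>t\<in>T. if t = i then inc e $ i else 0)"
        by (rule sum.cong) (use v(2,3) i in auto)
      finally show ?thesis using i by simp
    qed
    ultimately have "inc e - w = 0" using separates_span[OF T] by blast
    then show "inc e \<in> vec.span (v ` T)" using w(1) by simp
  qed
  moreover have "v ` T \<subseteq> vec.span (inc ` E)" using v(1) by blast
  ultimately have "vec.span (v ` T) = vec.span (inc ` E)"
    by (metis vec.span_eq)
  then have "edge_rank E = vec.dim (v ` T)" unfolding edge_rank_def by (metis vec.dim_span)
  then show ?thesis using vec.dim_eq_card_independent[OF ind] card_image[OF inj] by simp
qed

lemma minimal_separating_exists:
  fixes M :: "('n::finite) exps set"
  shows "\<exists>T. separates T M \<and> (\<forall>t\<in>T. \<not> separates (T - {t}) M)"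
proof -
  have "separates UNIV M" by (simp add: separates_def poly_mapping_eq_iff fun_eq_iff)
  then have "finite {T. separates T M}" "{T. separates T M} \<noteq> {}" by auto
  then obtain T where T: "separates T M" "\<And>T'. separates T' M \<Longrightarrow> T' \<subseteq> T \<Longrightarrow> T = T'"
    using finite_has_minimal[of "{T. separates T M}"] by auto
  have "\<not> separates (T - {t}) M" if "t \<in> T" for t
    using T(2)[of "T - {t}"] that by blast
  then show ?thesis using T(1) by blast
qed

lemma analytic_spread_edge_ideal:
  assumes "simple_graph E"
  shows "analytic_spread mpoly_ring irrelevant_ideal (edge_ideal E :: ('n::finite, 'k::field) mpoly set)
    = enat (edge_rank E)"
proof -
  obtain T where T: "separates T (cone_monoid (edge_exp ` E))"
    "\<And>t. t \<in> T \<Longrightarrow> \<not> separates (T - {t}) (cone_monoid (edge_exp ` E))"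
    using minimal_separating_exists[of "cone_monoid (edge_exp ` E)"] by blast
  have "mdeg a = 2" if "a \<in> edge_exp ` E" for a
    using that assms by (auto simp: mdeg_edge_exp simple_graph_def)
  then have "analytic_spread mpoly_ring irrelevant_ideal (mon_ideal (edge_exp ` E) :: ('n, 'k) mpoly set)
      = enat (card T)"
    by (rule krull_dim_fiber_cone[OF _ _ T]) simp_all
  moreover have "card T = edge_rank E" by (rule card_minimal_separating[OF T])
  ultimately show ?thesis by (simp add: edge_ideal_eq[OF assms])
qed

lemma inj_edge_exp: "inj (edge_exp :: 'n::finite set \<Rightarrow> _)"
  by (rule injI) (metis rvec_edge_exp inj_inc injD)

lemma min_num_gens_edge_ideal:
  assumes "simple_graph E"
  shows "min_num_gens mpoly_ring (edge_ideal E :: ('n::finite, 'k::field) mpoly set) = card E"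
proof -
  have "mdeg a = 2" if "a \<in> edge_exp ` E" for a
    using that assms by (auto simp: mdeg_edge_exp simple_graph_def)
  then have "min_num_gens mpoly_ring (edge_ideal E :: ('n, 'k) mpoly set) = card (edge_exp ` E)"
    unfolding edge_ideal_eq[OF assms] by (intro min_num_gens_mon_ideal) auto
  then show ?thesis by (simp add: card_image[OF inj_on_subset[OF inj_edge_exp subset_UNIV]])
qed

lemma min_num_gens_edge_ideal_square:
  assumes "simple_graph E"
  shows "min_num_gens mpoly_ring (ideal_power mpoly_ring (edge_ideal E :: ('n::finite, 'k::field) mpoly set) 2)
    = card (edge_sums E)"
proof -
  let ?U = "edge_exp ` E"
  have U: "mdeg a = 2" if "a \<in> ?U" for a
    using that assms by (auto simp: mdeg_edge_exp simple_graph_def)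
  have k2: "ksum ?U 2 = (\<lambda>(e, f). edge_exp e + edge_exp f) ` (E \<times> E)"
    by (auto simp: numeral_2_eq_2 sumset_def)
  have fin: "finite (ksum ?U 2)" unfolding k2 by (rule finite_imageI) simp
  have "min_num_gens mpoly_ring (ideal_power mpoly_ring (edge_ideal E :: ('n, 'k) mpoly set) 2)
    = card (ksum ?U 2)"
    unfolding edge_ideal_eq[OF assms] ideal_power_mon_ideal
    by (rule min_num_gens_mon_ideal[OF fin, of 4]) (use ksum_mdeg[of ?U 2, OF U] in auto)
  also have "\<dots> = card (rvec ` ksum ?U 2)"
    by (simp add: card_image[OF inj_on_subset[OF inj_rvec subset_UNIV]])
  also have "rvec ` ksum ?U 2 = edge_sums E"
    unfolding k2 edge_sums_def image_image
    by (intro image_cong refl) (auto simp: rvec_add rvec_edge_exp)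
  finally show ?thesis .
qed

text \<open>
  The terms of \<open>gap\<close> are the number of generators of \<open>I\<^sup>2\<close>, the analytic spread and the number of generators
  of \<open>I\<close>.
\<close>

lemma freiman_graph_iff_gap:
  fixes E :: "'n::finite set set"
  assumes "simple_graph E"
  shows "freiman_graph TYPE('k::field) E \<longleftrightarrow> gap E = 0"
  unfolding freiman_graph_def freiman_ideal_def analytic_spread_edge_ideal[OF assms]
    min_num_gens_edge_ideal[OF assms] min_num_gens_edge_ideal_square[OF assms] gap_def
  by (auto simp: algebra_simps)

theorem theorem2p3:
  fixes E :: "'n::finite set set"
  assumes "simple_graph E" and "connected_graph E"
  shows "freiman_graph TYPE('k::field) E \<longleftrightarrow>
      (\<nexists>W. primitive_even_walk E W) \<or>
      ((\<exists>s. bipartite_of_type (four_cycle_verts E) (four_cycle_edges E) 2 s) \<and>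
       (\<nexists>W. primitive_even_walk E W \<and> walk_length W > 4))"
  using freiman_graph_iff_gap[OF assms(1), where 'k = 'k] gap_zero_iff[OF assms(1)] by blast

end
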